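(* Let $X$ be a Banach lattice such that $X_{uo}^\sim$ separates points of $X$. The following statements are equivalent. (1) The mapping $j:X\to (X_{uo}^\sim)^*$, defined by $j(x)(\phi)=\phi(x)$ for any $x\in X$ and any $\phi\in X_{uo}^\sim$, is a surjective lattice isomorphism. (2) The closed unit ball $B_X$ of $X$ is relatively $\sigma(X,X_{uo}^\sim)$-compact in $X$. (3) $X$ is boundedly uo-complete. (4) $X$ is monotonically complete.
   Context: A net $(x_\alpha)$ in a vector lattice $X$ order converges to $x\in X$ ($x_\alpha\xrightarrow{o}x$) if there is a net $(y_\gamma)$ in $X$ (possibly with a different index set) with $y_\gamma\downarrow 0$ such that for every $\gamma$ there is $\alpha_0$ with $|x_\alpha-x|\le y_\gamma$ for all $\alpha\ge\alpha_0$. The net uo-converges to $x$ if $|x_\alpha-x|\wedge y\xrightarrow{o}0$ for every $y\in X_+$; it is uo-null if it uo-converges to $0$; it is uo-Cauchy if the double net $(x_\alpha-x_\beta)_{(\alpha,\beta)}$ is uo-null. For a Banach lattice $X$, the uo-dual $X_{uo}^\sim$ is the set of all linear functionals $\phi$ on $X$ with $\phi(x_\alpha)\to 0$ for every norm bounded uo-null net $(x_\alpha)$ in $X$; it is a norm closed ideal of $X^*$, and hence a Banach lattice. $X$ is boundedly uo-complete if every norm bounded uo-Cauchy net in $X$ is uo-convergent in $X$. $X$ is monotonically complete if every norm bounded increasing net of positive elements of $X$ has a supremum in $X$. Lattice isomorphisms need not be isometric. *)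

theory Defs
  imports "HOL-Analysis.Analysis" "HOL-Library.Lattice_Algebras" "HOL-Library.Lub_Glb"
begin

section \<open>Banach lattices\<close>

class banach_lattice = banach + ordered_real_vector + lattice_ab_group_add_abs +
  assumes norm_mono_abs: "\<bar>x\<bar> \<le> \<bar>y\<bar> \<Longrightarrow> norm x \<le> norm y"

instance real :: banach_lattice
  by standard simp

section \<open>Nets\<close>

text \<open>The index set of a net is the field of a directed preorder \<open>r\<close>; the pair
  \<open>(\<alpha>, \<beta>) \<in> r\<close> means \<open>\<alpha> \<le> \<beta>\<close>.\<close>

definition directed_preorder :: "'i rel \<Rightarrow> bool" where
  "directed_preorder r \<longleftrightarrow> preorder_on (Field r) r \<and> Field r \<noteq> {} \<and>
     (\<forall>\<alpha>\<in>Field r. \<forall>\<beta>\<in>Field r. \<exists>\<gamma>. (\<alpha>, \<gamma>) \<in> r \<and> (\<beta>, \<gamma>) \<in> r)"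

definition product_preorder :: "'i rel \<Rightarrow> 'k rel \<Rightarrow> ('i \<times> 'k) rel" where
  "product_preorder r s = {((\<alpha>, \<beta>), (\<alpha>', \<beta>')). (\<alpha>, \<alpha>') \<in> r \<and> (\<beta>, \<beta>') \<in> s}"

definition net_filter :: "'i rel \<Rightarrow> 'i filter" where
  "net_filter r = (INF \<alpha>\<in>Field r. principal {\<beta>. (\<alpha>, \<beta>) \<in> r})"

text \<open>HOL cannot quantify over all index types inside a formula, so quantified nets are
  indexed by subsets of the following type. This is no restriction: the lemmas
  \<open>order_converges_toI\<close>, \<open>uo_functionals_tendsto\<close>, \<open>boundedly_uo_completeD\<close> and
  \<open>monotonically_completeD\<close> below extend each definition to nets with arbitrary index type.\<close>

type_synonym 'a net_index = "'a set \<times> 'a"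

definition increasing_net :: "'i rel \<Rightarrow> ('i \<Rightarrow> 'a::order) \<Rightarrow> bool" where
  "increasing_net r x \<longleftrightarrow> (\<forall>\<alpha> \<beta>. (\<alpha>, \<beta>) \<in> r \<longrightarrow> x \<alpha> \<le> x \<beta>)"

definition decreases_to :: "'i rel \<Rightarrow> ('i \<Rightarrow> 'a::order) \<Rightarrow> 'a \<Rightarrow> bool" where
  "decreases_to r y l \<longleftrightarrow>
     (\<forall>\<alpha> \<beta>. (\<alpha>, \<beta>) \<in> r \<longrightarrow> y \<beta> \<le> y \<alpha>) \<and> isGlb UNIV (y ` Field r) l"

section \<open>Order convergence and unbounded order convergence\<close>

definition order_converges :: "'i rel \<Rightarrow> ('i \<Rightarrow> 'a::banach_lattice) \<Rightarrow> 'a \<Rightarrow> bool" where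
  "order_converges r x l \<longleftrightarrow>
     (\<exists>(s :: 'a net_index rel) y. directed_preorder s \<and> decreases_to s y 0 \<and>
        (\<forall>\<gamma>\<in>Field s. \<exists>\<alpha>\<^sub>0\<in>Field r. \<forall>\<alpha>. (\<alpha>\<^sub>0, \<alpha>) \<in> r \<longrightarrow> \<bar>x \<alpha> - l\<bar> \<le> y \<gamma>))"

definition uo_converges :: "'i rel \<Rightarrow> ('i \<Rightarrow> 'a::banach_lattice) \<Rightarrow> 'a \<Rightarrow> bool" where
  "uo_converges r x l \<longleftrightarrow> (\<forall>y\<ge>0. order_converges r (\<lambda>\<alpha>. inf \<bar>x \<alpha> - l\<bar> y) 0)"

definition uo_Cauchy :: "'i rel \<Rightarrow> ('i \<Rightarrow> 'a::banach_lattice) \<Rightarrow> bool" where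
  "uo_Cauchy r x \<longleftrightarrow> uo_converges (product_preorder r r) (\<lambda>(\<alpha>, \<beta>). x \<alpha> - x \<beta>) 0"

definition boundedly_uo_complete :: "'a::banach_lattice itself \<Rightarrow> bool" where
  "boundedly_uo_complete _ \<longleftrightarrow>
     (\<forall>(r :: 'a net_index rel) (x :: 'a net_index \<Rightarrow> 'a).
        directed_preorder r \<and> bounded (x ` Field r) \<and> uo_Cauchy r x \<longrightarrow> (\<exists>l. uo_converges r x l))"

definition monotonically_complete :: "'a::banach_lattice itself \<Rightarrow> bool" where
  "monotonically_complete _ \<longleftrightarrow>
     (\<forall>(r :: 'a net_index rel) (x :: 'a net_index \<Rightarrow> 'a).
        directed_preorder r \<and> bounded (x ` Field r) \<and> (\<forall>\<alpha>\<in>Field r. 0 \<le> x \<alpha>) \<and> increasing_net r x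
        \<longrightarrow> (\<exists>u. isLub UNIV (x ` Field r) u))"

section \<open>The uo-dual\<close>

definition uo_functionals :: "('a::banach_lattice \<Rightarrow> real) set" where
  "uo_functionals = {f. linear f \<and>
     (\<forall>(r :: 'a net_index rel) x.
        directed_preorder r \<and> bounded (x ` Field r) \<and> uo_converges r x 0
        \<longrightarrow> ((\<lambda>\<alpha>. f (x \<alpha>)) \<longlongrightarrow> 0) (net_filter r))}"

text \<open>The uo-dual as a subset of the norm dual. No functional is lost: every member of
  \<^const>\<open>uo_functionals\<close> is bounded, see \<open>blinfun_apply_image_uo_dual\<close> below.\<close>

definition uo_dual :: "('a::banach_lattice \<Rightarrow>\<^sub>L real) set" where
  "uo_dual = {\<phi>. blinfun_apply \<phi> \<in> uo_functionals}"

definition uo_dual_separates_points :: "'a::banach_lattice itself \<Rightarrow> bool" where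
  "uo_dual_separates_points _ \<longleftrightarrow>
     (\<forall>x y :: 'a. x \<noteq> y \<longrightarrow> (\<exists>\<phi>\<in>uo_dual. blinfun_apply \<phi> x \<noteq> blinfun_apply \<phi> y))"

definition uo_weak_topology :: "'a::banach_lattice topology" where
  "uo_weak_topology =
     topology_generated_by {blinfun_apply \<phi> -` U | \<phi> U. \<phi> \<in> uo_dual \<and> open U}"

definition relatively_compact_in :: "'a topology \<Rightarrow> 'a set \<Rightarrow> bool" where
  "relatively_compact_in T S \<longleftrightarrow> compactin T (T closure_of S)"

section \<open>The norm dual of the uo-dual and the evaluation map\<close>

text \<open>The uo-dual carries the norm of \<^typ>\<open>'a \<Rightarrow>\<^sub>L real\<close>. Functionals on it are
  extensional functions, so that equality of functions is equality on \<^const>\<open>uo_dual\<close>.\<close>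

definition uo_dual_dual :: "(('a::banach_lattice \<Rightarrow>\<^sub>L real) \<Rightarrow> real) set" where
  "uo_dual_dual = {F \<in> extensional uo_dual.
     (\<forall>\<phi>\<in>uo_dual. \<forall>\<psi>\<in>uo_dual. F (\<phi> + \<psi>) = F \<phi> + F \<psi>) \<and>
     (\<forall>c. \<forall>\<phi>\<in>uo_dual. F (c *\<^sub>R \<phi>) = c * F \<phi>) \<and>
     (\<exists>C. \<forall>\<phi>\<in>uo_dual. \<bar>F \<phi>\<bar> \<le> C * norm \<phi>)}"

definition nonneg_functional :: "('a::banach_lattice \<Rightarrow>\<^sub>L real) \<Rightarrow> bool" where
  "nonneg_functional \<phi> \<longleftrightarrow> (\<forall>x\<ge>0. 0 \<le> blinfun_apply \<phi> x)"

definition uo_dual_dual_le ::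
    "(('a::banach_lattice \<Rightarrow>\<^sub>L real) \<Rightarrow> real) \<Rightarrow> (('a \<Rightarrow>\<^sub>L real) \<Rightarrow> real) \<Rightarrow> bool" where
  "uo_dual_dual_le F G \<longleftrightarrow> (\<forall>\<phi>\<in>uo_dual. nonneg_functional \<phi> \<longrightarrow> F \<phi> \<le> G \<phi>)"

definition is_join :: "'b set \<Rightarrow> ('b \<Rightarrow> 'b \<Rightarrow> bool) \<Rightarrow> 'b \<Rightarrow> 'b \<Rightarrow> 'b \<Rightarrow> bool" where
  "is_join E le u v w \<longleftrightarrow>
     w \<in> E \<and> le u w \<and> le v w \<and> (\<forall>z\<in>E. le u z \<and> le v z \<longrightarrow> le w z)"

text \<open>A lattice isomorphism onto the Banach lattice \<^const>\<open>uo_dual_dual\<close> is a linear bijection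
  preserving suprema and infima; no relation between the norms is required.\<close>

definition lattice_iso_onto_uo_dual_dual ::
    "('a::banach_lattice \<Rightarrow> ('a \<Rightarrow>\<^sub>L real) \<Rightarrow> real) \<Rightarrow> bool" where
  "lattice_iso_onto_uo_dual_dual T \<longleftrightarrow>
     bij_betw T UNIV uo_dual_dual \<and>
     (\<forall>x y. \<forall>\<phi>\<in>uo_dual. T (x + y) \<phi> = T x \<phi> + T y \<phi>) \<and>
     (\<forall>c x. \<forall>\<phi>\<in>uo_dual. T (c *\<^sub>R x) \<phi> = c * T x \<phi>) \<and>
     (\<forall>x y. is_join uo_dual_dual uo_dual_dual_le (T x) (T y) (T (sup x y))) \<and>
     (\<forall>x y. is_join uo_dual_dual (\<lambda>F G. uo_dual_dual_le G F) (T x) (T y) (T (inf x y)))"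

definition uo_evaluation :: "'a::banach_lattice \<Rightarrow> ('a \<Rightarrow>\<^sub>L real) \<Rightarrow> real" where
  "uo_evaluation x = (\<lambda>\<phi>\<in>uo_dual. blinfun_apply \<phi> x)"

section \<open>Independence of the index type\<close>

lemma directed_preorderD:
  assumes "directed_preorder r"
  shows "\<And>a. a \<in> Field r \<Longrightarrow> (a, a) \<in> r"
    and "\<And>a b c. (a, b) \<in> r \<Longrightarrow> (b, c) \<in> r \<Longrightarrow> (a, c) \<in> r"
    and "\<And>a b. a \<in> Field r \<Longrightarrow> b \<in> Field r \<Longrightarrow> \<exists>c. (a, c) \<in> r \<and> (b, c) \<in> r"
    and "Field r \<noteq> {}"
  using assms unfolding directed_preorder_def preorder_on_def
  by (auto simp: refl_on_def dest: transD)

lemma directed_preorderI: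
  assumes "A \<noteq> {}" "r \<subseteq> A \<times> A"
    and "\<And>a. a \<in> A \<Longrightarrow> (a, a) \<in> r"
    and "\<And>a b c. (a, b) \<in> r \<Longrightarrow> (b, c) \<in> r \<Longrightarrow> (a, c) \<in> r"
    and "\<And>a b. a \<in> A \<Longrightarrow> b \<in> A \<Longrightarrow> \<exists>c. (a, c) \<in> r \<and> (b, c) \<in> r"
  shows "directed_preorder r" "Field r = A"
proof -
  show F: "Field r = A"
    using assms(2,3) by (auto simp: Field_def)
  have "refl_on A r" "trans r"
    using assms(2-4) by (auto simp: refl_on_def intro: transI)
  then show "directed_preorder r"
    using assms unfolding directed_preorder_def F preorder_on_def by auto
qed

lemma eventually_net_filter:
  assumes "directed_preorder r"
  shows "eventually P (net_filter r) \<longleftrightarrow> (\<exists>\<alpha>\<^sub>0\<in>Field r. \<forall>\<alpha>. (\<alpha>\<^sub>0, \<alpha>) \<in> r \<longrightarrow> P \<alpha>)"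
proof -
  note D = directed_preorderD[OF assms]
  have "eventually P (net_filter r)
      \<longleftrightarrow> (\<exists>b\<in>Field r. eventually P (principal {\<beta>. (b, \<beta>) \<in> r}))"
    unfolding net_filter_def
  proof (rule eventually_INF_base)
    show "Field r \<noteq> {}" by (rule D(4))
    fix a b assume ab: "a \<in> Field r" "b \<in> Field r"
    obtain c where c: "(a, c) \<in> r" "(b, c) \<in> r"
      using D(3)[OF ab] by blast
    then have "c \<in> Field r" by (auto simp: Field_def)
    moreover have "{\<beta>. (c, \<beta>) \<in> r} \<subseteq> {\<beta>. (a, \<beta>) \<in> r} \<inter> {\<beta>. (b, \<beta>) \<in> r}"
      using c D(2) by auto
    ultimately show "\<exists>x\<in>Field r. principal {\<beta>. (x, \<beta>) \<in> r}
        \<le> inf (principal {\<beta>. (a, \<beta>) \<in> r}) (principal {\<beta>. (b, \<beta>) \<in> r})"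
      by auto
  qed
  then show ?thesis
    by (simp add: eventually_principal)
qed

lemma order_converges_iff_eventually:
  assumes "directed_preorder r"
  shows "order_converges r x l \<longleftrightarrow>
     (\<exists>(s :: 'a net_index rel) y. directed_preorder s \<and> decreases_to s y (0::'a::banach_lattice) \<and>
        (\<forall>\<gamma>\<in>Field s. \<forall>\<^sub>F v in filtermap x (net_filter r). \<bar>v - l\<bar> \<le> y \<gamma>))"
  unfolding order_converges_def eventually_filtermap eventually_net_filter[OF assms] by simp

lemma order_converges_toI:
  fixes s :: "'k rel" and y :: "'k \<Rightarrow> 'a::banach_lattice"
  assumes s: "directed_preorder s" and y: "decreases_to s y 0"
    and *: "\<And>\<gamma>. \<gamma> \<in> Field s \<Longrightarrow> \<exists>\<alpha>\<^sub>0\<in>Field r. \<forall>\<alpha>. (\<alpha>\<^sub>0, \<alpha>) \<in> r \<longrightarrow> \<bar>x \<alpha> - l\<bar> \<le> y \<gamma>"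
  shows "order_converges r x l"
proof -
  note D = directed_preorderD[OF s]
  define A where "A = (\<lambda>\<gamma>. ({}::'a set, y \<gamma>)) ` Field s"
  define t where "t = {(p, q). p \<in> A \<and> q \<in> A \<and> snd q \<le> snd p}"
  have mono: "\<And>a b. (a, b) \<in> s \<Longrightarrow> y b \<le> y a"
    using y by (auto simp: decreases_to_def)
  have dir: "\<exists>c. (p, c) \<in> t \<and> (q, c) \<in> t" if "p \<in> A" "q \<in> A" for p q
  proof -
    from that obtain a b where "a \<in> Field s" "b \<in> Field s" "p = ({}, y a)" "q = ({}, y b)"
      by (auto simp: A_def)
    moreover from this obtain c where "(a, c) \<in> s" "(b, c) \<in> s"
      using D(3) by blast
    moreover from this have "c \<in> Field s" by (auto simp: Field_def)
    ultimately show ?thesis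
      using mono by (intro exI[of _ "({}, y c)"]) (auto simp: t_def A_def)
  qed
  have t_props: "A \<noteq> {}" "t \<subseteq> A \<times> A" "\<And>p. p \<in> A \<Longrightarrow> (p, p) \<in> t"
    "\<And>p q w. (p, q) \<in> t \<Longrightarrow> (q, w) \<in> t \<Longrightarrow> (p, w) \<in> t"
    using D(4) unfolding t_def by (auto simp: A_def)
  have t: "directed_preorder t" "Field t = A"
    by (rule directed_preorderI[where A = A]; fact t_props dir)+
  have "snd ` Field t = y ` Field s"
    unfolding t(2) by (simp add: A_def image_image)
  then have "decreases_to t snd 0"
    using y by (auto simp: decreases_to_def t_def)
  moreover have "\<exists>\<alpha>\<^sub>0\<in>Field r. \<forall>\<alpha>. (\<alpha>\<^sub>0, \<alpha>) \<in> r \<longrightarrow> \<bar>x \<alpha> - l\<bar> \<le> snd p" if "p \<in> Field t" for p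
    using that * unfolding t(2) by (auto simp: A_def)
  ultimately show ?thesis
    unfolding order_converges_def using t(1) by blast
qed

definition tail_preorder :: "'i rel \<Rightarrow> ('i \<Rightarrow> 'a) \<Rightarrow> 'a net_index rel" where
  "tail_preorder r x =
     (let A = {(x ` (r `` {\<alpha>}), x \<beta>) | \<alpha> \<beta>. (\<alpha>, \<beta>) \<in> r}
      in {(p, q). p \<in> A \<and> q \<in> A \<and> fst q \<subseteq> fst p})"

lemma mem_case_prod_Collect: "(p, q) \<in> {(p, q). Q p q} \<longleftrightarrow> Q p q"
  by simp

lemma tail_preorder:
  assumes r: "directed_preorder r"
  shows "directed_preorder (tail_preorder r x)"
    and "Field (tail_preorder r x) = {(x ` (r `` {\<alpha>}), x \<beta>) | \<alpha> \<beta>. (\<alpha>, \<beta>) \<in> r}" (is "_ = ?A")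
    and "snd ` Field (tail_preorder r x) = x ` Field r"
    and "filtermap snd (net_filter (tail_preorder r x)) = filtermap x (net_filter r)"
proof -
  note D = directed_preorderD[OF r]
  have eq: "tail_preorder r x = {(p, q). p \<in> ?A \<and> q \<in> ?A \<and> fst q \<subseteq> fst p}"
    by (simp only: tail_preorder_def Let_def)
  have iff: "(p, q) \<in> tail_preorder r x \<longleftrightarrow> p \<in> ?A \<and> q \<in> ?A \<and> fst q \<subseteq> fst p" for p q
    unfolding eq by (rule mem_case_prod_Collect)
  have memA: "(x ` (r `` {a}), x b) \<in> ?A" if "(a, b) \<in> r" for a b
    using that by blast
  obtain a0 where a0: "a0 \<in> Field r" using D(4) by blast
  have ne: "?A \<noteq> {}"
  proof
    assume "?A = {}"
    with memA[OF D(1)[OF a0]] show False by (simp only: empty_iff)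
  qed
  have dir: "\<exists>c. (p, c) \<in> tail_preorder r x \<and> (q, c) \<in> tail_preorder r x"
    if pq: "p \<in> ?A" "q \<in> ?A" for p q
  proof -
    obtain a a' b b' where p: "p = (x ` (r `` {a}), x a')" "(a, a') \<in> r"
      and q: "q = (x ` (r `` {b}), x b')" "(b, b') \<in> r"
      using pq by blast
    then have "a \<in> Field r" "b \<in> Field r" by (auto simp: Field_def)
    then obtain c where c: "(a, c) \<in> r" "(b, c) \<in> r" using D(3) by blast
    have cc: "(c, c) \<in> r" using c by (intro D(1)) (auto simp: Field_def)
    have "x ` (r `` {c}) \<subseteq> x ` (r `` {a})" "x ` (r `` {c}) \<subseteq> x ` (r `` {b})"
      using D(2)[OF c(1)] D(2)[OF c(2)] by blast+
    then have "(p, (x ` (r `` {c}), x c)) \<in> tail_preorder r x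
        \<and> (q, (x ` (r `` {c}), x c)) \<in> tail_preorder r x"
      unfolding iff using pq memA[OF cc] p(1) q(1) by (simp only: fst_conv simp_thms)
    then show ?thesis by blast
  qed
  have sub: "tail_preorder r x \<subseteq> ?A \<times> ?A"
    unfolding eq by blast
  have refl: "(p, p) \<in> tail_preorder r x" if "p \<in> ?A" for p
    unfolding iff using that by (intro conjI order_refl)
  have trans: "(p, w) \<in> tail_preorder r x"
    if "(p, q) \<in> tail_preorder r x" "(q, w) \<in> tail_preorder r x" for p q w
    using that unfolding iff by (elim conjE) (intro conjI order_trans[of "fst w" "fst q" "fst p"])
  show dp: "directed_preorder (tail_preorder r x)" and F: "Field (tail_preorder r x) = ?A"
    by (rule directed_preorderI[where A = ?A]; fact ne sub refl trans dir)+
  show "snd ` Field (tail_preorder r x) = x ` Field r"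
  proof
    show "snd ` Field (tail_preorder r x) \<subseteq> x ` Field r"
    proof
      fix v assume "v \<in> snd ` Field (tail_preorder r x)"
      then obtain a b where "(a, b) \<in> r" "v = x b" unfolding F by force
      then show "v \<in> x ` Field r" by (auto simp: Field_def)
    qed
    show "x ` Field r \<subseteq> snd ` Field (tail_preorder r x)"
    proof
      fix v assume "v \<in> x ` Field r"
      then obtain a where "a \<in> Field r" "v = x a" by auto
      then show "v \<in> snd ` Field (tail_preorder r x)"
        unfolding F using memA[OF D(1)] by (intro image_eqI[of _ _ "(x ` (r `` {a}), x a)"]) simp_all
    qed
  qed
  show "filtermap snd (net_filter (tail_preorder r x)) = filtermap x (net_filter r)"
    unfolding filter_eq_iff eventually_filtermap eventually_net_filter[OF r]
      eventually_net_filter[OF dp]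
  proof (intro allI iffI)
    fix P assume "\<exists>p\<in>Field (tail_preorder r x). \<forall>q. (p, q) \<in> tail_preorder r x \<longrightarrow> P (snd q)"
    then obtain a a' where a: "(a, a') \<in> r"
      and P: "\<And>q. ((x ` (r `` {a}), x a'), q) \<in> tail_preorder r x \<Longrightarrow> P (snd q)"
      unfolding F by blast
    have "P (x b)" if b: "(a, b) \<in> r" for b
    proof -
      have "((x ` (r `` {a}), x a'), (x ` (r `` {a}), x b)) \<in> tail_preorder r x"
        unfolding iff by (intro conjI memA a b) simp
      from P[OF this] show ?thesis by simp
    qed
    then show "\<exists>\<alpha>\<^sub>0\<in>Field r. \<forall>\<alpha>. (\<alpha>\<^sub>0, \<alpha>) \<in> r \<longrightarrow> P (x \<alpha>)"
      using a by (intro bexI[of _ a]) (auto simp: Field_def)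
  next
    fix P assume "\<exists>\<alpha>\<^sub>0\<in>Field r. \<forall>\<alpha>. (\<alpha>\<^sub>0, \<alpha>) \<in> r \<longrightarrow> P (x \<alpha>)"
    then obtain a where a: "a \<in> Field r" and P: "\<And>b. (a, b) \<in> r \<Longrightarrow> P (x b)" by blast
    have "P (snd q)" if "((x ` (r `` {a}), x a), q) \<in> tail_preorder r x" for q
    proof -
      have "fst q \<subseteq> x ` (r `` {a})" "q \<in> ?A"
        using that unfolding iff by (simp_all only: fst_conv)
      then obtain b c where "(b, c) \<in> r" "x ` (r `` {b}) \<subseteq> x ` (r `` {a})" "snd q = x c" by auto
      then have "snd q \<in> x ` (r `` {a})" by blast
      then show ?thesis using P by auto
    qed
    moreover have "(x ` (r `` {a}), x a) \<in> ?A" by (rule memA[OF D(1)[OF a]])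
    ultimately show "\<exists>p\<in>Field (tail_preorder r x). \<forall>q. (p, q) \<in> tail_preorder r x \<longrightarrow> P (snd q)"
      unfolding F by blast
  qed
qed

lemma order_converges_cong:
  assumes "directed_preorder r" "directed_preorder s"
    and "filtermap x (net_filter r) = filtermap y (net_filter s)"
  shows "order_converges r x l \<longleftrightarrow> order_converges s y l"
  by (simp only: order_converges_iff_eventually[OF assms(1)]
      order_converges_iff_eventually[OF assms(2)] assms(3))

lemma uo_converges_cong:
  assumes "directed_preorder r" "directed_preorder s"
    and eq: "filtermap x (net_filter r) = filtermap y (net_filter s)"
  shows "uo_converges r x l \<longleftrightarrow> uo_converges s y l"
proof -
  have "filtermap (\<lambda>a. inf \<bar>x a - l\<bar> z) (net_filter r) = filtermap (\<lambda>a. inf \<bar>y a - l\<bar> z) (net_filter s)"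
    for z
    using arg_cong[OF eq, of "filtermap (\<lambda>v. inf \<bar>v - l\<bar> z)"] by (simp add: filtermap_filtermap)
  from order_converges_cong[OF assms(1,2) this] show ?thesis
    by (simp only: uo_converges_def)
qed

lemma product_preorder:
  assumes r: "directed_preorder r" and s: "directed_preorder s"
  shows "directed_preorder (product_preorder r s)"
    and "Field (product_preorder r s) = Field r \<times> Field s"
    and "net_filter (product_preorder r s) = net_filter r \<times>\<^sub>F net_filter s"
proof -
  note Dr = directed_preorderD[OF r] and Ds = directed_preorderD[OF s]
  have dir: "\<exists>c. (a, c) \<in> product_preorder r s \<and> (b, c) \<in> product_preorder r s"
    if ab: "a \<in> Field r \<times> Field s" "b \<in> Field r \<times> Field s" for a b
  proof -
    obtain c d where "(fst a, c) \<in> r" "(fst b, c) \<in> r" "(snd a, d) \<in> s" "(snd b, d) \<in> s"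
      using Dr(3)[of "fst a" "fst b"] Ds(3)[of "snd a" "snd b"] ab by (auto simp: mem_Times_iff)
    then show ?thesis
      by (intro exI[of _ "(c, d)"]) (auto simp: product_preorder_def case_prod_unfold)
  qed
  have 1: "Field r \<times> Field s \<noteq> {}" using Dr(4) Ds(4) by auto
  have 2: "product_preorder r s \<subseteq> (Field r \<times> Field s) \<times> (Field r \<times> Field s)"
    by (auto simp: product_preorder_def Field_def)
  have 3: "(a, a) \<in> product_preorder r s" if "a \<in> Field r \<times> Field s" for a
    using that Dr(1) Ds(1) by (auto simp: product_preorder_def)
  have 4: "(a, c) \<in> product_preorder r s"
    if "(a, b) \<in> product_preorder r s" "(b, c) \<in> product_preorder r s" for a b c
    using that Dr(2) Ds(2) by (auto simp: product_preorder_def)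
  show dp: "directed_preorder (product_preorder r s)"
    and F: "Field (product_preorder r s) = Field r \<times> Field s"
    by (rule directed_preorderI[where A = "Field r \<times> Field s"]; fact 1 2 3 4 dir)+
  show "net_filter (product_preorder r s) = net_filter r \<times>\<^sub>F net_filter s"
    unfolding filter_eq_iff eventually_prod_filter eventually_net_filter[OF dp]
      eventually_net_filter[OF r] eventually_net_filter[OF s] F
  proof (intro allI iffI)
    fix P assume "\<exists>p\<in>Field r \<times> Field s. \<forall>q. (p, q) \<in> product_preorder r s \<longrightarrow> P q"
    then obtain a b where "a \<in> Field r" "b \<in> Field s"
      and "\<And>a' b'. (a, a') \<in> r \<Longrightarrow> (b, b') \<in> s \<Longrightarrow> P (a', b')"
      by (auto simp: product_preorder_def)
    then show "\<exists>Pf Pg. (\<exists>\<alpha>\<^sub>0\<in>Field r. \<forall>\<alpha>. (\<alpha>\<^sub>0, \<alpha>) \<in> r \<longrightarrow> Pf \<alpha>) \<and>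
        (\<exists>\<alpha>\<^sub>0\<in>Field s. \<forall>\<alpha>. (\<alpha>\<^sub>0, \<alpha>) \<in> s \<longrightarrow> Pg \<alpha>) \<and> (\<forall>x y. Pf x \<longrightarrow> Pg y \<longrightarrow> P (x, y))"
      by (intro exI[of _ "\<lambda>x. (a, x) \<in> r"] exI[of _ "\<lambda>x. (b, x) \<in> s"]) auto
  next
    fix P assume "\<exists>Pf Pg. (\<exists>\<alpha>\<^sub>0\<in>Field r. \<forall>\<alpha>. (\<alpha>\<^sub>0, \<alpha>) \<in> r \<longrightarrow> Pf \<alpha>) \<and>
        (\<exists>\<alpha>\<^sub>0\<in>Field s. \<forall>\<alpha>. (\<alpha>\<^sub>0, \<alpha>) \<in> s \<longrightarrow> Pg \<alpha>) \<and> (\<forall>x y. Pf x \<longrightarrow> Pg y \<longrightarrow> P (x, y))"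
    then obtain Pf Pg a b where "a \<in> Field r" "\<And>c. (a, c) \<in> r \<Longrightarrow> Pf c"
      and "b \<in> Field s" "\<And>c. (b, c) \<in> s \<Longrightarrow> Pg c" and "\<And>c d. Pf c \<Longrightarrow> Pg d \<Longrightarrow> P (c, d)"
      by blast
    then show "\<exists>p\<in>Field r \<times> Field s. \<forall>q. (p, q) \<in> product_preorder r s \<longrightarrow> P q"
      by (intro bexI[of _ "(a, b)"]) (simp_all add: product_preorder_def case_prod_unfold)
  qed
qed

lemma filtermap_diff_prod_filter:
  "filtermap (\<lambda>(a, b). z a - z b) (F \<times>\<^sub>F F)
     = filtermap (\<lambda>(u, v). u - v :: 'a::minus) (filtermap z F \<times>\<^sub>F filtermap z F)"
  by (simp add: prod_filtermap1 prod_filtermap2 filtermap_filtermap case_prod_unfold)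

lemma uo_Cauchy_cong:
  assumes r: "directed_preorder r" and s: "directed_preorder s"
    and eq: "filtermap x (net_filter r) = filtermap y (net_filter s)"
  shows "uo_Cauchy r x \<longleftrightarrow> uo_Cauchy s y"
  unfolding uo_Cauchy_def
proof (rule uo_converges_cong[OF product_preorder(1)[OF r r] product_preorder(1)[OF s s]])
  show "filtermap (\<lambda>(a, b). x a - x b) (net_filter (product_preorder r r))
      = filtermap (\<lambda>(a, b). y a - y b) (net_filter (product_preorder s s))"
    by (simp only: product_preorder(3)[OF r r] product_preorder(3)[OF s s]
        filtermap_diff_prod_filter[where z = x] filtermap_diff_prod_filter[where z = y] eq)
qed

lemma uo_functionals_tendsto:
  fixes r :: "'i rel" and x :: "'i \<Rightarrow> 'a::banach_lattice"
  assumes f: "f \<in> uo_functionals" and r: "directed_preorder r"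
    and b: "bounded (x ` Field r)" and x: "uo_converges r x 0"
  shows "((\<lambda>\<alpha>. f (x \<alpha>)) \<longlongrightarrow> 0) (net_filter r)"
proof -
  note T = tail_preorder[OF r, of x]
  have "uo_converges (tail_preorder r x) snd 0"
    using uo_converges_cong[OF T(1) r T(4)] x by simp
  then have "((\<lambda>\<alpha>. f (snd \<alpha>)) \<longlongrightarrow> 0) (net_filter (tail_preorder r x))"
    using f T(1) b T(3) unfolding uo_functionals_def by auto
  then have "filterlim f (nhds 0) (filtermap snd (net_filter (tail_preorder r x)))"
    by (simp add: filterlim_filtermap)
  then show ?thesis
    unfolding T(4) by (simp add: filterlim_filtermap)
qed

lemma boundedly_uo_completeD:
  fixes r :: "'i rel" and x :: "'i \<Rightarrow> 'a::banach_lattice"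
  assumes c: "boundedly_uo_complete TYPE('a)" and r: "directed_preorder r"
    and b: "bounded (x ` Field r)" and x: "uo_Cauchy r x"
  shows "\<exists>l. uo_converges r x l"
proof -
  note T = tail_preorder[OF r, of x]
  have "uo_Cauchy (tail_preorder r x) snd"
    using uo_Cauchy_cong[OF T(1) r T(4)] x by simp
  then have "\<exists>l. uo_converges (tail_preorder r x) snd l"
    using c T(1) b T(3) unfolding boundedly_uo_complete_def by auto
  then show ?thesis
    using uo_converges_cong[OF T(1) r T(4)] by simp
qed

lemma monotonically_completeD:
  fixes r :: "'i rel" and x :: "'i \<Rightarrow> 'a::banach_lattice"
  assumes c: "monotonically_complete TYPE('a)" and r: "directed_preorder r"
    and b: "bounded (x ` Field r)" and p: "\<And>\<alpha>. \<alpha> \<in> Field r \<Longrightarrow> 0 \<le> x \<alpha>"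
    and inc: "increasing_net r x"
  shows "\<exists>u. isLub UNIV (x ` Field r) u"
proof -
  note D = directed_preorderD[OF r]
  define A where "A = (\<lambda>\<gamma>. ({}::'a set, x \<gamma>)) ` Field r"
  define t where "t = {(p, q). p \<in> A \<and> q \<in> A \<and> snd p \<le> snd q}"
  have mono: "\<And>a b. (a, b) \<in> r \<Longrightarrow> x a \<le> x b"
    using inc by (auto simp: increasing_net_def)
  have dir: "\<exists>c. (p, c) \<in> t \<and> (q, c) \<in> t" if "p \<in> A" "q \<in> A" for p q
  proof -
    from that obtain a b where "a \<in> Field r" "b \<in> Field r" "p = ({}, x a)" "q = ({}, x b)"
      by (auto simp: A_def)
    moreover from this obtain c where "(a, c) \<in> r" "(b, c) \<in> r"
      using D(3) by blast
    moreover from this have "c \<in> Field r" by (auto simp: Field_def)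
    ultimately show ?thesis
      using mono by (intro exI[of _ "({}, x c)"]) (auto simp: t_def A_def)
  qed
  have t_props: "A \<noteq> {}" "t \<subseteq> A \<times> A" "\<And>p. p \<in> A \<Longrightarrow> (p, p) \<in> t"
    "\<And>p q w. (p, q) \<in> t \<Longrightarrow> (q, w) \<in> t \<Longrightarrow> (p, w) \<in> t"
    using D(4) unfolding t_def by (auto simp: A_def)
  have t: "directed_preorder t" "Field t = A"
    by (rule directed_preorderI[where A = A]; fact t_props dir)+
  have im: "snd ` Field t = x ` Field r"
    unfolding t(2) by (simp add: A_def image_image)
  have "increasing_net t snd"
    by (auto simp: increasing_net_def t_def)
  moreover have "\<forall>\<alpha>\<in>Field t. 0 \<le> snd \<alpha>"
    using p unfolding t(2) A_def by auto
  ultimately have "\<exists>u. isLub UNIV (snd ` Field t) u"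
    using c t(1) b unfolding monotonically_complete_def im[symmetric] by blast
  then show ?thesis unfolding im .
qed

section \<open>Members of the uo-dual are bounded\<close>

lemma banach_lattice_nonneg_limit:
  fixes X :: "nat \<Rightarrow> 'a::banach_lattice"
  assumes lim: "X \<longlonglongrightarrow> l" and nn: "eventually (\<lambda>n. 0 \<le> X n) sequentially"
  shows "0 \<le> l"
proof -
  have le: "norm (sup (- l) 0) \<le> norm (X n - l)" if "0 \<le> X n" for n
  proof (rule norm_mono_abs)
    have "- l \<le> X n - l" using that by simp
    also have "\<dots> \<le> \<bar>X n - l\<bar>" by (rule abs_ge_self)
    finally show "\<bar>sup (- l) 0\<bar> \<le> \<bar>X n - l\<bar>" by simp
  qed
  have "(\<lambda>n. norm (X n - l)) \<longlonglongrightarrow> 0"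
    using lim by (simp add: LIM_zero_iff tendsto_norm_zero)
  then have "norm (sup (- l) 0) \<le> 0"
    by (rule tendsto_lowerbound) (use nn le in \<open>auto elim: eventually_mono\<close>)
  then have "- l \<le> 0"
    by (metis norm_le_zero_iff sup.cobounded1)
  then show ?thesis by simp
qed

lemma uo_functionals_bounded_linear:
  fixes f :: "'a::banach_lattice \<Rightarrow> real"
  assumes f: "f \<in> uo_functionals"
  shows "bounded_linear f"
proof (rule ccontr)
  assume nb: "\<not> bounded_linear f"
  have lin: "linear f" using f by (simp add: uo_functionals_def)
  have ex: "\<exists>v. \<bar>f v\<bar> > C * norm v" for C
  proof (rule ccontr)
    assume "\<nexists>v. \<bar>f v\<bar> > C * norm v"
    then have "bounded_linear f"
      by (intro bounded_linear.intro lin bounded_linear_axioms.intro exI[of _ C])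
        (auto simp: not_less mult.commute)
    with nb show False ..
  qed
  define c where "c n = real (Suc n) * 2 ^ n" for n
  have cpos: "c n > 0" for n by (simp add: c_def)
  have "\<exists>w. norm w = 1 / c n \<and> \<bar>f w\<bar> > 1" for n
  proof -
    obtain v where v: "\<bar>f v\<bar> > c n * norm v" using ex by blast
    have "v \<noteq> 0" using v linear_0[OF lin] by auto
    then have nv: "norm v > 0" by simp
    let ?w = "(1 / (c n * norm v)) *\<^sub>R v"
    have "norm ?w = 1 / c n" using nv cpos[of n] by simp
    moreover have "\<bar>f ?w\<bar> > 1"
      using v nv cpos[of n] by (simp add: linear_cmul[OF lin] abs_mult)
    ultimately show ?thesis by blast
  qed
  then obtain w where w: "\<And>n. norm (w n) = 1 / c n" "\<And>n. \<bar>f (w n)\<bar> > 1" by metis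
  define g where "g n = real (Suc n) *\<^sub>R \<bar>w n\<bar>" for n
  have nabs: "norm \<bar>z\<bar> = norm z" for z :: 'a
    by (intro antisym norm_mono_abs) auto
  have "norm (g n) = (1/2) ^ n" for n
    using w(1)[of n] by (simp add: g_def nabs c_def power_one_over)
  then have "summable (\<lambda>n. norm (g n))" by (simp add: summable_geometric)
  then have sg: "summable g" by (rule summable_norm_cancel)
  define u where "u = suminf g"
  have gpos: "0 \<le> g n" for n unfolding g_def by (intro scaleR_nonneg_nonneg) auto
  have gu: "g n \<le> u" for n
  proof -
    have "(\<lambda>m. sum g {..<m} - g n) \<longlonglongrightarrow> u - g n"
      unfolding u_def by (intro tendsto_intros summable_LIMSEQ sg)
    moreover have "eventually (\<lambda>m. 0 \<le> sum g {..<m} - g n) sequentially"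
      unfolding eventually_sequentially
    proof (intro exI allI impI)
      fix m assume "Suc n \<le> m"
      then have "sum g {n} \<le> sum g {..<m}" by (intro sum_mono2 gpos) auto
      then show "0 \<le> sum g {..<m} - g n" by simp
    qed
    ultimately have "0 \<le> u - g n" by (rule banach_lattice_nonneg_limit)
    then show ?thesis by simp
  qed
  have u0: "0 \<le> u" using gpos[of 0] gu[of 0] by (rule order_trans)
  define y where "y n = (1 / real (Suc n)) *\<^sub>R u" for n
  have wy: "\<bar>w n\<bar> \<le> y n" for n
    using scaleR_left_mono[OF gu[of n], of "1 / real (Suc n)"] by (simp add: g_def y_def)
  have y0: "0 \<le> y n" for n unfolding y_def using u0 by (simp add: scaleR_nonneg_nonneg)
  have ylim: "(\<lambda>n. y n) \<longlonglongrightarrow> 0"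
    unfolding y_def using tendsto_scaleR[OF LIMSEQ_Suc[OF lim_1_over_n] tendsto_const, of u] by simp
  define r where "r = {(m, n::nat). m \<le> n}"
  have r: "directed_preorder r" "Field r = UNIV"
    by (rule directed_preorderI[where A = UNIV]; auto simp: r_def intro: max.cobounded1 max.cobounded2)+
  have dec: "decreases_to r y 0"
    unfolding decreases_to_def r(2)
  proof (intro conjI allI impI)
    fix a b assume "(a, b) \<in> r"
    then show "y b \<le> y a" unfolding y_def r_def
      by (intro scaleR_right_mono u0) (auto simp: divide_simps)
  next
    show "isGlb UNIV (range y) 0"
      unfolding isGlb_def greatestP_def isLb_def setge_def setle_def
    proof (intro conjI ballI)
      fix z assume "z \<in> Collect (\<lambda>x. (\<forall>t\<in>range y. x \<le> t) \<and> x \<in> UNIV)"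
      then have "0 \<le> y n - z" for n by auto
      moreover have "(\<lambda>n. y n - z) \<longlonglongrightarrow> 0 - z" by (intro tendsto_intros ylim)
      ultimately have "0 \<le> 0 - z" by (intro banach_lattice_nonneg_limit) auto
      then show "z \<le> 0" by simp
    qed (use y0 in auto)
  qed
  have uo: "uo_converges r w 0"
    unfolding uo_converges_def
  proof (intro allI impI)
    fix z :: 'a assume z: "0 \<le> z"
    show "order_converges r (\<lambda>\<alpha>. inf \<bar>w \<alpha> - 0\<bar> z) 0"
    proof (rule order_converges_toI[OF r(1) dec])
      fix n assume "n \<in> Field r"
      have "\<bar>inf \<bar>w m - 0\<bar> z - 0\<bar> \<le> y n" if "(n, m) \<in> r" for m
      proof -
        have "0 \<le> inf \<bar>w m\<bar> z" using z by simp
        then have "\<bar>inf \<bar>w m - 0\<bar> z - 0\<bar> = inf \<bar>w m\<bar> z" by simp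
        also have "\<dots> \<le> \<bar>w m\<bar>" by simp
        also have "\<bar>w m\<bar> \<le> y n"
          using wy[of m] dec that unfolding decreases_to_def by (meson order_trans)
        finally show ?thesis .
      qed
      then show "\<exists>\<alpha>\<^sub>0\<in>Field r. \<forall>\<alpha>. (\<alpha>\<^sub>0, \<alpha>) \<in> r \<longrightarrow> \<bar>inf \<bar>w \<alpha> - 0\<bar> z - 0\<bar> \<le> y n"
        unfolding r(2) by blast
    qed
  qed
  have "1 / c n \<le> 1" for n
  proof -
    have "1 \<le> real (Suc n) * 2 ^ n" using mult_mono[of 1 "real (Suc n)" 1 "2 ^ n"] by simp
    then show ?thesis by (simp add: c_def)
  qed
  then have "bounded (w ` Field r)"
    unfolding bounded_iff using w(1) by (intro exI[of _ 1]) auto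
  from uo_functionals_tendsto[OF f r(1) this uo]
  have "\<forall>\<^sub>F n in net_filter r. dist (f (w n)) 0 < 1"
    by (rule tendstoD) simp
  then obtain n where "\<And>m. (n, m) \<in> r \<Longrightarrow> dist (f (w m)) 0 < 1"
    unfolding eventually_net_filter[OF r(1)] by blast
  then have "\<bar>f (w n)\<bar> < 1" by (auto simp: r_def)
  with w(2)[of n] show False by simp
qed

lemma blinfun_apply_image_uo_dual:
  "blinfun_apply ` uo_dual = (uo_functionals :: ('a::banach_lattice \<Rightarrow> real) set)"
proof
  show "(uo_functionals :: ('a \<Rightarrow> real) set) \<subseteq> blinfun_apply ` uo_dual"
  proof
    fix f :: "'a \<Rightarrow> real" assume f: "f \<in> uo_functionals"
    then have "blinfun_apply (Blinfun f) = f"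
      by (intro bounded_linear_Blinfun_apply uo_functionals_bounded_linear)
    with f show "f \<in> blinfun_apply ` uo_dual"
      by (intro image_eqI[of _ _ "Blinfun f"]) (simp_all add: uo_dual_def)
  qed
qed (auto simp: uo_dual_def)

end

theory Submission
  imports Defs
begin

text \<open>One shows (1) to (2) to (4) to (1), (1) to (3) and (3) to (4). The hard implication
  is (4) to (1), i.e. that a bounded functional \<open>G\<close> on the uo-dual is evaluation at a point. Let \<open>f\<close>
  be a positive member of the uo-dual. By a Helly argument, \<open>G\<close> is approximated on finite sets by
  elements of a fixed ball. Since bounded disjoint sequences are uo-null, \<open>f\<close> is uniformly small on
  the parts of ball elements above a suitable \<open>y\<close>, and this makes minimization of a strictly
  convex functional turn weak approximants into approximants uniform on \<open>[-f, f]\<close>. These converge in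
  the seminorm \<open>\<lambda>x. f \<bar>x\<bar>\<close>, and monotone completeness places the limit in the space, with norm bounded
  independently of \<open>f\<close> by the weak Fatou property. The smallest positive and negative parts
  of the solutions for \<open>f\<close> increase with \<open>f\<close>, so their suprema exist and represent \<open>G\<close>.

  For (3) to (4) and (2) to (4), the uo-dual is an ideal of order continuous functionals, so its
  positive members determine the order, and bounded increasing nets are uo-Cauchy. For (1) to (3),
  the values along a uo-Cauchy net converge to a bounded functional on the uo-dual, which is
  represented by the uo-limit.\<close>

section \<open>Vector lattice identities\<close>

text \<open>What makes (4) to (1) delicate is the dependence on \<open>f\<close>. A solution on
  \<open>[-f, f]\<close> is determined only modulo the null ideal of
  \<open>\<lambda>x. f \<bar>x\<bar>\<close>, so independent choices for different \<open>f\<close>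
  need not be ordered. Least positive parts are a canonical choice, and since the solution sets
  shrink as \<open>f\<close> grows, they increase. Their supremum over all \<open>f\<close> exists
  only because the norm bound is free of \<open>f\<close>. Uniformity on \<open>[-f, f]\<close>
  matters because \<open>f \<bar>x\<bar>\<close> is the maximum of \<open>g x\<close> over this
  interval, so a uniform error is an error in the seminorm. The natural strictly convex functional
  would be \<open>f\<close> of a square, but a vector lattice has no product. The sum of
  \<open>f \<bar>b - (k/N) y\<bar>\<close> over a grid of \<open>k\<close> replaces it: it
  discretizes the integral of \<open>\<bar>t - s\<bar>\<close> over \<open>s\<close> in
  \<open>[-y, y]\<close>, which is the parabola \<open>t^2 + y^2\<close>. Beyond \<open>y\<close>
  the curvature is lost, hence the need for small parts above \<open>y\<close>. Where suprema are
  not known to exist, sets of upper bounds stand in for them. An Archimedean argument shows that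
  nothing positive fits between a set and its upper bounds.\<close>

lemma norm_abs_eq [simp]: "norm \<bar>x\<bar> = norm (x::'a::banach_lattice)"
  by (intro antisym norm_mono_abs) auto

lemma norm_mono_nonneg: "0 \<le> x \<Longrightarrow> x \<le> y \<Longrightarrow> norm x \<le> norm (y::'a::banach_lattice)"
  by (rule norm_mono_abs) simp

lemma norm_pprt_le: "norm (pprt x) \<le> norm (x::'a::banach_lattice)"
  by (rule norm_mono_abs) (simp add: abs_prts)

lemma scaleR_inf_distrib:
  fixes x y :: "'a::banach_lattice"
  assumes "0 \<le> c"
  shows "c *\<^sub>R inf x y = inf (c *\<^sub>R x) (c *\<^sub>R y)"
proof (cases "c = 0")
  case False
  with assms have c: "0 < c" by simp
  show ?thesis
  proof (rule antisym)
    show "c *\<^sub>R inf x y \<le> inf (c *\<^sub>R x) (c *\<^sub>R y)"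
      using assms by (simp add: scaleR_left_mono)
    have "inf (c *\<^sub>R x) (c *\<^sub>R y) /\<^sub>R c \<le> inf x y"
      using c by (simp add: pos_divideR_le_eq)
    then show "inf (c *\<^sub>R x) (c *\<^sub>R y) \<le> c *\<^sub>R inf x y"
      using c pos_divideR_le_eq by blast
  qed
qed simp

lemma scaleR_sup_distrib:
  fixes x y :: "'a::banach_lattice"
  assumes "0 \<le> c"
  shows "c *\<^sub>R sup x y = sup (c *\<^sub>R x) (c *\<^sub>R y)"
  using scaleR_inf_distrib[OF assms, of "-x" "-y"]
  by (metis neg_inf_eq_sup scaleR_minus_right minus_minus)

lemma pprt_scaleR: "0 \<le> c \<Longrightarrow> pprt (c *\<^sub>R x) = c *\<^sub>R pprt (x::'a::banach_lattice)"
  by (simp add: pprt_def scaleR_sup_distrib)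

lemma abs_scaleR_lattice: "\<bar>c *\<^sub>R x\<bar> = \<bar>c\<bar> *\<^sub>R \<bar>x::'a::banach_lattice\<bar>"
proof (cases "0 \<le> c")
  case True
  then have "\<bar>c *\<^sub>R x\<bar> = c *\<^sub>R \<bar>x\<bar>"
    unfolding abs_lattice[of x] abs_lattice[of "c *\<^sub>R x"] by (subst scaleR_sup_distrib) auto
  with True show ?thesis by simp
next
  case False
  then have "\<bar>c *\<^sub>R x\<bar> = \<bar>(- c) *\<^sub>R x\<bar>" by simp
  also have "\<dots> = (- c) *\<^sub>R \<bar>x\<bar>"
    using False unfolding abs_lattice[of x] abs_lattice[of "(- c) *\<^sub>R x"]
    by (subst scaleR_sup_distrib) auto
  finally show ?thesis using False by simp
qed

lemma abs_eq_pprt_add: "\<bar>x\<bar> = pprt x + pprt (- x)" for x :: "'a::banach_lattice"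
  by (simp add: abs_prts pprt_neg)

lemma pprt_diff_pprt_uminus: "pprt x - pprt (- x) = (x::'a::banach_lattice)"
  using prts[of x] by (simp add: pprt_neg)

lemma pprt_add_le: "pprt (x + y) \<le> pprt x + pprt (y::'a::banach_lattice)"
  unfolding pprt_def by (rule sup_least) (auto intro: add_mono)

lemma inf_pprt_pprt_uminus: "inf (pprt x) (pprt (- x)) = (0::'a::banach_lattice)"
proof -
  have "inf (pprt x) (pprt (- x)) = inf (x + pprt (- x)) (0 + pprt (- x))"
    using pprt_diff_pprt_uminus[of x] by (metis add.commute add_0 diff_add_cancel)
  also have "\<dots> = inf x 0 + pprt (- x)"
    by (simp only: add_inf_distrib_right)
  also have "inf x 0 = - pprt (- x)" by (simp add: pprt_neg nprt_def)
  finally show ?thesis by simp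
qed

lemma sup_eq_add_pprt: "sup x y = y + pprt (x - y)" for x y :: "'a::banach_lattice"
  by (simp add: pprt_def add_sup_distrib_left)

lemma inf_eq_diff_pprt: "inf x y = x - pprt (x - y)" for x y :: "'a::banach_lattice"
  by (simp add: pprt_def diff_sup_eq_inf add_inf_distrib_left inf.commute)

lemma abs_pprt_diff_le: "\<bar>pprt x - pprt y\<bar> \<le> \<bar>x - (y::'a::banach_lattice)\<bar>"
proof -
  have *: "pprt a - pprt b \<le> \<bar>a - b\<bar>" for a b :: 'a
  proof -
    have "pprt a \<le> pprt (a - b) + pprt b" using pprt_add_le[of "a - b" b] by simp
    then have "pprt a - pprt b \<le> pprt (a - b)" by (simp add: diff_le_eq)
    also have "\<dots> \<le> \<bar>a - b\<bar>" by (simp add: abs_eq_pprt_add)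
    finally show ?thesis .
  qed
  show ?thesis
    using *[of x y] *[of y x] by (intro abs_leI) (simp_all add: abs_minus_commute)
qed

lemma abs_inf_diff_le: "\<bar>inf x z - inf y z\<bar> \<le> \<bar>x - (y::'a::banach_lattice)\<bar>"
proof -
  have "inf x z - inf y z = pprt (z - y) - pprt (z - x)"
    using inf_eq_diff_pprt[of z x] inf_eq_diff_pprt[of z y] by (simp add: inf.commute)
  then show ?thesis using abs_pprt_diff_le[of "z - y" "z - x"] by simp
qed

text \<open>Distributing the two sums yields the supremum over all four choices of signs. It
  exhibits the defect \<open>\<bar>a\<bar> + \<bar>b\<bar> - \<bar>a + b\<bar>\<close> in the
  triangle inequality as the positive part of \<open>\<bar>a - b\<bar> - \<bar>a + b\<bar>\<close>,
  which is the source of the strict convexity used later.\<close>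

lemma abs_add_abs_eq_sup: "\<bar>a\<bar> + \<bar>b\<bar> = sup \<bar>a + b\<bar> \<bar>a - b\<bar>" for a b :: "'a::banach_lattice"
proof -
  have "\<bar>a\<bar> + \<bar>b\<bar> = sup (sup (a + b) (a - b)) (sup (- a + b) (- a - b))"
    unfolding abs_lattice by (simp add: add_sup_distrib_left add_sup_distrib_right ac_simps)
  also have "\<dots> = sup \<bar>a + b\<bar> \<bar>a - b\<bar>"
    unfolding abs_lattice by (simp add: ac_simps)
  finally show ?thesis .
qed

text \<open>Sum minus supremum of the two terms, where the sum comes from
  \<open>abs_add_abs_eq_sup\<close> applied to \<open>m + t\<close> and \<open>m - t\<close>. It
  folds the opposite grid points \<open>t\<close> and \<open>-t\<close> into one condition on
  \<open>\<bar>m\<bar>\<close>.\<close>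

lemma inf_abs_eq_abs_diff_abs:
  fixes m t :: "'a::banach_lattice"
  shows "inf \<bar>m + t\<bar> \<bar>m - t\<bar> = \<bar>\<bar>m\<bar> - \<bar>t\<bar>\<bar>"
proof -
  have 1: "sup \<bar>m + t\<bar> \<bar>m - t\<bar> = \<bar>m\<bar> + \<bar>t\<bar>" by (simp add: abs_add_abs_eq_sup)
  have "\<bar>m + t\<bar> + \<bar>m - t\<bar> = sup \<bar>2 *\<^sub>R m\<bar> \<bar>2 *\<^sub>R t\<bar>"
    by (simp add: abs_add_abs_eq_sup scaleR_2)
  also have "\<dots> = sup (2 *\<^sub>R \<bar>m\<bar>) (2 *\<^sub>R \<bar>t\<bar>)" by (simp only: abs_scaleR_lattice) simp
  also have "\<dots> = 2 *\<^sub>R sup \<bar>m\<bar> \<bar>t\<bar>" by (simp add: scaleR_sup_distrib)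
  finally have 2: "\<bar>m + t\<bar> + \<bar>m - t\<bar> = 2 *\<^sub>R sup \<bar>m\<bar> \<bar>t\<bar>" .
  have 3: "\<bar>\<bar>m\<bar> - \<bar>t\<bar>\<bar> = 2 *\<^sub>R sup \<bar>m\<bar> \<bar>t\<bar> - (\<bar>m\<bar> + \<bar>t\<bar>)"
    using sup_eq_add_pprt[of "\<bar>m\<bar>" "\<bar>t\<bar>"] sup_eq_add_pprt[of "\<bar>t\<bar>" "\<bar>m\<bar>"]
    by (simp add: abs_eq_pprt_add[of "\<bar>m\<bar> - \<bar>t\<bar>"] scaleR_2 sup.commute algebra_simps)
  show ?thesis
    using add_eq_inf_sup[of "\<bar>m + t\<bar>" "\<bar>m - t\<bar>"] unfolding 1 2 by (simp add: 3 algebra_simps)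
qed

lemma disjoint_add_le:
  fixes a v d :: "'a::banach_lattice"
  assumes "inf a v = 0" "a \<le> d" "v \<le> d"
  shows "a + v \<le> d"
  using assms add_eq_inf_sup[of a v] by simp

text \<open>Monotonicity of the norm turns the order bound on the multiples of \<open>w\<close> into
  \<open>norm (pprt w) \<le> norm c / n\<close>. This carries the arguments in which a fixed amount
  is subtracted again and again from an upper bound.\<close>

lemma archimedean:
  fixes w c :: "'a::banach_lattice"
  assumes "\<And>n::nat. real n *\<^sub>R w \<le> c"
  shows "w \<le> 0"
proof -
  have "norm (pprt w) \<le> norm c / real n" if "n > 0" for n
  proof -
    have "pprt (real n *\<^sub>R w) \<le> pprt c" using assms by (rule pprt_mono)
    then have "real n *\<^sub>R pprt w \<le> pprt c" by (simp add: pprt_scaleR)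
    then have "norm (real n *\<^sub>R pprt w) \<le> norm (pprt c)"
      by (intro norm_mono_nonneg) (auto intro: scaleR_nonneg_nonneg)
    also have "\<dots> \<le> norm c" by (rule norm_pprt_le)
    finally show ?thesis using that by (simp add: field_simps)
  qed
  moreover have "(\<lambda>n. norm c / real n) \<longlonglongrightarrow> 0" by (rule lim_const_over_n)
  ultimately have "norm (pprt w) \<le> 0"
    by (intro tendsto_lowerbound) (auto simp: eventually_sequentially intro!: exI[of _ 1])
  then show ?thesis by (simp add: le_zero_iff_zero_pprt)
qed

lemma riesz_decomposition:
  fixes y x\<^sub>1 x\<^sub>2 :: "'a::banach_lattice"
  assumes "0 \<le> y" "y \<le> x\<^sub>1 + x\<^sub>2" "0 \<le> x\<^sub>1" "0 \<le> x\<^sub>2"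
  obtains y\<^sub>1 y\<^sub>2 where "y = y\<^sub>1 + y\<^sub>2" "0 \<le> y\<^sub>1" "y\<^sub>1 \<le> x\<^sub>1" "0 \<le> y\<^sub>2" "y\<^sub>2 \<le> x\<^sub>2"
proof (rule that[of "inf y x\<^sub>1" "y - inf y x\<^sub>1"])
  show "y = inf y x\<^sub>1 + (y - inf y x\<^sub>1)" by (metis add.commute diff_add_cancel)
  have "y - inf y x\<^sub>1 = pprt (y - x\<^sub>1)" by (simp add: inf_eq_diff_pprt)
  moreover have "pprt (y - x\<^sub>1) \<le> x\<^sub>2"
    using assms by (auto simp: pprt_def algebra_simps)
  ultimately show "0 \<le> y - inf y x\<^sub>1" "y - inf y x\<^sub>1 \<le> x\<^sub>2" by simp_all
qed (use assms in auto)

section \<open>The uo-dual as an ideal of order continuous functionals\<close>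

lemma isLub_UNIV_iff: "isLub UNIV S u \<longleftrightarrow> (\<forall>x\<in>S. x \<le> u) \<and> (\<forall>v. (\<forall>x\<in>S. x \<le> v) \<longrightarrow> u \<le> v)"
  by (auto simp: isLub_def leastP_def isUb_def setle_def setge_def)

lemma isGlb_UNIV_iff: "isGlb UNIV S u \<longleftrightarrow> (\<forall>x\<in>S. u \<le> x) \<and> (\<forall>v. (\<forall>x\<in>S. v \<le> x) \<longrightarrow> v \<le> u)"
  by (auto simp: isGlb_def greatestP_def isLb_def setle_def setge_def)

lemma linear_extension_of_cone_map:
  fixes p :: "'a::banach_lattice \<Rightarrow> real"
  assumes add: "\<And>x y. 0 \<le> x \<Longrightarrow> 0 \<le> y \<Longrightarrow> p (x + y) = p x + p y"
    and scale: "\<And>c x. 0 \<le> c \<Longrightarrow> 0 \<le> x \<Longrightarrow> p (c *\<^sub>R x) = c * p x"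
  obtains g where "linear g" "\<And>x. 0 \<le> x \<Longrightarrow> g x = p x"
proof -
  define g where "g x = p (pprt x) - p (pprt (- x))" for x
  have p0: "p 0 = 0" using scale[of 0 0] by simp
  \<comment> \<open>The value is the same for every splitting into positive elements, so additivity
    can be read off from the splitting that suits the sum.\<close>
  have eq: "g (a - b) = p a - p b" if "0 \<le> a" "0 \<le> b" for a b
  proof -
    have "a + pprt (- (a - b)) = b + pprt (a - b)"
      using pprt_diff_pprt_uminus[of "a - b"] by (simp add: algebra_simps)
    then have "p a + p (pprt (- (a - b))) = p b + p (pprt (a - b))"
      using add[of a "pprt (- (a - b))"] add[of b "pprt (a - b)"] that by simp
    then show ?thesis by (simp add: g_def)
  qed
  have "linear g"
  proof
    fix x y :: 'a
    have "x + y = (pprt x + pprt y) - (pprt (- x) + pprt (- y))"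
      using pprt_diff_pprt_uminus[of x] pprt_diff_pprt_uminus[of y] by (simp add: algebra_simps)
    then have "g (x + y) = p (pprt x + pprt y) - p (pprt (- x) + pprt (- y))"
      using eq[of "pprt x + pprt y" "pprt (- x) + pprt (- y)"] by simp
    then show "g (x + y) = g x + g y" by (simp add: add g_def)
  next
    fix c :: real and x :: 'a
    show "g (c *\<^sub>R x) = c *\<^sub>R g x"
    proof (cases "0 \<le> c")
      case True
      then have "pprt (- (c *\<^sub>R x)) = c *\<^sub>R pprt (- x)"
        using pprt_scaleR[of c "- x"] by simp
      with True show ?thesis by (simp add: g_def pprt_scaleR scale right_diff_distrib)
    next
      case False
      then have "pprt (c *\<^sub>R x) = (- c) *\<^sub>R pprt (- x)" "pprt (- (c *\<^sub>R x)) = (- c) *\<^sub>R pprt x"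
        using pprt_scaleR[of "- c" "- x"] pprt_scaleR[of "- c" x] by simp_all
      moreover have "p ((- c) *\<^sub>R z) = - c * p z" if "0 \<le> z" for z
        using False that by (intro scale) auto
      ultimately show ?thesis by (simp add: g_def algebra_simps)
    qed
  qed
  moreover have "g x = p x" if "0 \<le> x" for x
    using eq[of x 0] that p0 by simp
  ultimately show ?thesis by (rule that)
qed

lemma order_converges_dominated:
  assumes "order_converges r x 0" "\<And>\<alpha>. \<alpha> \<in> Field r \<Longrightarrow> \<bar>y \<alpha>\<bar> \<le> \<bar>x \<alpha>\<bar>"
  shows "order_converges r y (0::'a::banach_lattice)"
proof -
  obtain s and z :: "'a net_index \<Rightarrow> 'a" where s: "directed_preorder s" "decreases_to s z 0"
    and z: "\<And>\<gamma>. \<gamma> \<in> Field s \<Longrightarrow> \<exists>\<alpha>\<^sub>0\<in>Field r. \<forall>\<alpha>. (\<alpha>\<^sub>0, \<alpha>) \<in> r \<longrightarrow> \<bar>x \<alpha> - 0\<bar> \<le> z \<gamma>"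
    using assms(1) unfolding order_converges_def by blast
  have "\<exists>\<alpha>\<^sub>0\<in>Field r. \<forall>\<alpha>. (\<alpha>\<^sub>0, \<alpha>) \<in> r \<longrightarrow> \<bar>y \<alpha> - 0\<bar> \<le> z \<gamma>" if \<gamma>: "\<gamma> \<in> Field s" for \<gamma>
  proof -
    obtain \<alpha>\<^sub>0 where "\<alpha>\<^sub>0 \<in> Field r" and *: "\<And>\<alpha>. (\<alpha>\<^sub>0, \<alpha>) \<in> r \<Longrightarrow> \<bar>x \<alpha>\<bar> \<le> z \<gamma>"
      using z[OF \<gamma>] by auto
    moreover have "\<bar>y \<alpha>\<bar> \<le> z \<gamma>" if "(\<alpha>\<^sub>0, \<alpha>) \<in> r" for \<alpha>
      using *[OF that] assms(2)[of \<alpha>] that by (meson FieldI2 order_trans)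
    ultimately show ?thesis by auto
  qed
  with s show ?thesis by (rule order_converges_toI)
qed

lemma uo_converges_0_dominated:
  assumes x: "uo_converges r x 0" and le: "\<And>\<alpha>. \<alpha> \<in> Field r \<Longrightarrow> \<bar>y \<alpha>\<bar> \<le> \<bar>x \<alpha>\<bar>"
  shows "uo_converges r y (0::'a::banach_lattice)"
  unfolding uo_converges_def
proof (intro allI impI)
  fix z :: 'a assume z: "0 \<le> z"
  have "order_converges r (\<lambda>\<alpha>. inf \<bar>x \<alpha> - 0\<bar> z) 0" using x z by (simp add: uo_converges_def)
  then show "order_converges r (\<lambda>\<alpha>. inf \<bar>y \<alpha> - 0\<bar> z) 0"
  proof (rule order_converges_dominated)
    fix \<alpha> assume "\<alpha> \<in> Field r"
    from le[OF this] have "inf \<bar>y \<alpha>\<bar> z \<le> inf \<bar>x \<alpha>\<bar> z" by (simp add: le_infI1)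
    then show "\<bar>inf \<bar>y \<alpha> - 0\<bar> z\<bar> \<le> \<bar>inf \<bar>x \<alpha> - 0\<bar> z\<bar>" using z by simp
  qed
qed

lemma uo_functionals_linear: "f \<in> uo_functionals \<Longrightarrow> linear f"
  by (simp add: uo_functionals_def)

lemma uo_functionals_scale:
  assumes "f \<in> uo_functionals" shows "(\<lambda>x. c * f x) \<in> uo_functionals"
proof -
  have "linear (\<lambda>x. c * f x)"
    using linear_compose_scale_right[OF uo_functionals_linear[OF assms], of c] by simp
  moreover have "((\<lambda>\<alpha>. c * f (x \<alpha>)) \<longlongrightarrow> 0) (net_filter r)"
    if "directed_preorder r" "bounded (x ` Field r)" "uo_converges r x 0" for r :: "'a net_index rel" and x
    using tendsto_mult_left[OF uo_functionals_tendsto[OF assms that], of c] by simp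
  ultimately show ?thesis by (simp add: uo_functionals_def)
qed

lemma uo_functionals_add:
  assumes f: "f \<in> uo_functionals" and g: "g \<in> uo_functionals"
  shows "(\<lambda>x. f x + g x) \<in> uo_functionals"
proof -
  have "linear (\<lambda>x. f x + g x)"
    using assms by (intro linear_compose_add uo_functionals_linear)
  moreover have "((\<lambda>\<alpha>. f (x \<alpha>) + g (x \<alpha>)) \<longlongrightarrow> 0) (net_filter r)"
    if "directed_preorder r" "bounded (x ` Field r)" "uo_converges r x 0" for r :: "'a net_index rel" and x
    using tendsto_add[OF uo_functionals_tendsto[OF f that] uo_functionals_tendsto[OF g that]] by simp
  ultimately show ?thesis by (simp add: uo_functionals_def)
qed

lemma uo_functionals_diff:
  assumes "f \<in> uo_functionals" and "g \<in> uo_functionals"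
  shows "(\<lambda>x. f x - g x) \<in> uo_functionals"
  using uo_functionals_add[OF assms(1) uo_functionals_scale[OF assms(2), of "-1"]] by simp

lemma uo_functionals_sum:
  assumes "finite S" "\<And>i. i \<in> S \<Longrightarrow> f i \<in> uo_functionals"
  shows "(\<lambda>x. \<Sum>i\<in>S. f i x) \<in> uo_functionals"
  using assms
proof (induction S)
  case empty
  then show ?case by (auto simp: uo_functionals_def intro: linear_zero)
qed (auto intro: uo_functionals_add)

section \<open>Positive members of the uo-dual and their components\<close>

text \<open>The positive cone is kept as a set of plain functions, so that sums and components can
  be written pointwise. Boundedness is automatic by
  \<open>uo_functionals_bounded_linear\<close>.\<close>

definition pos_uo :: "('a::banach_lattice \<Rightarrow> real) set" where
  "pos_uo = {f \<in> uo_functionals. \<forall>x\<ge>0. 0 \<le> f x}"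

lemma pos_uo_D:
  assumes "f \<in> pos_uo"
  shows "f \<in> uo_functionals" "linear f" "0 \<le> x \<Longrightarrow> 0 \<le> f x"
  using assms uo_functionals_linear by (auto simp: pos_uo_def)

lemma pos_uo_mono: "f \<in> pos_uo \<Longrightarrow> x \<le> y \<Longrightarrow> f x \<le> f y"
  using pos_uo_D(3)[of f "y - x"] linear_diff[OF pos_uo_D(2), of f y x] by simp

lemma pos_linear_abs_le:
  assumes "linear f" "\<And>x::'a::banach_lattice. 0 \<le> x \<Longrightarrow> 0 \<le> f x"
  shows "\<bar>f x :: real\<bar> \<le> f \<bar>x\<bar>"
proof -
  have "0 \<le> \<bar>x\<bar> - (- x)" unfolding diff_ge_0_iff_ge by (rule abs_ge_minus_self)
  then have "0 \<le> \<bar>x\<bar> + x" by simp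
  then have "f x \<le> f \<bar>x\<bar>" "- f x \<le> f \<bar>x\<bar>"
    using assms(2)[of "\<bar>x\<bar> - x"] assms(2)[of "\<bar>x\<bar> + x"]
    by (auto simp: linear_diff[OF assms(1)] linear_add[OF assms(1)] abs_ge_self)
  then show ?thesis by (rule abs_leI)
qed

lemma pos_uo_abs_le: "f \<in> pos_uo \<Longrightarrow> \<bar>f x\<bar> \<le> f \<bar>x\<bar>"
  by (rule pos_linear_abs_le) (auto dest: pos_uo_D)

text \<open>Applied to the whole cone this is the positive part of \<open>f\<close>; applied to the ideal generated
  by \<open>w\<close> it is the component of the positive part on the band of \<open>w\<close>. Membership in the uo-dual is
  inherited because near-maximizers \<open>y \<alpha>\<close> below \<open>\<bar>x \<alpha>\<bar>\<close> form a uo-null net again.\<close>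

lemma uo_functionals_solid_sup:
  fixes f :: "'a::banach_lattice \<Rightarrow> real"
  assumes f: "f \<in> uo_functionals" and I0: "0 \<in> I"
    and Iadd: "\<And>x y. x \<in> I \<Longrightarrow> y \<in> I \<Longrightarrow> x + y \<in> I"
    and Iscale: "\<And>c x. 0 \<le> c \<Longrightarrow> x \<in> I \<Longrightarrow> c *\<^sub>R x \<in> I"
    and Idown: "\<And>x y. x \<in> I \<Longrightarrow> 0 \<le> y \<Longrightarrow> y \<le> x \<Longrightarrow> y \<in> I"
  obtains g where "g \<in> pos_uo" "\<And>x y. y \<in> I \<Longrightarrow> 0 \<le> y \<Longrightarrow> y \<le> x \<Longrightarrow> f y \<le> g x"
    "\<And>x c. 0 \<le> x \<Longrightarrow> (\<And>y. y \<in> I \<Longrightarrow> 0 \<le> y \<Longrightarrow> y \<le> x \<Longrightarrow> f y \<le> c) \<Longrightarrow> g x \<le> c"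
proof -
  note lin = uo_functionals_linear[OF f]
  define S where "S x = {y \<in> I. 0 \<le> y \<and> y \<le> x}" for x
  define p where "p x = Sup (f ` S x)" for x
  obtain K where K: "\<And>x. \<bar>f x\<bar> \<le> norm x * K" "0 \<le> K"
    using bounded_linear.nonneg_bounded[OF uo_functionals_bounded_linear[OF f]] by auto
  have bdd: "bdd_above (f ` S x)" for x
  proof (rule bdd_aboveI2)
    fix y assume y: "y \<in> S x"
    then have "norm y * K \<le> norm x * K"
      using K(2) by (intro mult_right_mono norm_mono_nonneg) (auto simp: S_def)
    with K(1)[of y] show "f y \<le> norm x * K" by linarith
  qed
  have up: "f y \<le> p x" if "y \<in> S x" for x y
    unfolding p_def using that bdd by (intro cSup_upper) auto
  have zero: "0 \<in> S x" if "0 \<le> x" for x using I0 that by (simp add: S_def)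
  have least: "p x \<le> c" if "0 \<le> x" "\<And>y. y \<in> S x \<Longrightarrow> f y \<le> c" for x c
    unfolding p_def using zero[OF that(1)] that(2) by (intro cSup_least) auto
  \<comment> \<open>One inequality splits a competitor by Riesz decomposition, with both pieces in
    \<open>I\<close> because \<open>I\<close> is closed downwards; the other adds two
    competitors.\<close>
  have padd: "p (x1 + x2) = p x1 + p x2" if x: "0 \<le> x1" "0 \<le> x2" for x1 x2
  proof (rule antisym)
    show "p (x1 + x2) \<le> p x1 + p x2"
    proof (rule least)
      fix y assume y: "y \<in> S (x1 + x2)"
      then obtain y1 y2 where d: "y = y1 + y2" "0 \<le> y1" "y1 \<le> x1" "0 \<le> y2" "y2 \<le> x2"
        using riesz_decomposition[of y x1 x2] x by (auto simp: S_def)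
      then have "y1 \<in> S x1" "y2 \<in> S x2"
        using y Idown[of y y1] Idown[of y y2] by (auto simp: S_def)
      then show "f y \<le> p x1 + p x2" using up unfolding d(1) linear_add[OF lin] by (intro add_mono)
    qed (use x in simp)
    have "p x1 \<le> p (x1 + x2) - f y2" if y2: "y2 \<in> S x2" for y2
    proof (rule least[OF x(1)])
      fix y1 assume "y1 \<in> S x1"
      then have "y1 + y2 \<in> S (x1 + x2)" using y2 Iadd by (auto simp: S_def intro: add_mono)
      from up[OF this] show "f y1 \<le> p (x1 + x2) - f y2" by (simp add: linear_add[OF lin])
    qed
    then have "p x2 \<le> p (x1 + x2) - p x1" by (intro least[OF x(2)]) (simp add: algebra_simps)
    then show "p x1 + p x2 \<le> p (x1 + x2)" by simp
  qed
  have le: "p (c *\<^sub>R x) \<le> c * p x" if c: "0 < c" and x: "0 \<le> x" for c x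
  proof (rule least)
    fix y assume y: "y \<in> S (c *\<^sub>R x)"
    then have "(1/c) *\<^sub>R y \<in> S x"
      using c Iscale[of "1/c" y] scaleR_left_mono[of y "c *\<^sub>R x" "1/c"]
      by (auto simp: S_def scaleR_nonneg_nonneg)
    from up[OF this] c show "f y \<le> c * p x" by (simp add: linear_cmul[OF lin] field_simps)
  qed (use c x in \<open>simp add: scaleR_nonneg_nonneg\<close>)
  have pscale: "p (c *\<^sub>R x) = c * p x" if c: "0 \<le> c" and x: "0 \<le> x" for c x
  proof (cases "c = 0")
    case True
    have "S 0 = {0}" using I0 by (auto simp: S_def)
    then show ?thesis using True linear_0[OF lin] by (simp add: p_def)
  next
    case False
    then have "p x \<le> (1/c) * p (c *\<^sub>R x)"
      using le[of "1/c" "c *\<^sub>R x"] c x by (simp add: scaleR_nonneg_nonneg)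
    then show ?thesis using le[of c x] False c x by (simp add: field_simps)
  qed
  obtain g where g: "linear g" "\<And>x. 0 \<le> x \<Longrightarrow> g x = p x"
    using linear_extension_of_cone_map[of p, OF padd pscale] by blast
  have gpos: "0 \<le> g x" if "0 \<le> x" for x
    using up[OF zero[OF that]] that by (simp add: g(2) linear_0[OF lin])
  have "g \<in> uo_functionals"
    unfolding uo_functionals_def
  proof (intro CollectI conjI allI impI g(1))
    fix r :: "'a net_index rel" and x :: "'a net_index \<Rightarrow> 'a"
    assume *: "directed_preorder r \<and> bounded (x ` Field r) \<and> uo_converges r x 0"
    show "((\<lambda>\<alpha>. g (x \<alpha>)) \<longlongrightarrow> 0) (net_filter r)"
    proof (rule tendstoI)
      fix e :: real assume e: "0 < e"
      have "\<exists>y. y \<in> S \<bar>x \<alpha>\<bar> \<and> p \<bar>x \<alpha>\<bar> - e/2 < f y" for \<alpha>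
      proof (rule ccontr)
        assume "\<not> ?thesis"
        then have "p \<bar>x \<alpha>\<bar> \<le> p \<bar>x \<alpha>\<bar> - e/2" by (intro least) (auto simp: not_less)
        with e show False by simp
      qed
      then obtain y where y: "\<And>\<alpha>. y \<alpha> \<in> S \<bar>x \<alpha>\<bar>" "\<And>\<alpha>. p \<bar>x \<alpha>\<bar> - e/2 < f (y \<alpha>)" by metis
      have yx: "\<bar>y \<alpha>\<bar> \<le> \<bar>x \<alpha>\<bar>" for \<alpha> using y(1)[of \<alpha>] by (simp add: S_def)
      obtain M where "\<And>\<alpha>. \<alpha> \<in> Field r \<Longrightarrow> norm (x \<alpha>) \<le> M" using * by (auto simp: bounded_iff)
      then have "norm (y \<alpha>) \<le> M" if "\<alpha> \<in> Field r" for \<alpha>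
        using norm_mono_abs[OF yx[of \<alpha>]] that by (meson order_trans)
      then have "bounded (y ` Field r)" by (auto simp: bounded_iff intro!: exI[of _ M])
      moreover have "uo_converges r y 0" using * yx by (auto intro: uo_converges_0_dominated)
      ultimately have "((\<lambda>\<alpha>. f (y \<alpha>)) \<longlongrightarrow> 0) (net_filter r)"
        using * by (intro uo_functionals_tendsto[OF f]) auto
      from tendstoD[OF this, of "e/2"] e have "\<forall>\<^sub>F \<alpha> in net_filter r. \<bar>f (y \<alpha>)\<bar> < e/2" by simp
      then show "\<forall>\<^sub>F \<alpha> in net_filter r. dist (g (x \<alpha>)) 0 < e"
      proof (rule eventually_mono)
        fix \<alpha> assume "\<bar>f (y \<alpha>)\<bar> < e/2"
        moreover have "\<bar>g (x \<alpha>)\<bar> \<le> g \<bar>x \<alpha>\<bar>" by (rule pos_linear_abs_le[OF g(1) gpos])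
        moreover have "g \<bar>x \<alpha>\<bar> = p \<bar>x \<alpha>\<bar>" by (simp add: g(2))
        ultimately show "dist (g (x \<alpha>)) 0 < e" using y(2)[of \<alpha>] by simp
      qed
    qed
  qed
  with gpos have "g \<in> pos_uo" by (simp add: pos_uo_def)
  then show ?thesis
    using up least by (intro that[of g]) (auto simp: g(2) S_def)
qed

lemma uo_functionals_pos_part:
  assumes f: "f \<in> uo_functionals"
  obtains g where "g \<in> pos_uo" "(\<lambda>x. g x - f x) \<in> pos_uo"
proof (rule uo_functionals_solid_sup[OF f, of UNIV])
  fix g assume g: "g \<in> pos_uo" "\<And>x y. y \<in> UNIV \<Longrightarrow> 0 \<le> y \<Longrightarrow> y \<le> x \<Longrightarrow> f y \<le> g x"
  have "(\<lambda>x. g x - f x) \<in> pos_uo"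
    using uo_functionals_diff[OF pos_uo_D(1)[OF g(1)] f] g(2) by (auto simp: pos_uo_def)
  with g(1) show ?thesis by (rule that)
qed auto

text \<open>With \<open>h\<close> above both \<open>0\<close> and \<open>f\<close>, the functional
  \<open>h + (h - f)\<close> dominates the two positive terms of \<open>f = h - (h - f)\<close>.
  Every member of the uo-dual therefore lies in some interval \<open>[-g, g]\<close>, so statements
  about such intervals reach the whole uo-dual.\<close>

lemma uo_functionals_dominating:
  assumes f: "f \<in> uo_functionals"
  obtains g where "g \<in> pos_uo" "\<And>x. \<bar>f x\<bar> \<le> g \<bar>x\<bar>"
proof -
  obtain h where h: "h \<in> pos_uo" "(\<lambda>x. h x - f x) \<in> pos_uo"
    using uo_functionals_pos_part[OF f] .
  have 1: "(\<lambda>x. h x + (h x - f x)) \<in> pos_uo"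
    using uo_functionals_add[OF pos_uo_D(1)[OF h(1)] pos_uo_D(1)[OF h(2)]]
      add_nonneg_nonneg[OF pos_uo_D(3)[OF h(1)] pos_uo_D(3)[OF h(2)]]
    unfolding pos_uo_def by blast
  have "\<bar>f x\<bar> \<le> h \<bar>x\<bar> + (h \<bar>x\<bar> - f \<bar>x\<bar>)" for x
    using pos_uo_abs_le[OF h(1), of x] pos_uo_abs_le[OF h(2), of x] by linarith
  with 1 show ?thesis by (rule that)
qed

text \<open>Among functionals between \<open>0\<close> and \<open>f\<close> on the positive cone,
  none exceeds \<open>f (pprt x)\<close> at \<open>x\<close>; the component of \<open>f\<close> on
  the ideal generated by \<open>pprt x\<close> attains this value, because it agrees with
  \<open>f\<close> at \<open>pprt x\<close> and vanishes at the disjoint element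
  \<open>pprt (- x)\<close>.\<close>

lemma pos_uo_component:
  fixes x :: "'a::banach_lattice"
  assumes f: "f \<in> pos_uo"
  obtains g where "g \<in> pos_uo" "(\<lambda>x. f x - g x) \<in> pos_uo" "g x = f (pprt x)"
proof -
  define I where "I = {y. 0 \<le> y \<and> (\<exists>t\<ge>0. y \<le> t *\<^sub>R pprt x)}"
  have I: "0 \<in> I" "\<And>a b. a \<in> I \<Longrightarrow> b \<in> I \<Longrightarrow> a + b \<in> I"
    "\<And>c a. 0 \<le> c \<Longrightarrow> a \<in> I \<Longrightarrow> c *\<^sub>R a \<in> I" "\<And>a b. a \<in> I \<Longrightarrow> 0 \<le> b \<Longrightarrow> b \<le> a \<Longrightarrow> b \<in> I"
  proof -
    show "0 \<in> I" by (auto simp: I_def intro!: exI[of _ 0])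
    show "a + b \<in> I" if ab: "a \<in> I" "b \<in> I" for a b
    proof -
      from ab obtain s t where "0 \<le> s" "a \<le> s *\<^sub>R pprt x" "0 \<le> t" "b \<le> t *\<^sub>R pprt x"
        by (auto simp: I_def)
      then have "0 \<le> s + t" "a + b \<le> (s + t) *\<^sub>R pprt x" by (auto simp: scaleR_add_left add_mono)
      with ab show ?thesis unfolding I_def by auto
    qed
    show "c *\<^sub>R a \<in> I" if c: "0 \<le> c" and a: "a \<in> I" for c a
    proof -
      from a obtain s where "0 \<le> s" "a \<le> s *\<^sub>R pprt x" by (auto simp: I_def)
      then have "0 \<le> c * s" "c *\<^sub>R a \<le> (c * s) *\<^sub>R pprt x"
        using c scaleR_left_mono[of a "s *\<^sub>R pprt x" c] by auto
      with c a show ?thesis unfolding I_def by (auto simp: scaleR_nonneg_nonneg)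
    qed
    show "b \<in> I" if "a \<in> I" "0 \<le> b" "b \<le> a" for a b
      using that by (auto simp: I_def intro: order_trans)
  qed
  obtain g where g: "g \<in> pos_uo" "\<And>u y. y \<in> I \<Longrightarrow> 0 \<le> y \<Longrightarrow> y \<le> u \<Longrightarrow> f y \<le> g u"
    "\<And>u c. 0 \<le> u \<Longrightarrow> (\<And>y. y \<in> I \<Longrightarrow> 0 \<le> y \<Longrightarrow> y \<le> u \<Longrightarrow> f y \<le> c) \<Longrightarrow> g u \<le> c"
  proof (rule uo_functionals_solid_sup[OF pos_uo_D(1)[OF f], of I])
    fix g assume "g \<in> pos_uo" "\<And>u y. y \<in> I \<Longrightarrow> 0 \<le> y \<Longrightarrow> y \<le> u \<Longrightarrow> f y \<le> g u"
      "\<And>u c. 0 \<le> u \<Longrightarrow> (\<And>y. y \<in> I \<Longrightarrow> 0 \<le> y \<Longrightarrow> y \<le> u \<Longrightarrow> f y \<le> c) \<Longrightarrow> g u \<le> c"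
    then show thesis by (rule that)
  qed (simp_all add: I(1,2,3) I(4))
  have gf: "g u \<le> f u" if "0 \<le> u" for u
    using that by (intro g(3)) (auto intro: pos_uo_mono[OF f])
  have "(\<lambda>x. f x - g x) \<in> pos_uo"
    using uo_functionals_diff[OF pos_uo_D(1)[OF f] pos_uo_D(1)[OF g(1)]] gf
    by (auto simp: pos_uo_def)
  moreover have "pprt x \<in> I" by (auto simp: I_def intro!: exI[of _ 1])
  then have "g (pprt x) = f (pprt x)" using g(2)[of "pprt x" "pprt x"] gf[of "pprt x"] by simp
  moreover have "g (pprt (- x)) \<le> 0"
  proof (rule g(3))
    fix y assume "y \<in> I" and y: "0 \<le> y" "y \<le> pprt (- x)"
    then obtain t where t: "0 \<le> t" "y \<le> t *\<^sub>R pprt x" by (auto simp: I_def)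
    \<comment> \<open>The factor \<open>t + 1\<close> is at least both \<open>t\<close> and
      \<open>1\<close>, so a single multiple bounds \<open>y\<close> on both sides and disjointness
      of the two parts of \<open>x\<close> applies.\<close>
    have "y \<le> inf ((t + 1) *\<^sub>R pprt x) ((t + 1) *\<^sub>R pprt (- x))"
    proof (rule le_infI)
      show "y \<le> (t + 1) *\<^sub>R pprt x"
        using t(2) scaleR_right_mono[of t "t + 1" "pprt x"] by (auto intro: order_trans)
      show "y \<le> (t + 1) *\<^sub>R pprt (- x)"
        using y(2) scaleR_right_mono[of 1 "t + 1" "pprt (- x)"] t(1) by (auto intro: order_trans)
    qed
    also have "\<dots> = 0"
      using t(1) by (subst scaleR_inf_distrib[symmetric]) (auto simp: inf_pprt_pprt_uminus)
    finally have "y = 0" using y(1) by simp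
    then show "f y \<le> 0" by (simp add: linear_0[OF pos_uo_D(2)[OF f]])
  qed simp
  then have "g (pprt (- x)) = 0" using pos_uo_D(3)[OF g(1), of "pprt (- x)"] by simp
  ultimately show ?thesis
    using g(1) linear_diff[OF pos_uo_D(2)[OF g(1)], of "pprt x" "pprt (- x)"]
    by (intro that[of g]) (simp_all add: pprt_diff_pprt_uminus)
qed

text \<open>Give the component of \<open>f\<close> on the positive part of \<open>x\<close> the sign
  plus and its complement the sign minus. This converts estimates that hold for all \<open>g\<close>
  in \<open>[-f, f]\<close> into estimates in the seminorm
  \<open>\<lambda>x. f \<bar>x\<bar>\<close>.\<close>

lemma pos_uo_abs_attained:
  assumes f: "f \<in> pos_uo"
  obtains g where "g \<in> uo_functionals" "\<And>z. \<bar>g z\<bar> \<le> f \<bar>z\<bar>" "g x = f \<bar>x\<bar>"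
proof -
  obtain h where h: "h \<in> pos_uo" "(\<lambda>x. f x - h x) \<in> pos_uo" "h x = f (pprt x)"
    using pos_uo_component[OF f] .
  note lin = pos_uo_D(2)[OF f]
  have "(\<lambda>z. h z - (f z - h z)) \<in> uo_functionals"
    by (intro uo_functionals_diff pos_uo_D(1) h f)
  moreover have "\<bar>h z - (f z - h z)\<bar> \<le> f \<bar>z\<bar>" for z
    using pos_uo_abs_le[OF h(1), of z] pos_uo_abs_le[OF h(2), of z] by linarith
  moreover have "h x - (f x - h x) = f \<bar>x\<bar>"
    using linear_diff[OF lin, of "pprt x" "pprt (- x)"] linear_add[OF lin, of "pprt x" "pprt (- x)"]
    by (simp add: h(3) pprt_diff_pprt_uminus abs_eq_pprt_add[symmetric])
  ultimately show ?thesis by (rule that)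
qed

lemma uo_dual_separates_points_eq_0:
  assumes sep: "uo_dual_separates_points TYPE('a::banach_lattice)"
    and x: "\<And>f. f \<in> pos_uo \<Longrightarrow> f x = 0"
  shows "x = (0::'a)"
proof (rule ccontr)
  assume "x \<noteq> 0"
  then obtain \<phi> where \<phi>: "\<phi> \<in> uo_dual" "blinfun_apply \<phi> x \<noteq> blinfun_apply \<phi> 0"
    using sep unfolding uo_dual_separates_points_def by blast
  then have "blinfun_apply \<phi> \<in> uo_functionals" by (simp add: uo_dual_def)
  then obtain g where g: "g \<in> pos_uo" "(\<lambda>x. g x - blinfun_apply \<phi> x) \<in> pos_uo"
    by (rule uo_functionals_pos_part)
  from x[OF g(1)] x[OF g(2)] \<phi>(2) show False by simp
qed

text \<open>Separation of points is upgraded to control of the order: the component \<open>h\<close>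
  of \<open>f\<close> concentrated on the negative part of \<open>x\<close> satisfies
  \<open>h (- x) = f (pprt (- x))\<close>, so \<open>0 \<le> h x\<close> forces \<open>f\<close> to
  vanish on that part.\<close>

lemma pos_uo_nonneg_imp_nonneg:
  assumes sep: "uo_dual_separates_points TYPE('a::banach_lattice)"
    and x: "\<And>f. f \<in> pos_uo \<Longrightarrow> 0 \<le> f x"
  shows "0 \<le> (x::'a)"
proof -
  have "pprt (- x) = 0"
  proof (rule uo_dual_separates_points_eq_0[OF sep])
    fix f :: "'a \<Rightarrow> real" assume f: "f \<in> pos_uo"
    obtain h where h: "h \<in> pos_uo" "h (- x) = f (pprt (- x))"
      using pos_uo_component[OF f] by blast
    have "h (- x) \<le> 0" using x[OF h(1)] linear_neg[OF pos_uo_D(2)[OF h(1)]] by simp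
    with h(2) pos_uo_D(3)[OF f, of "pprt (- x)"] show "f (pprt (- x)) = 0" by simp
  qed
  then show ?thesis by (metis le_zero_iff_zero_pprt neg_le_0_iff_le)
qed

section \<open>Order continuity of positive functionals\<close>

lemma order_converges_downward_directed:
  fixes D :: "'a::banach_lattice set"
  assumes "D \<noteq> {}" "\<And>a b. a \<in> D \<Longrightarrow> b \<in> D \<Longrightarrow> \<exists>c\<in>D. c \<le> a \<and> c \<le> b"
    and "\<And>a. a \<in> D \<Longrightarrow> 0 \<le> a" "\<And>v. (\<And>a. a \<in> D \<Longrightarrow> v \<le> a) \<Longrightarrow> v \<le> 0"
    and "\<And>d. d \<in> D \<Longrightarrow> \<exists>\<alpha>\<^sub>0\<in>Field r. \<forall>\<alpha>. (\<alpha>\<^sub>0, \<alpha>) \<in> r \<longrightarrow> \<bar>x \<alpha> - l\<bar> \<le> d"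
  shows "order_converges r x l"
proof -
  define s where "s = {(a, b). a \<in> D \<and> b \<in> D \<and> b \<le> a}"
  have s: "directed_preorder s" "Field s = D"
    by (rule directed_preorderI[where A = D]; use assms(1,2) in \<open>auto simp: s_def\<close>)+
  have "decreases_to s id 0"
    using assms(3,4) unfolding decreases_to_def s(2) isGlb_UNIV_iff by (auto simp: s_def)
  with s(1) show ?thesis
    by (rule order_converges_toI) (use assms(5) in \<open>auto simp: s(2)\<close>)
qed

text \<open>The elements of \<open>D\<close>, indexed by themselves in reverse order, decrease to
  \<open>0\<close> and so are uo-null.\<close>

lemma pos_uo_order_continuous:
  fixes D :: "'a::banach_lattice set"
  assumes f: "f \<in> pos_uo" and ne: "D \<noteq> {}"
    and dir: "\<And>a b. a \<in> D \<Longrightarrow> b \<in> D \<Longrightarrow> \<exists>c\<in>D. c \<le> a \<and> c \<le> b"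
    and pos: "\<And>a. a \<in> D \<Longrightarrow> 0 \<le> a" and inf: "\<And>v. (\<And>a. a \<in> D \<Longrightarrow> v \<le> a) \<Longrightarrow> v \<le> 0"
    and e: "0 < (e::real)"
  obtains d where "d \<in> D" "f d < e"
proof -
  obtain d0 where d0: "d0 \<in> D" using ne by blast
  \<comment> \<open>Cutting \<open>D\<close> off at \<open>d0\<close> makes the net norm bounded, as
    the definition of the uo-dual demands, and keeps it cofinal below every element of
    \<open>D\<close>.\<close>
  define E where "E = {d\<in>D. d \<le> d0}"
  define r where "r = {(a, b). a \<in> E \<and> b \<in> E \<and> b \<le> a}"
  have dirE: "\<exists>c\<in>E. c \<le> a \<and> c \<le> b" if "a \<in> E" "b \<in> E" for a b
    using dir[of a b] that by (auto simp: E_def intro: order_trans)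
  have r: "directed_preorder r" "Field r = E"
    by (rule directed_preorderI[where A = E]; use d0 dirE in \<open>auto simp: r_def E_def\<close>)+
  have "bounded (id ` Field r)"
    unfolding bounded_iff r(2) E_def using norm_mono_nonneg[OF pos] by auto
  moreover have "uo_converges r id 0"
    unfolding uo_converges_def
  proof (intro allI impI)
    fix y :: 'a assume y: "0 \<le> y"
    show "order_converges r (\<lambda>\<alpha>. inf \<bar>id \<alpha> - 0\<bar> y) 0"
    proof (rule order_converges_downward_directed[where D = D, OF ne dir pos inf])
      fix d assume d: "d \<in> D"
      obtain c where c: "c \<in> D" "c \<le> d" "c \<le> d0" using dir[OF d d0] by auto
      have "\<bar>inf (\<bar>id \<alpha> - 0\<bar>) y - 0\<bar> \<le> d" if "(c, \<alpha>) \<in> r" for \<alpha>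
      proof -
        have "0 \<le> \<alpha>" "\<alpha> \<le> c" using that pos by (auto simp: r_def E_def)
        then have "\<bar>inf (\<bar>id \<alpha> - 0\<bar>) y - 0\<bar> = inf \<alpha> y" using y by simp
        also have "\<dots> \<le> d" using \<open>\<alpha> \<le> c\<close> c(2) by (auto intro: le_infI1 order_trans)
        finally show ?thesis .
      qed
      then show "\<exists>\<alpha>\<^sub>0\<in>Field r. \<forall>\<alpha>. (\<alpha>\<^sub>0, \<alpha>) \<in> r \<longrightarrow> \<bar>inf (\<bar>id \<alpha> - 0\<bar>) y - 0\<bar> \<le> d"
        using c unfolding r(2) E_def by auto
    qed
  qed
  ultimately have "((\<lambda>\<alpha>. f (id \<alpha>)) \<longlongrightarrow> 0) (net_filter r)"
    by (intro uo_functionals_tendsto[OF pos_uo_D(1)[OF f] r(1)])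
  from tendstoD[OF this e] obtain a where a: "a \<in> E" "\<And>b. (a, b) \<in> r \<Longrightarrow> \<bar>f b\<bar> < e"
    unfolding eventually_net_filter[OF r(1)] r(2) by auto
  then have "\<bar>f a\<bar> < e" by (intro a(2)) (simp add: r_def)
  then have "f a < e" by linarith
  with a(1) show ?thesis by (intro that[of a]) (auto simp: E_def)
qed

lemma pos_uo_order_continuous_sup:
  fixes A :: "'a::banach_lattice set"
  assumes f: "f \<in> pos_uo" and ne: "A \<noteq> {}"
    and dir: "\<And>a b. a \<in> A \<Longrightarrow> b \<in> A \<Longrightarrow> \<exists>c\<in>A. a \<le> c \<and> b \<le> c"
    and u: "isLub UNIV A u" and e: "0 < (e::real)"
  obtains a where "a \<in> A" "f (u - a) < e"
proof -
  have u: "\<And>a. a \<in> A \<Longrightarrow> a \<le> u" "\<And>v. (\<And>a. a \<in> A \<Longrightarrow> a \<le> v) \<Longrightarrow> u \<le> v"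
    using u by (auto simp: isLub_UNIV_iff)
  have dir': "\<exists>c\<in>(\<lambda>a. u - a) ` A. c \<le> x \<and> c \<le> y"
    if "x \<in> (\<lambda>a. u - a) ` A" "y \<in> (\<lambda>a. u - a) ` A" for x y
    using that dir by (auto; metis)
  have inf: "v \<le> 0" if "\<And>x. x \<in> (\<lambda>a. u - a) ` A \<Longrightarrow> v \<le> x" for v
  proof -
    note hyp = that
    have "a \<le> u - v" if "a \<in> A" for a
      using hyp[of "u - a"] that by (simp add: algebra_simps)
    from u(2)[OF this] show ?thesis by simp
  qed
  have "\<exists>d\<in>(\<lambda>a. u - a) ` A. f d < e"
    by (rule pos_uo_order_continuous[OF f _ dir' _ inf e])
      (use ne u(1) in auto)
  then show ?thesis using that by auto
qed

lemma pos_uo_order_continuous_inf: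
  fixes A :: "'a::banach_lattice set"
  assumes f: "f \<in> pos_uo" and ne: "A \<noteq> {}"
    and dir: "\<And>a b. a \<in> A \<Longrightarrow> b \<in> A \<Longrightarrow> \<exists>c\<in>A. c \<le> a \<and> c \<le> b"
    and u: "isGlb UNIV A u" and e: "0 < (e::real)"
  obtains a where "a \<in> A" "f (a - u) < e"
proof -
  have u: "\<And>a. a \<in> A \<Longrightarrow> u \<le> a" "\<And>v. (\<And>a. a \<in> A \<Longrightarrow> v \<le> a) \<Longrightarrow> v \<le> u"
    using u by (auto simp: isGlb_UNIV_iff)
  have dir': "\<exists>c\<in>(\<lambda>a. a - u) ` A. c \<le> x \<and> c \<le> y"
    if "x \<in> (\<lambda>a. a - u) ` A" "y \<in> (\<lambda>a. a - u) ` A" for x y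
    using that dir by (auto; metis)
  have inf: "v \<le> 0" if "\<And>x. x \<in> (\<lambda>a. a - u) ` A \<Longrightarrow> v \<le> x" for v
  proof -
    note hyp = that
    have "v + u \<le> a" if "a \<in> A" for a
      using hyp[of "a - u"] that by (simp add: algebra_simps)
    from u(2)[OF this] show ?thesis by simp
  qed
  have "\<exists>d\<in>(\<lambda>a. a - u) ` A. f d < e"
    by (rule pos_uo_order_continuous[OF f _ dir' _ inf e])
      (use ne u(1) in auto)
  then show ?thesis using that by auto
qed

section \<open>Approximation of functionals on the uo-dual\<close>

lemma nonneg_term_le_suminf:
  fixes g :: "nat \<Rightarrow> 'a::banach_lattice"
  assumes "summable g" "\<And>n. 0 \<le> g n"
  shows "g n \<le> suminf g"
proof -
  have "(\<lambda>m. sum g {..<m} - g n) \<longlonglongrightarrow> suminf g - g n"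
    by (intro tendsto_intros summable_LIMSEQ assms(1))
  moreover have "eventually (\<lambda>m. 0 \<le> sum g {..<m} - g n) sequentially"
    unfolding eventually_sequentially
  proof (intro exI allI impI)
    fix m assume "Suc n \<le> m"
    then have "sum g {n} \<le> sum g {..<m}" by (intro sum_mono2 assms(2)) auto
    then show "0 \<le> sum g {..<m} - g n" by simp
  qed
  ultimately have "0 \<le> suminf g - g n" by (rule banach_lattice_nonneg_limit)
  then show ?thesis by simp
qed

definition nat_preorder :: "nat rel" where
  "nat_preorder = {(m, n). m \<le> n}"

lemma nat_preorder: "directed_preorder nat_preorder" "Field nat_preorder = UNIV"
  by (rule directed_preorderI[where A = UNIV];
      auto simp: nat_preorder_def intro: max.cobounded1 max.cobounded2)+

text \<open>The suprema of the tails of \<open>inf (w k) z\<close> need not exist, so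
  \<open>D\<close> collects all upper bounds of tails, and the point is that only \<open>0\<close>
  can be a positive lower bound of \<open>D\<close>.\<close>

lemma disjoint_sequence_uo_converges_0:
  fixes w :: "nat \<Rightarrow> 'a::banach_lattice"
  assumes w: "\<And>n. 0 \<le> w n" and disj: "\<And>m n. m \<noteq> n \<Longrightarrow> inf (w m) (w n) = 0"
  shows "uo_converges nat_preorder w 0"
  unfolding uo_converges_def
proof (intro allI impI)
  fix z :: 'a assume z: "0 \<le> z"
  define ub where "ub n = {d. \<forall>k\<ge>n. inf (w k) z \<le> d}" for n
  define D where "D = (\<Union>n. ub n)"
  have ub_mono: "ub m \<subseteq> ub n" if "m \<le> n" for m n using that by (auto simp: ub_def)
  have D0: "0 \<le> d" if "d \<in> D" for d
  proof -
    from that obtain n where "inf (w n) z \<le> d" by (auto simp: D_def ub_def)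
    moreover have "0 \<le> inf (w n) z" using w z by simp
    ultimately show ?thesis by order
  qed
  \<comment> \<open>Bounds stay bounds after subtracting \<open>t\<close>, hence after subtracting every multiple of \<open>t\<close>.\<close>
  have zero: "t \<le> 0" if t: "0 \<le> t" "\<And>d. d \<in> D \<Longrightarrow> t \<le> d" and tw: "\<And>k. n \<le> k \<Longrightarrow> inf (w k) t = 0" for t n
  proof -
    have "z - real m *\<^sub>R t \<in> ub n" for m
    proof (induction m)
      case (Suc m)
      have "inf (w k) z \<le> z - real m *\<^sub>R t - t" if k: "n \<le> k" for k
      proof -
        have "inf (inf (w k) z) t \<le> inf (w k) t" by (auto intro: le_infI1)
        then have "inf (inf (w k) z) t = 0"
          using tw[OF k] w[of k] z t(1) by (auto intro!: antisym)
        moreover have "t \<le> z - real m *\<^sub>R t" using Suc t(2) by (auto simp: D_def)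
        moreover have "inf (w k) z \<le> z - real m *\<^sub>R t" using Suc k by (auto simp: ub_def)
        ultimately have "inf (w k) z + t \<le> z - real m *\<^sub>R t" by (intro disjoint_add_le)
        then show ?thesis by (simp add: le_diff_eq)
      qed
      then show ?case by (simp add: ub_def algebra_simps)
    qed (auto simp: ub_def)
    then have "z - real m *\<^sub>R t \<in> D" for m by (auto simp: D_def)
    from D0[OF this] have "real m *\<^sub>R t \<le> z" for m by simp
    then show ?thesis by (rule archimedean)
  qed
  show "order_converges nat_preorder (\<lambda>\<alpha>. inf \<bar>w \<alpha> - 0\<bar> z) 0"
  proof (rule order_converges_downward_directed[where D = D])
    have "z \<in> ub 0" by (auto simp: ub_def)
    then show "D \<noteq> {}" by (auto simp: D_def)
    fix a b assume "a \<in> D" "b \<in> D"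
    then obtain m n where "a \<in> ub m" "b \<in> ub n" by (auto simp: D_def)
    then have "inf a b \<in> ub (max m n)" by (auto simp: ub_def)
    then show "\<exists>c\<in>D. c \<le> a \<and> c \<le> b" by (intro bexI[of _ "inf a b"]) (auto simp: D_def)
  next
    fix v assume v: "\<And>a. a \<in> D \<Longrightarrow> v \<le> a"
    then have pv: "pprt v \<le> d" if "d \<in> D" for d using that D0 by (simp add: pprt_def)
    \<comment> \<open>\<open>zero\<close> is used twice: first for
      \<open>inf (w j) (pprt v)\<close>, which is disjoint from all later terms, and then for
      \<open>pprt v\<close>, which is now known to be disjoint from every term.\<close>
    have "inf (w j) (pprt v) = 0" for j
    proof -
      have "inf (w j) (pprt v) \<le> 0"
      proof (rule zero)
        show "inf (w j) (pprt v) \<le> d" if "d \<in> D" for d using pv[OF that] by (rule le_infI2)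
        fix k assume "Suc j \<le> k"
        then have "inf (w k) (w j) = 0" by (intro disj) auto
        moreover have "inf (w k) (inf (w j) (pprt v)) \<le> inf (w k) (w j)" by (auto intro: le_infI2)
        ultimately show "inf (w k) (inf (w j) (pprt v)) = 0" using w by (auto intro!: antisym)
      qed (use w in auto)
      then show ?thesis using w by (auto intro!: antisym)
    qed
    then have "pprt v \<le> 0" using pv by (intro zero[of _ 0]) auto
    then show "v \<le> 0" by (simp add: pprt_def)
  next
    fix d assume "d \<in> D"
    then obtain n where "d \<in> ub n" by (auto simp: D_def)
    then show "\<exists>\<alpha>\<^sub>0\<in>Field nat_preorder. \<forall>\<alpha>. (\<alpha>\<^sub>0, \<alpha>) \<in> nat_preorder \<longrightarrow> \<bar>inf (\<bar>w \<alpha> - 0\<bar>) z - 0\<bar> \<le> d"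
      using w z unfolding nat_preorder(2)
      by (intro bexI[of _ n]) (auto simp: ub_def nat_preorder_def)
  qed (rule D0)
qed

lemma uo_functionals_disjoint_sequence:
  fixes w :: "nat \<Rightarrow> 'a::banach_lattice"
  assumes f: "f \<in> uo_functionals" and w: "\<And>n. 0 \<le> w n"
    and disj: "\<And>m n. m \<noteq> n \<Longrightarrow> inf (w m) (w n) = 0" and C: "\<And>n. norm (w n) \<le> C"
  shows "(\<lambda>n. f (w n)) \<longlonglongrightarrow> 0"
proof -
  have "bounded (w ` Field nat_preorder)" using C by (auto simp: bounded_iff)
  from uo_functionals_tendsto[OF f nat_preorder(1) this disjoint_sequence_uo_converges_0[OF w disj]]
  have *: "((\<lambda>n. f (w n)) \<longlongrightarrow> 0) (net_filter nat_preorder)" by blast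
  have "net_filter nat_preorder = sequentially"
    unfolding filter_eq_iff eventually_net_filter[OF nat_preorder(1)] eventually_sequentially
    unfolding nat_preorder(2) by (simp add: nat_preorder_def)
  with * show ?thesis by simp
qed

text \<open>If no \<open>y\<close> worked, one could choose \<open>b n\<close> in the ball with \<open>f\<close> large on the part of \<open>b n\<close>
  above \<open>4 ^ n\<close> times the sum of its predecessors. Up to a small error these parts are disjoint.\<close>

lemma pos_uo_uniformly_small_tails:
  fixes f :: "'a::banach_lattice \<Rightarrow> real"
  assumes f: "f \<in> pos_uo" and e: "0 < e"
  obtains y where "0 \<le> y" "\<And>b. norm b \<le> C \<Longrightarrow> f (pprt (\<bar>b\<bar> - y)) \<le> e"
proof (rule ccontr)
  note witness = that
  assume contra: "\<not> thesis"
  have ex: "\<exists>b. 0 \<le> b \<and> norm b \<le> C \<and> e < f (pprt (b - y))" if y: "0 \<le> y" for y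
  proof (rule ccontr)
    assume none: "\<not> ?thesis"
    have "f (pprt (\<bar>b\<bar> - y)) \<le> e" if "norm b \<le> C" for b
    proof (rule ccontr)
      assume "\<not> f (pprt (\<bar>b\<bar> - y)) \<le> e"
      then have "0 \<le> \<bar>b\<bar> \<and> norm \<bar>b\<bar> \<le> C \<and> e < f (pprt (\<bar>b\<bar> - y))" using that by simp
      with none show False by blast
    qed
    then have thesis by (rule witness[OF y])
    with contra show False ..
  qed
  obtain g where "\<forall>y. 0 \<le> y \<longrightarrow> 0 \<le> g y \<and> norm (g y) \<le> C \<and> e < f (pprt (g y - y))"
    using choice[of "\<lambda>y b. 0 \<le> y \<longrightarrow> 0 \<le> b \<and> norm b \<le> C \<and> e < f (pprt (b - y))"] ex by blast
  then have g: "\<And>y. 0 \<le> y \<Longrightarrow> 0 \<le> g y" "\<And>y. 0 \<le> y \<Longrightarrow> norm (g y) \<le> C"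
    "\<And>y. 0 \<le> y \<Longrightarrow> e < f (pprt (g y - y))" by blast+
  define s where "s = rec_nat 0 (\<lambda>n s. s + g (4 ^ n *\<^sub>R s))"
  define b where "b n = g (4 ^ n *\<^sub>R s n)" for n
  have s_simps: "s 0 = 0" "\<And>n. s (Suc n) = s n + b n" by (simp_all add: s_def b_def)
  have s0: "0 \<le> s n" for n
  proof (induction n)
    case (Suc n)
    then show ?case using g(1)[of "4 ^ n *\<^sub>R s n"]
      by (simp add: s_simps(2) b_def scaleR_nonneg_nonneg)
  qed (simp add: s_simps)
  then have b: "0 \<le> b n" "norm (b n) \<le> C" "e < f (pprt (b n - 4 ^ n *\<^sub>R s n))" for n
    using g[of "4 ^ n *\<^sub>R s n"] by (simp_all add: b_def scaleR_nonneg_nonneg)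
  have s_mono: "s m \<le> s n" if "m \<le> n" for m n
    using that b(1) by (induction rule: dec_induct) (auto simp: s_simps(2) intro: order_trans)
  have bs: "b n \<le> s m" if "n < m" for m n
    using s_mono[of "Suc n" m] that s0[of n] by (simp add: s_simps(2)) (meson le_add_same_cancel2 order_trans)
  \<comment> \<open>The weights make the chosen elements summable, and the sum \<beta> dominates all
    of them up to factors: \<open>b m \<le> 2 ^ m *\<^sub>R \<beta>\<close>.\<close>
  define h where "h n = (1/2::real) ^ n *\<^sub>R b n" for n
  have h0: "0 \<le> h n" for n using b by (simp add: h_def scaleR_nonneg_nonneg)
  have hC: "norm (h n) \<le> C * (1/2) ^ n" for n
    using mult_right_mono[OF b(2)[of n], of "(1/2) ^ n"] by (simp add: h_def mult.commute)
  have "summable (\<lambda>n. norm (h n))"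
  proof (rule summable_comparison_test'[where N = 0])
    show "summable (\<lambda>n. C * (1/2) ^ n)" by (intro summable_mult summable_geometric) simp
    show "norm (norm (h n)) \<le> C * (1/2) ^ n" for n
      by (simp only: real_norm_def abs_norm_cancel hC)
  qed
  then have sh: "summable h" by (rule summable_norm_cancel)
  define \<beta> where "\<beta> = suminf h"
  have h\<beta>: "h n \<le> \<beta>" for n unfolding \<beta>_def by (rule nonneg_term_le_suminf[OF sh h0])
  have \<beta>0: "0 \<le> \<beta>" using h0[of 0] h\<beta>[of 0] by order
  \<comment> \<open>Subtracting a small multiple of \<beta> makes the parts exactly disjoint. Its
    cost \<open>(1/2) ^ n * f \<beta>\<close> tends to \<open>0\<close>, so \<open>f (w n)\<close>
    cannot tend to \<open>0\<close>, contrary to the behaviour of disjoint sequences.\<close>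
  define w where "w n = pprt (b n - 4 ^ n *\<^sub>R s n - (1/2) ^ n *\<^sub>R \<beta>)" for n
  have w0: "0 \<le> w n" for n by (simp add: w_def)
  have wb: "w n \<le> b n" for n
  proof -
    have "0 \<le> 4 ^ n *\<^sub>R s n" "0 \<le> (1/2::real) ^ n *\<^sub>R \<beta>" using s0 \<beta>0 by (simp_all add: scaleR_nonneg_nonneg)
    then have "0 \<le> 4 ^ n *\<^sub>R s n + (1/2::real) ^ n *\<^sub>R \<beta>" by (rule add_nonneg_nonneg)
    then have "b n - 4 ^ n *\<^sub>R s n - (1/2) ^ n *\<^sub>R \<beta> \<le> b n" by (simp add: algebra_simps)
    then show ?thesis using b(1) by (simp add: w_def pprt_def)
  qed
  have disj: "inf (w n) (w m) = 0" if nm: "n < m" for n m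
  proof -
    \<comment> \<open>\<open>w n\<close> is below a multiple of \<open>pprt q\<close> and
      \<open>w m\<close> below a multiple of \<open>pprt (- q)\<close>. The factor
      \<open>4 ^ m\<close> is what works for \<open>w m\<close>: \<open>4 ^ m *\<^sub>R s m\<close>
      dominates \<open>4 ^ m *\<^sub>R b n\<close>, and \<open>b m \<le> 2 ^ m *\<^sub>R \<beta>
      \<le> 4 ^ m *\<^sub>R (1/2) ^ n *\<^sub>R \<beta>\<close> as \<open>n < m\<close>.\<close>
    define q where "q = b n - (1/2) ^ n *\<^sub>R \<beta>"
    have "0 \<le> 4 ^ n *\<^sub>R s n" using s0 by (simp add: scaleR_nonneg_nonneg)
    then have "w n \<le> pprt q" unfolding w_def q_def by (intro pprt_mono) (simp add: algebra_simps)
    also have "\<dots> \<le> 4 ^ m *\<^sub>R pprt q" using scaleR_right_mono[of 1 "4 ^ m" "pprt q"] by simp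
    finally have 1: "w n \<le> 4 ^ m *\<^sub>R pprt q" .
    have "b m = 2 ^ m *\<^sub>R h m" by (simp add: h_def power_mult_distrib[symmetric])
    then have "b m \<le> 2 ^ m *\<^sub>R \<beta>" using h\<beta>[of m] by (simp add: scaleR_left_mono)
    moreover have "2 ^ m *\<^sub>R \<beta> = 4 ^ m *\<^sub>R (1/2) ^ m *\<^sub>R \<beta>"
      by (simp add: power_mult_distrib[symmetric])
    moreover have "(1/2::real) ^ m *\<^sub>R \<beta> \<le> (1/2) ^ n *\<^sub>R \<beta>"
      using nm \<beta>0 by (intro scaleR_right_mono power_decreasing) auto
    ultimately have "b m \<le> 4 ^ m *\<^sub>R (1/2) ^ n *\<^sub>R \<beta>"
      by (metis order_trans scaleR_left_mono zero_le_numeral zero_le_power)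
    moreover have "4 ^ m *\<^sub>R b n \<le> 4 ^ m *\<^sub>R s m" using bs[OF nm] by (intro scaleR_left_mono) auto
    moreover have "0 \<le> (1/2::real) ^ m *\<^sub>R \<beta>" using \<beta>0 by (simp add: scaleR_nonneg_nonneg)
    ultimately have "b m - 4 ^ m *\<^sub>R s m - (1/2) ^ m *\<^sub>R \<beta> \<le> 4 ^ m *\<^sub>R (1/2) ^ n *\<^sub>R \<beta> - 4 ^ m *\<^sub>R b n - 0"
      by (intro diff_mono)
    also have "\<dots> = 4 ^ m *\<^sub>R (- q)" by (simp add: q_def scaleR_diff_right)
    finally have "w m \<le> pprt (4 ^ m *\<^sub>R (- q))" unfolding w_def by (rule pprt_mono)
    then have 2: "w m \<le> 4 ^ m *\<^sub>R pprt (- q)" by (subst (asm) pprt_scaleR) auto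
    have "inf (w n) (w m) \<le> inf (4 ^ m *\<^sub>R pprt q) (4 ^ m *\<^sub>R pprt (- q))"
      using 1 2 by (rule inf_mono)
    also have "\<dots> = 0" by (subst scaleR_inf_distrib[symmetric]) (auto simp: inf_pprt_pprt_uminus)
    finally show ?thesis using w0 by (auto intro!: antisym)
  qed
  have "(\<lambda>n. f (w n)) \<longlonglongrightarrow> 0"
  proof (rule uo_functionals_disjoint_sequence[OF pos_uo_D(1)[OF f] w0])
    show "inf (w m) (w n) = 0" if "m \<noteq> n" for m n
      using disj[of m n] disj[of n m] that by (cases "m < n") (auto simp: inf.commute)
    show "norm (w n) \<le> C" for n using norm_mono_nonneg[OF w0 wb, of n] b(2)[of n] by simp
  qed
  moreover have "(\<lambda>n. (1/2) ^ n * f \<beta>) \<longlonglongrightarrow> 0"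
    by (intro tendsto_mult_left_zero LIMSEQ_power_zero) auto
  ultimately have "(\<lambda>n. f (w n) + (1/2) ^ n * f \<beta>) \<longlonglongrightarrow> 0 + 0" by (rule tendsto_add)
  moreover have "e \<le> f (w n) + (1/2) ^ n * f \<beta>" for n
  proof -
    let ?c = "(1/2) ^ n *\<^sub>R \<beta>"
    have "pprt ?c = ?c" using \<beta>0 by (intro pprt_eq_id scaleR_nonneg_nonneg) auto
    then have "pprt (b n - 4 ^ n *\<^sub>R s n) \<le> w n + ?c"
      using pprt_add_le[of "b n - 4 ^ n *\<^sub>R s n - ?c" ?c] by (simp add: w_def)
    from pos_uo_mono[OF f this] b(3)[of n] show ?thesis
      by (simp add: linear_add[OF pos_uo_D(2)[OF f]] linear_cmul[OF pos_uo_D(2)[OF f]])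
  qed
  ultimately have "e \<le> 0 + 0" by (intro tendsto_lowerbound) auto
  with e show False by simp
qed

section \<open>Helly approximation on finite sets\<close>

text \<open>A bounded functional on the uo-dual, transported to plain functions. The norm of
  \<open>f\<close> enters only through its bounds \<open>K\<close>, and strict positivity of
  \<open>C\<close> allows rescaling vectors to the sphere of radius \<open>C\<close>.\<close>

definition bidual_bounded :: "(('a::banach_lattice \<Rightarrow> real) \<Rightarrow> real) \<Rightarrow> real \<Rightarrow> bool" where
  "bidual_bounded G C \<longleftrightarrow> 0 < C \<and>
     (\<forall>f\<in>uo_functionals. \<forall>g\<in>uo_functionals. G (\<lambda>x. f x + g x) = G f + G g) \<and>
     (\<forall>c. \<forall>f\<in>uo_functionals. G (\<lambda>x. c * f x) = c * G f) \<and>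
     (\<forall>f\<in>uo_functionals. \<forall>K\<ge>0. (\<forall>x. \<bar>f x\<bar> \<le> K * norm x) \<longrightarrow> \<bar>G f\<bar> \<le> C * K)"

lemma bidual_boundedD:
  assumes "bidual_bounded G C"
  shows "0 < C"
    "f \<in> uo_functionals \<Longrightarrow> g \<in> uo_functionals \<Longrightarrow> G (\<lambda>x. f x + g x) = G f + G g"
    "f \<in> uo_functionals \<Longrightarrow> G (\<lambda>x. c * f x) = c * G f"
    "f \<in> uo_functionals \<Longrightarrow> 0 \<le> K \<Longrightarrow> (\<And>x. \<bar>f x\<bar> \<le> K * norm x) \<Longrightarrow> \<bar>G f\<bar> \<le> C * K"
  using assms by (auto simp: bidual_bounded_def)

lemma bidual_bounded_sum:
  assumes G: "bidual_bounded G C" and S: "finite S" "S \<subseteq> uo_functionals"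
  shows "G (\<lambda>x. \<Sum>f\<in>S. r f * f x) = (\<Sum>f\<in>S. r f * G f)"
  using S
proof (induction S)
  case empty
  have "(\<lambda>x. 0) \<in> uo_functionals" using uo_functionals_sum[of "{}"] by simp
  from bidual_boundedD(3)[OF G this, of 0] show ?case by simp
next
  case (insert f S)
  then have "(\<lambda>x. \<Sum>f\<in>S. r f * f x) \<in> uo_functionals"
    by (intro uo_functionals_sum uo_functionals_scale) auto
  with insert show ?case
    by (simp add: bidual_boundedD(2,3)[OF G] uo_functionals_scale)
qed

lemma uo_functionals_bounded:
  assumes "f \<in> uo_functionals"
  obtains K where "0 \<le> K" "\<And>x. \<bar>f x\<bar> \<le> K * norm x"
  using bounded_linear.nonneg_bounded[OF uo_functionals_bounded_linear[OF assms]]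
  by (auto simp: mult.commute)

text \<open>Helly's theorem without separation: if the mean square error \<open>Q\<close> were bounded away from \<open>0\<close>
  on the ball, then at a near-minimizer \<open>b\<close> the functional \<open>h\<close> formed with the residuals as
  coefficients would nearly attain its norm, and \<open>G h \<le> C * norm h\<close> would fail.\<close>

lemma bidual_weak_approximation:
  fixes G :: "('a::banach_lattice \<Rightarrow> real) \<Rightarrow> real"
  assumes G: "bidual_bounded G C" and S: "finite S" "S \<subseteq> uo_functionals" and e: "0 < e"
  obtains b where "norm b \<le> C" "\<And>f. f \<in> S \<Longrightarrow> \<bar>G f - f b\<bar> \<le> e"
proof -
  note C = bidual_boundedD(1)[OF G]
  have lin: "linear f" if "f \<in> S" for f using S(2) that uo_functionals_linear by blast
  have "\<exists>K\<ge>0. \<forall>x. \<bar>f x\<bar> \<le> K * norm x" if "f \<in> S" for f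
  proof -
    from S(2) that have "f \<in> uo_functionals" by blast
    then show ?thesis by (rule uo_functionals_bounded) blast
  qed
  then obtain K where K: "\<And>f. f \<in> S \<Longrightarrow> 0 \<le> K f" "\<And>f x. f \<in> S \<Longrightarrow> \<bar>f x\<bar> \<le> K f * norm x" by metis
  define Q where "Q b = (\<Sum>f\<in>S. (G f - f b)\<^sup>2)" for b
  define B where "B = {b::'a. norm b \<le> C}"
  define M where "M = (\<Sum>f\<in>S. (K f * (2 * C))\<^sup>2)"
  define d where "d = Inf (Q ` B)"
  have M0: "0 \<le> M" unfolding M_def by (intro sum_nonneg) auto
  have Q0: "0 \<le> Q b" for b unfolding Q_def by (intro sum_nonneg) auto
  have bdd: "bdd_below (Q ` B)" using Q0 by (intro bdd_belowI2) auto
  have "0 \<in> B" using C by (simp add: B_def)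
  then have ne: "Q ` B \<noteq> {}" by blast
  have dle: "d \<le> Q b" if "b \<in> B" for b unfolding d_def using that bdd by (intro cInf_lower) auto
  have near: "\<exists>b\<in>B. Q b < d + \<eta>" if "0 < \<eta>" for \<eta>
    using cInf_lessD[OF ne, of "d + \<eta>"] that unfolding d_def by auto
  have "d \<le> 0"
  proof (rule ccontr)
    assume "\<not> d \<le> 0"
    then have d: "0 < d" by simp
    \<comment> \<open>Moving from \<open>b\<close> towards \<open>c\<close> by \<open>t\<close>
      changes \<open>Q\<close> by \<open>- 2 * t * (h c - h b)\<close> plus at most
      \<open>t\<^sup>2 * M\<close>. With \<open>t * M \<le> d / 2\<close> and near-minimality up to
      \<open>t * d / 4\<close>, division by \<open>2 * t\<close> leaves \<open>3/8 * d\<close>,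
      which is below \<open>d\<close>.\<close>
    define t where "t = min 1 (d / (2 * (M + 1)))"
    have t: "0 < t" "t \<le> 1" using d M0 by (auto simp: t_def)
    have "t \<le> d / (2 * (M + 1))" by (simp add: t_def)
    moreover have "0 < 2 * (M + 1)" using M0 by simp
    ultimately have "t * (2 * (M + 1)) \<le> d" by (simp only: pos_le_divide_eq)
    then have tM: "t * M \<le> d / 2" using t(1) by (simp add: algebra_simps)
    obtain b where b: "b \<in> B" "Q b < d + t * d / 4" using near[of "t * d / 4"] t d by auto
    define r where "r f = G f - f b" for f
    define h where "h x = (\<Sum>f\<in>S. r f * f x)" for x
    have hU: "h \<in> uo_functionals"
      unfolding h_def using S by (intro uo_functionals_sum uo_functionals_scale) auto
    note hlin = uo_functionals_linear[OF hU]
    have step: "h c \<le> h b + 3/8 * d" if c: "c \<in> B" for c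
    proof -
      have "norm ((1 - t) *\<^sub>R b + t *\<^sub>R c) \<le> (1 - t) * norm b + t * norm c"
        using t by (intro norm_triangle_le) auto
      also have "\<dots> \<le> (1 - t) * C + t * C"
        using t b c by (intro add_mono mult_left_mono) (auto simp: B_def)
      finally have "(1 - t) *\<^sub>R b + t *\<^sub>R c \<in> B" by (simp add: B_def algebra_simps)
      from dle[OF this] have "d \<le> Q ((1 - t) *\<^sub>R b + t *\<^sub>R c)" .
      also have "\<dots> = (\<Sum>f\<in>S. (r f)\<^sup>2 - 2 * t * (r f * (f c - f b)) + t\<^sup>2 * (f c - f b)\<^sup>2)"
        unfolding Q_def
        by (intro sum.cong refl) (simp add: r_def linear_add[OF lin] linear_cmul[OF lin],
            simp add: power2_eq_square algebra_simps)
      also have "\<dots> = Q b - 2 * t * (h c - h b) + t\<^sup>2 * (\<Sum>f\<in>S. (f c - f b)\<^sup>2)"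
        by (simp add: Q_def r_def h_def sum.distrib sum_subtractf sum_distrib_left right_diff_distrib)
      also have "t\<^sup>2 * (\<Sum>f\<in>S. (f c - f b)\<^sup>2) \<le> t\<^sup>2 * M"
        unfolding M_def
      proof (intro mult_left_mono sum_mono)
        fix f assume f: "f \<in> S"
        have "norm (c - b) \<le> C + C"
          using b c norm_triangle_ineq4[of c b] by (simp add: B_def)
        then have "\<bar>f c - f b\<bar> \<le> K f * (2 * C)"
          using K(2)[OF f, of "c - b"] mult_left_mono[OF _ K(1)[OF f], of "norm (c - b)" "2 * C"]
          by (simp add: linear_diff[OF lin[OF f]])
        then show "(f c - f b)\<^sup>2 \<le> (K f * (2 * C))\<^sup>2" by (metis abs_ge_zero power2_abs power_mono)
      qed simp
      also have "t\<^sup>2 * M \<le> t * (d / 2)"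
        using mult_left_mono[OF tM, of t] t by (simp add: power2_eq_square mult.assoc)
      finally have "2 * t * (h c - h b) \<le> t * d / 4 + t * (d / 2)" using b(2) by linarith
      then have "t * (2 * (h c - h b)) \<le> t * (3/4 * d)" by (simp add: algebra_simps)
      then show ?thesis using t by simp
    qed
    \<comment> \<open>The bound of \<open>h\<close> on the ball of radius \<open>C\<close> by its
      value at \<open>b\<close>, up to slack, is a bound for its norm; this is where the bound on
      \<open>G\<close> can be used.\<close>
    have "\<bar>h x\<bar> \<le> (h b + 3/8 * d) / C * norm x" for x
    proof (cases "x = 0")
      case False
      let ?c = "(C / norm x) *\<^sub>R x"
      have "?c \<in> B" "- ?c \<in> B" using C False by (auto simp: B_def)
      then have "\<bar>h ?c\<bar> \<le> h b + 3/8 * d"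
        using step[of ?c] step[of "- ?c"] by (simp add: linear_neg[OF hlin] abs_le_iff)
      then show ?thesis using C False by (simp add: linear_cmul[OF hlin] field_simps abs_mult)
    qed (simp add: linear_0[OF hlin])
    moreover have "0 \<le> (h b + 3/8 * d) / C"
      using step[OF \<open>0 \<in> B\<close>] C by (simp add: linear_0[OF hlin])
    ultimately have "G h \<le> h b + 3/8 * d"
      using bidual_boundedD(4)[OF G hU, of "(h b + 3/8 * d) / C"] C by simp
    moreover have "G h = (\<Sum>f\<in>S. r f * G f)"
      unfolding h_def by (rule bidual_bounded_sum[OF G S])
    ultimately have "(\<Sum>f\<in>S. r f * G f) - h b \<le> 3/8 * d" by simp
    \<comment> \<open>The coefficients are the residuals, so the difference is the sum of their
      squares. It is at least \<open>d\<close>, yet was just bounded by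
      \<open>3/8 * d\<close>.\<close>
    also have "(\<Sum>f\<in>S. r f * G f) - h b = Q b"
      by (simp add: h_def Q_def sum_subtractf[symmetric] r_def power2_eq_square algebra_simps)
    finally show False using dle[OF b(1)] d by simp
  qed
  then obtain b where b: "b \<in> B" "Q b < e\<^sup>2" using near[of "e\<^sup>2"] e by (auto intro: less_le_trans)
  have "\<bar>G f - f b\<bar> \<le> e" if "f \<in> S" for f
  proof -
    have "(G f - f b)\<^sup>2 \<le> Q b"
      unfolding Q_def using that S(1) by (intro member_le_sum) auto
    with b(2) have "\<bar>G f - f b\<bar>\<^sup>2 \<le> e\<^sup>2" by simp
    then show ?thesis using e by (simp add: power2_le_iff_abs_le)
  qed
  with b(1) show ?thesis by (intro that[of b]) (auto simp: B_def)
qed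

section \<open>Strict convexity and approximation uniform on order intervals\<close>

text \<open>The nontrivial half of the distributive law, which holds in any lattice-ordered group:
  \<open>x = inf a x + pprt (x - a)\<close> bounds \<open>b\<close> and \<open>c\<close>, hence
  their supremum, and subtracting \<open>pprt (sup b c - a)\<close> from that supremum leaves its
  infimum with \<open>a\<close>.\<close>

lemma inf_sup_le: "inf a (sup b c) \<le> sup (inf a b) (inf a c)" for a b c :: "'a::banach_lattice"
proof -
  let ?s = "sup b c" and ?u = "sup (inf a b) (inf a c)"
  have "x \<le> ?u + pprt (?s - a)" if x: "x \<le> ?s" "inf a x \<le> ?u" for x
  proof -
    have "x = inf a x + pprt (x - a)" using inf_eq_diff_pprt[of x a] by (simp add: inf.commute)
    also have "\<dots> \<le> ?u + pprt (?s - a)" using x by (intro add_mono pprt_mono diff_right_mono)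
    finally show ?thesis .
  qed
  from this[of b] this[of c] have "?s \<le> ?u + pprt (?s - a)" by (intro le_supI) auto
  then have "?s - pprt (?s - a) \<le> ?u" by (simp only: diff_le_eq)
  then show ?thesis using inf_eq_diff_pprt[of ?s a] by (simp only: inf.commute)
qed

text \<open>For numbers: \<open>m\<close> is within one mesh width of the grid unless it overshoots
  the outermost point. In the lattice no case distinction on the position of \<open>m\<close> is
  available, so the grid grows by the pair of outer points at each induction step and the lattice
  bounds are combined by distributivity.\<close>

lemma grid_lower_bound:
  fixes m e c :: "'a::banach_lattice"
  assumes e: "0 \<le> e" and c: "\<And>k::int. \<bar>k\<bar> \<le> int n \<Longrightarrow> c \<le> \<bar>m - real_of_int k *\<^sub>R e\<bar>"
  shows "c \<le> sup e (\<bar>m\<bar> - real n *\<^sub>R e)"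
  using c
proof (induction n)
  case 0
  from 0[of 0] show ?case by (auto intro: le_supI2)
next
  case (Suc n)
  define w where "w = \<bar>m\<bar> - real n *\<^sub>R e"
  have "c \<le> inf \<bar>m + real (Suc n) *\<^sub>R e\<bar> \<bar>m - real (Suc n) *\<^sub>R e\<bar>"
    using Suc.prems[of "int (Suc n)"] Suc.prems[of "- int (Suc n)"]
    by (simp only: of_int_minus of_int_of_nat_eq scaleR_minus_left diff_minus_eq_add le_inf_iff)
  also have "\<dots> = \<bar>\<bar>m\<bar> - \<bar>real (Suc n) *\<^sub>R e\<bar>\<bar>" by (rule inf_abs_eq_abs_diff_abs)
  also have "\<bar>real (Suc n) *\<^sub>R e\<bar> = real (Suc n) *\<^sub>R e" using e by (simp add: scaleR_nonneg_nonneg)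
  also have "\<bar>m\<bar> - real (Suc n) *\<^sub>R e = w - e" by (simp add: w_def algebra_simps)
  finally have 1: "c \<le> sup (w - e) (e - w)" by (simp add: abs_lattice)
  have 2: "c \<le> sup e w" unfolding w_def using Suc.prems by (intro Suc.IH) auto
  \<comment> \<open>The infimum is at most the mean of the two terms, which is half of
    \<open>e\<close>.\<close>
  have 3: "inf w (e - w) \<le> e"
  proof -
    let ?z = "inf w (e - w)"
    have "?z + ?z \<le> w + (e - w)" by (intro add_mono) auto
    then have "(1/2) *\<^sub>R (?z + ?z) \<le> (1/2) *\<^sub>R e" by (intro scaleR_left_mono) auto
    then have "?z \<le> (1/2) *\<^sub>R e" by (simp add: scaleR_2[symmetric])
    also have "\<dots> \<le> 1 *\<^sub>R e" using e by (intro scaleR_right_mono) auto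
    finally show ?thesis by simp
  qed
  have "c \<le> inf (sup e w) (sup (w - e) (e - w))" using 1 2 by simp
  also have "\<dots> \<le> sup (inf (sup e w) (w - e)) (inf (sup e w) (e - w))" by (rule inf_sup_le)
  also have "\<dots> \<le> sup (w - e) (sup (inf (e - w) e) (inf (e - w) w))"
    using inf_sup_le[of "e - w" e w] by (intro sup_mono) (auto simp: inf.commute)
  also have "\<dots> \<le> sup e (w - e)"
    using 3 by (auto simp: inf.commute intro: le_supI1 le_supI2 le_infI1 le_infI2)
  also have "w - e = \<bar>m\<bar> - real (Suc n) *\<^sub>R e" by (simp add: w_def algebra_simps)
  finally show ?case .
qed

text \<open>The \<open>k\<close>-th summand is the positive part of
  \<open>\<bar>b - b'\<bar> - 2 *\<^sub>R \<bar>m - q k\<bar>\<close>. All summands are nonnegative,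
  so their sum dominates each one, and \<open>\<bar>b - b'\<bar>\<close> minus the sum is at most
  twice the distance of \<open>m\<close> from every grid point. That distance is bounded by the mesh
  plus the overshoot of \<open>\<bar>m\<bar>\<close> beyond \<open>y\<close>.\<close>

lemma midpoint_gap:
  fixes b b' y :: "'a::banach_lattice"
  assumes y: "0 \<le> y" and N: "0 < N" and m: "2 *\<^sub>R m = b + b'"
  defines "q \<equiv> \<lambda>k::int. (real_of_int k / real N) *\<^sub>R y"
  shows "\<bar>b - b'\<bar> \<le> (\<Sum>k=-int N..int N. \<bar>b - q k\<bar> + \<bar>b' - q k\<bar> - 2 *\<^sub>R \<bar>m - q k\<bar>)
    + 2 *\<^sub>R ((1 / real N) *\<^sub>R y + pprt (\<bar>m\<bar> - y))"
proof -
  define gap where "gap k = \<bar>b - q k\<bar> + \<bar>b' - q k\<bar> - 2 *\<^sub>R \<bar>m - q k\<bar>" for k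
  define \<Gamma> where "\<Gamma> = sum gap {-int N..int N}"
  have two: "2 *\<^sub>R \<bar>m - q k\<bar> = \<bar>(b - q k) + (b' - q k)\<bar>" for k
  proof -
    have "2 *\<^sub>R \<bar>m - q k\<bar> = \<bar>2 *\<^sub>R (m - q k)\<bar>" by (simp only: abs_scaleR_lattice) simp
    also have "2 *\<^sub>R (m - q k) = (b - q k) + (b' - q k)"
      by (simp add: scaleR_diff_right m scaleR_2[of "q k"])
    finally show ?thesis .
  qed
  have eq: "gap k + 2 *\<^sub>R \<bar>m - q k\<bar> = sup (2 *\<^sub>R \<bar>m - q k\<bar>) \<bar>b - b'\<bar>" for k
    unfolding two gap_def using abs_add_abs_eq_sup[of "b - q k" "b' - q k"] by simp
  have gap0: "0 \<le> gap k" for k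
  proof -
    have "2 *\<^sub>R \<bar>m - q k\<bar> \<le> gap k + 2 *\<^sub>R \<bar>m - q k\<bar>" unfolding eq by simp
    then show ?thesis by simp
  qed
  have "(1/2) *\<^sub>R (\<bar>b - b'\<bar> - \<Gamma>) \<le> \<bar>m - real_of_int k *\<^sub>R (1 / real N) *\<^sub>R y\<bar>" if k: "\<bar>k\<bar> \<le> int N" for k
  proof -
    have "sum gap {k} \<le> \<Gamma>" (is "?s \<le> _") unfolding \<Gamma>_def using k gap0 by (intro sum_mono2) auto
    moreover have "\<bar>b - b'\<bar> \<le> gap k + 2 *\<^sub>R \<bar>m - q k\<bar>" unfolding eq by simp
    moreover have "?s = gap k" by simp
    ultimately have "\<bar>b - b'\<bar> \<le> \<Gamma> + 2 *\<^sub>R \<bar>m - q k\<bar>"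
      by (metis add_right_mono order_trans)
    then have "\<bar>b - b'\<bar> - \<Gamma> \<le> 2 *\<^sub>R \<bar>m - q k\<bar>" by (simp only: diff_le_eq add.commute)
    then have "(1/2) *\<^sub>R (\<bar>b - b'\<bar> - \<Gamma>) \<le> (1/2) *\<^sub>R 2 *\<^sub>R \<bar>m - q k\<bar>"
      by (intro scaleR_left_mono) simp_all
    then show ?thesis by (simp add: q_def)
  qed
  then have "(1/2) *\<^sub>R (\<bar>b - b'\<bar> - \<Gamma>) \<le> sup ((1 / real N) *\<^sub>R y) (\<bar>m\<bar> - real N *\<^sub>R (1 / real N) *\<^sub>R y)"
    using y by (intro grid_lower_bound) (simp_all add: scaleR_nonneg_nonneg)
  also have "real N *\<^sub>R (1 / real N) *\<^sub>R y = y" using N by simp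
  also have "sup ((1 / real N) *\<^sub>R y) (\<bar>m\<bar> - y) \<le> (1 / real N) *\<^sub>R y + pprt (\<bar>m\<bar> - y)"
    using y by (intro le_supI) (auto simp: pprt_def scaleR_nonneg_nonneg intro: add_increasing)
  finally have "2 *\<^sub>R (1/2) *\<^sub>R (\<bar>b - b'\<bar> - \<Gamma>) \<le> 2 *\<^sub>R ((1 / real N) *\<^sub>R y + pprt (\<bar>m\<bar> - y))"
    by (rule scaleR_left_mono) simp
  moreover have "2 *\<^sub>R (1/2) *\<^sub>R (\<bar>b - b'\<bar> - \<Gamma>) = \<bar>b - b'\<bar> - \<Gamma>" by simp
  ultimately show ?thesis unfolding \<Gamma>_def gap_def by (simp only: diff_le_eq add.commute)
qed

text \<open>The weak approximants of \<open>G\<close> form a decreasing family of convex sets. By \<open>midpoint_gap\<close> the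
  convex functional \<open>h\<close> is strictly convex up to a small error, so its near-minimizers on these sets
  are close to each other in the seminorm \<open>\<lambda>x. f \<bar>x\<bar>\<close>.\<close>

lemma bidual_strong_approximation:
  fixes G :: "('a::banach_lattice \<Rightarrow> real) \<Rightarrow> real"
  assumes G: "bidual_bounded G C" and f: "f \<in> pos_uo" and e: "0 < e"
  obtains b where "norm b \<le> C"
    "\<And>g. g \<in> uo_functionals \<Longrightarrow> (\<And>x. \<bar>g x\<bar> \<le> f \<bar>x\<bar>) \<Longrightarrow> \<bar>G g - g b\<bar> \<le> e"
proof -
  note lin = pos_uo_D(2)[OF f]
  \<comment> \<open>The final estimate costs \<open>8 * \<eta> = e / 2\<close>: four from the mesh
    and tail errors in \<open>gap\<close>, one for each of the near-minimizers \<open>b\<close> and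
    \<open>b'\<close>, and two because \<open>v p\<close> is within \<eta> of \<open>D\<close>. The
    other \<open>e / 2\<close> is the weak approximation of \<open>G g\<close> at
    \<open>b'\<close>.\<close>
  define \<eta> where "\<eta> = e / 16"
  have \<eta>: "0 < \<eta>" using e by (simp add: \<eta>_def)
  obtain y where y: "0 \<le> y" "\<And>b. norm b \<le> C \<Longrightarrow> f (pprt (\<bar>b\<bar> - y)) \<le> \<eta>"
    using pos_uo_uniformly_small_tails[OF f \<eta>] by blast
  have fy: "0 \<le> f y" by (rule pos_uo_D(3)[OF f y(1)])
  obtain N :: nat where N: "0 < N" "f y / real N \<le> \<eta>"
  proof -
    obtain N :: nat where "f y / \<eta> < real N" using reals_Archimedean2 by blast
    moreover from this have "0 < real N" using fy \<eta> by (meson divide_nonneg_pos le_less_trans)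
    ultimately have "0 < N" "f y / real N \<le> \<eta>" using \<eta> by (auto simp: field_simps)
    then show ?thesis by (rule that)
  qed
  define q where "q k = (real_of_int k / real N) *\<^sub>R y" for k :: int
  define h where "h b = (\<Sum>k=-int N..int N. f \<bar>b - q k\<bar>)" for b
  obtain K where K: "0 \<le> K" "\<And>x. \<bar>f x\<bar> \<le> K * norm x"
    using uo_functionals_bounded[OF pos_uo_D(1)[OF f]] by blast
  have h0: "0 \<le> h b" for b unfolding h_def by (intro sum_nonneg pos_uo_D(3)[OF f]) auto
  obtain H where H: "\<And>b. norm b \<le> C \<Longrightarrow> h b \<le> H"
  proof
    fix b :: 'a assume b: "norm b \<le> C"
    show "h b \<le> (\<Sum>k=-int N..int N. K * (C + norm (q k)))"
      unfolding h_def
    proof (rule sum_mono)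
      fix k
      have "f \<bar>b - q k\<bar> \<le> K * norm \<bar>b - q k\<bar>" using K(2)[of "\<bar>b - q k\<bar>"] by linarith
      also have "\<dots> \<le> K * (C + norm (q k))"
        using norm_triangle_ineq4[of b "q k"] b K(1) by (intro mult_left_mono) auto
      finally show "f \<bar>b - q k\<bar> \<le> K * (C + norm (q k))" .
    qed
  qed
  have gap: "f \<bar>b - b'\<bar> \<le> h b + h b' - 2 * h m + 4 * \<eta>" if m: "2 *\<^sub>R m = b + b'" "norm m \<le> C" for b b' m
  proof -
    have "f \<bar>b - b'\<bar> \<le> f ((\<Sum>k=-int N..int N. \<bar>b - q k\<bar> + \<bar>b' - q k\<bar> - 2 *\<^sub>R \<bar>m - q k\<bar>)
        + 2 *\<^sub>R ((1 / real N) *\<^sub>R y + pprt (\<bar>m\<bar> - y)))"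
      unfolding q_def by (intro pos_uo_mono[OF f] midpoint_gap y(1) N(1) m(1))
    also have "\<dots> = h b + h b' - 2 * h m + 2 * (f y / real N + f (pprt (\<bar>m\<bar> - y)))"
      by (simp add: linear_add[OF lin] linear_diff[OF lin] linear_cmul[OF lin] linear_sum[OF lin]
          h_def sum.distrib sum_subtractf sum_distrib_left)
    also have "\<dots> \<le> h b + h b' - 2 * h m + 2 * (\<eta> + \<eta>)"
      by (intro add_left_mono mult_left_mono add_mono N(2) y(2)[OF m(2)]) simp
    also have "2 * (\<eta> + \<eta>) = 4 * \<eta>" by simp
    finally show ?thesis .
  qed
  define A where "A p = {b. norm b \<le> C \<and> (\<forall>g\<in>fst p. \<bar>G g - g b\<bar> \<le> snd p)}"
    for p :: "('a \<Rightarrow> real) set \<times> real"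
  \<comment> \<open>Refining a pair, by more test functionals or a smaller tolerance, shrinks
    \<open>A\<close> and raises the minimal value \<open>v\<close>. These values stay below
    \<open>H\<close>, so a pair nearly attaining their supremum leaves almost no room for a further
    rise.\<close>
  define P where "P = {p::('a \<Rightarrow> real) set \<times> real. finite (fst p) \<and> fst p \<subseteq> uo_functionals \<and> 0 < snd p}"
  define v where "v p = Inf (h ` A p)" for p
  have Ane: "A p \<noteq> {}" if "p \<in> P" for p
  proof -
    have p: "finite (fst p)" "fst p \<subseteq> uo_functionals" "0 < snd p" using that by (auto simp: P_def)
    obtain b where "norm b \<le> C" "\<And>g. g \<in> fst p \<Longrightarrow> \<bar>G g - g b\<bar> \<le> snd p"
      using bidual_weak_approximation[OF G p] by metis
    then have "b \<in> A p" by (simp add: A_def)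
    then show ?thesis by blast
  qed
  have vle: "v p \<le> h b" if "b \<in> A p" for p b
    unfolding v_def using that h0 by (intro cInf_lower bdd_belowI2[of _ 0]) auto
  have near: "\<exists>b\<in>A p. h b < v p + \<eta>" if "p \<in> P" for p
    using cInf_lessD[of "h ` A p" "v p + \<eta>"] Ane[OF that] \<eta> unfolding v_def by auto
  have vH: "v p \<le> H" if p: "p \<in> P" for p
  proof -
    obtain b where b: "b \<in> A p" using Ane[OF p] by blast
    then have "norm b \<le> C" by (simp add: A_def)
    with H vle[OF b] show ?thesis by (meson order_trans)
  qed
  define D where "D = Sup (v ` P)"
  have Pne: "({}, 1) \<in> P" by (simp add: P_def)
  have bddv: "bdd_above (v ` P)" using vH by (intro bdd_aboveI2)
  have vD: "v p \<le> D" if "p \<in> P" for p unfolding D_def using that bddv by (intro cSup_upper) auto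
  obtain p where p: "p \<in> P" "D - \<eta> < v p"
  proof -
    have "v ` P \<noteq> {}" using Pne by blast
    moreover have "D - \<eta> < Sup (v ` P)" using \<eta> by (simp add: D_def)
    ultimately have "\<exists>x\<in>v ` P. D - \<eta> < x" by (rule less_cSupD)
    then show thesis using that by blast
  qed
  obtain b where b: "b \<in> A p" "h b < v p + \<eta>" using near[OF p(1)] by blast
  have bC: "norm b \<le> C" using b(1) by (simp add: A_def)
  have "\<bar>G g - g b\<bar> \<le> e" if g: "g \<in> uo_functionals" "\<And>x. \<bar>g x\<bar> \<le> f \<bar>x\<bar>" for g
  proof -
    \<comment> \<open>Only the auxiliary \<open>b'\<close> depends on \<open>g\<close>, while
      \<open>b\<close> was fixed before; this gives uniformity over \<open>[-f, f]\<close>. The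
      tolerance \<open>snd p\<close> is kept so that the midpoint of \<open>b\<close> and
      \<open>b'\<close> lies in \<open>A p\<close>.\<close>
    define p' where "p' = (insert g (fst p), min (snd p) (e / 2))"
    have p': "p' \<in> P" using p(1) g(1) e by (auto simp: P_def p'_def)
    obtain b' where b': "b' \<in> A p'" "h b' < v p' + \<eta>" using near[OF p'] by blast
    have sub: "b' \<in> A p" using b'(1) by (auto simp: A_def p'_def)
    define m where "m = (1/2) *\<^sub>R (b + b')"
    have m2: "2 *\<^sub>R m = b + b'" by (simp add: m_def)
    have "norm (b + b') \<le> C + C"
      using bC sub norm_triangle_ineq[of b b'] by (simp add: A_def)
    then have mC: "norm m \<le> C" by (simp add: m_def)
    have "\<bar>G u - u m\<bar> \<le> snd p" if u: "u \<in> fst p" for u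
    proof -
      have "linear u" using u p(1) uo_functionals_linear by (auto simp: P_def)
      then have "u m = (u b + u b') / 2" by (simp add: m_def linear_cmul linear_add)
      moreover have "\<bar>G u - u b\<bar> \<le> snd p" "\<bar>G u - u b'\<bar> \<le> snd p" using u b(1) sub by (auto simp: A_def)
      ultimately show ?thesis by (simp add: abs_le_iff)
    qed
    then have "m \<in> A p" using mC by (simp add: A_def)
    then have "v p \<le> h m" by (rule vle)
    then have "f \<bar>b - b'\<bar> \<le> 8 * \<eta>"
      using gap[OF m2 mC] b(2) b'(2) p(2) vD[OF p(1)] vD[OF p'] by linarith
    moreover have "\<bar>G g - g b'\<bar> \<le> e / 2" using b'(1) by (auto simp: A_def p'_def)
    moreover have "\<bar>g b - g b'\<bar> \<le> f \<bar>b - b'\<bar>"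
      using g(2)[of "b - b'"] by (simp add: linear_diff[OF uo_functionals_linear[OF g(1)]])
    ultimately show ?thesis unfolding \<eta>_def by linarith
  qed
  with bC show ?thesis by (rule that)
qed

section \<open>Representation under monotone completeness\<close>

lemma monotonically_complete_lub:
  fixes A :: "'a::banach_lattice set"
  assumes mc: "monotonically_complete TYPE('a)" and ne: "A \<noteq> {}"
    and dir: "\<And>a b. a \<in> A \<Longrightarrow> b \<in> A \<Longrightarrow> \<exists>c\<in>A. a \<le> c \<and> b \<le> c"
    and A: "\<And>a. a \<in> A \<Longrightarrow> 0 \<le> a" "\<And>a. a \<in> A \<Longrightarrow> norm a \<le> M"
  obtains u where "isLub UNIV A u"
proof -
  define r where "r = {(a, b). a \<in> A \<and> b \<in> A \<and> a \<le> b}"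
  have r: "directed_preorder r" "Field r = A"
    by (rule directed_preorderI[where A = A]; use ne dir in \<open>auto simp: r_def\<close>)+
  have "\<exists>u. isLub UNIV (id ` Field r) u"
  proof (rule monotonically_completeD[OF mc r(1)])
    show "bounded (id ` Field r)" using A(2) by (auto simp: bounded_iff r(2))
    show "increasing_net r id" by (auto simp: increasing_net_def r_def)
  qed (use A in \<open>auto simp: r(2)\<close>)
  then show ?thesis using that by (auto simp: r(2))
qed

text \<open>Reflection in an element of \<open>A\<close> turns the part of \<open>A\<close> below it
  into an increasing family between \<open>0\<close> and \<open>a0\<close>, whose norm bound comes
  for free.\<close>

lemma monotonically_complete_glb:
  fixes A :: "'a::banach_lattice set"
  assumes mc: "monotonically_complete TYPE('a)" and ne: "A \<noteq> {}"
    and dir: "\<And>a b. a \<in> A \<Longrightarrow> b \<in> A \<Longrightarrow> \<exists>c\<in>A. c \<le> a \<and> c \<le> b"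
    and A: "\<And>a. a \<in> A \<Longrightarrow> 0 \<le> a"
  obtains u where "isGlb UNIV A u"
proof -
  obtain a0 where a0: "a0 \<in> A" using ne by blast
  define B where "B = {a0 - a | a. a \<in> A \<and> a \<le> a0}"
  obtain u where u: "isLub UNIV B u"
  proof (rule monotonically_complete_lub[OF mc, of B "norm a0"])
    show "B \<noteq> {}" using a0 by (auto simp: B_def)
    show "\<exists>c\<in>B. x \<le> c \<and> y \<le> c" if xy: "x \<in> B" "y \<in> B" for x y
    proof -
      obtain a b where ab: "x = a0 - a" "y = a0 - b" "a \<in> A" "b \<in> A" "a \<le> a0" "b \<le> a0"
        using xy by (auto simp: B_def)
      then obtain c where "c \<in> A" "c \<le> a" "c \<le> b" using dir by blast
      then show ?thesis using ab by (intro bexI[of _ "a0 - c"]) (auto simp: B_def intro: order_trans)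
    qed
    show pos: "0 \<le> x" if "x \<in> B" for x using that by (auto simp: B_def)
    show "norm x \<le> norm a0" if "x \<in> B" for x
      using pos[OF that] by (rule norm_mono_nonneg) (use that A in \<open>auto simp: B_def\<close>)
  qed
  have "isGlb UNIV A (a0 - u)"
    unfolding isGlb_UNIV_iff
  proof (intro conjI ballI allI impI)
    fix a assume "a \<in> A"
    then obtain c where c: "c \<in> A" "c \<le> a" "c \<le> a0" using dir a0 by blast
    then have "a0 - c \<le> u" using u by (auto simp: isLub_UNIV_iff B_def)
    then have "a0 - u \<le> c" by (simp add: algebra_simps)
    with c(2) show "a0 - u \<le> a" by order
  next
    fix v assume "\<forall>a\<in>A. v \<le> a"
    then have "\<forall>x\<in>B. x \<le> a0 - v" by (auto simp: B_def)
    then have "u \<le> a0 - v" using u by (auto simp: isLub_UNIV_iff)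
    then show "v \<le> a0 - u" by (simp add: algebra_simps)
  qed
  then show ?thesis by (rule that)
qed

text \<open>A failure could be condensed into a single increasing sequence: suitably weighted, the
  bad sequences add up to a bounded one, whose supremum would have to dominate suprema that are too
  large.\<close>

lemma monotonically_complete_weak_Fatou:
  assumes mc: "monotonically_complete TYPE('a::banach_lattice)"
  obtains R where "\<And>(x :: nat \<Rightarrow> 'a) u. mono x \<Longrightarrow> (\<And>n. 0 \<le> x n) \<Longrightarrow> (\<And>n. norm (x n) \<le> C) \<Longrightarrow>
    isLub UNIV (range x) u \<Longrightarrow> norm u \<le> R"
proof (rule ccontr)
  assume contra: "\<not> thesis"
  define P where "P x u \<longleftrightarrow> mono x \<and> (\<forall>n. 0 \<le> x n) \<and> (\<forall>n. norm (x n) \<le> C) \<and> isLub UNIV (range x) u"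
    for x :: "nat \<Rightarrow> 'a" and u
  have "\<exists>x u. P x u \<and> R < norm u" for R
  proof (rule ccontr)
    assume none: "\<nexists>x u. P x u \<and> R < norm u"
    have thesis
      by (rule that[of R]) (use none in \<open>auto simp: P_def not_less\<close>)
    with contra show False ..
  qed
  then have "\<forall>k::nat. \<exists>p. P (fst p) (snd p) \<and> 4 ^ k < norm (snd p)" by auto
  from choice[OF this] obtain p where p: "\<And>k::nat. P (fst (p k)) (snd (p k))" "\<And>k. 4 ^ k < norm (snd (p k))"
    by blast
  define x where "x k = fst (p k)" for k
  define u where "u k = snd (p k)" for k
  have x: "mono (x k)" "0 \<le> x k n" "norm (x k n) \<le> C" "isLub UNIV (range (x k)) (u k)" for k n
    using p(1)[of k] by (auto simp: P_def x_def u_def)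
  have un: "4 ^ k < norm (u k)" for k using p(2) by (simp add: u_def)
  \<comment> \<open>The weights sum to \<open>2\<close>, which keeps \<open>z\<close> bounded by
    \<open>2 * C\<close>, while the suprema exceed \<open>4 ^ k\<close>; after weighting they still
    exceed \<open>2 ^ k\<close>, more than any fixed norm allows.\<close>
  define X where "X k n = (1/2::real) ^ k *\<^sub>R x k n" for k n
  have X0: "0 \<le> X k n" for k n using x(2) by (simp add: X_def scaleR_nonneg_nonneg)
  have Xmono: "X k m \<le> X k n" if "m \<le> n" for k m n
    unfolding X_def using monoD[OF x(1) that, of k] by (intro scaleR_left_mono) auto
  define z where "z n = (\<Sum>k<n. X k n)" for n
  have z0: "0 \<le> z n" for n unfolding z_def using X0 by (intro sum_nonneg) auto
  have zmono: "z m \<le> z n" if "m \<le> n" for m n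
  proof -
    have "z m \<le> (\<Sum>k<m. X k n)" unfolding z_def using Xmono[OF that] by (intro sum_mono) auto
    also have "\<dots> \<le> z n" unfolding z_def using that X0 by (intro sum_mono2) auto
    finally show ?thesis .
  qed
  have C0: "0 \<le> C" using x(3)[of 0 0] norm_ge_zero order_trans by blast
  have "norm (z n) \<le> 2 * C" for n
  proof -
    have "norm (z n) \<le> (\<Sum>k<n. C * (1/2) ^ k)"
      unfolding z_def X_def using x(3)
      by (intro sum_norm_le) (simp add: mult.commute mult_right_mono)
    also have "\<dots> = C * (2 * (1 - (1/2) ^ n))"
      by (simp add: sum_distrib_left[symmetric] sum_gp_strict)
    also have "\<dots> \<le> C * 2" using C0 by (intro mult_left_mono) auto
    finally show ?thesis by simp
  qed
  then obtain s where s: "isLub UNIV (range z) s"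
  proof (rule_tac monotonically_complete_lub[OF mc, of "range z" "2 * C"])
    show "\<exists>c\<in>range z. a \<le> c \<and> b \<le> c" if "a \<in> range z" "b \<in> range z" for a b
    proof -
      obtain m n where "a = z m" "b = z n" using \<open>a \<in> range z\<close> \<open>b \<in> range z\<close> by blast
      then show ?thesis using zmono[of m "max m n"] zmono[of n "max m n"]
        by (intro bexI[of _ "z (max m n)"]) auto
    qed
  qed (use z0 in auto)
  have "4 ^ k < 2 ^ k * norm s" for k
  proof -
    have "x k n \<le> 2 ^ k *\<^sub>R s" for n
    proof -
      let ?n = "max n (Suc k)"
      have "X k n \<le> X k ?n" by (rule Xmono) simp
      also have "X k ?n = sum (\<lambda>j. X j ?n) {k}" by simp
      also have "\<dots> \<le> z ?n" unfolding z_def using X0 by (intro sum_mono2) auto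
      also have "\<dots> \<le> s" using s by (auto simp: isLub_UNIV_iff)
      finally have "2 ^ k *\<^sub>R X k n \<le> 2 ^ k *\<^sub>R s" by (rule scaleR_left_mono) simp
      then show ?thesis by (simp add: X_def power_mult_distrib[symmetric])
    qed
    then have "u k \<le> 2 ^ k *\<^sub>R s" using x(4)[of k] by (auto simp: isLub_UNIV_iff)
    moreover have "0 \<le> u k" using x(4)[of k] x(2)[of k 0] by (auto simp: isLub_UNIV_iff intro: order_trans)
    ultimately have "norm (u k) \<le> norm (2 ^ k *\<^sub>R s)" by (intro norm_mono_nonneg)
    with un[of k] show ?thesis by simp
  qed
  then have "2 ^ k < norm s" for k :: nat
  proof -
    have "(4::real) ^ k = 2 ^ k * 2 ^ k" by (simp add: power_mult_distrib[symmetric])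
    with \<open>4 ^ k < 2 ^ k * norm s\<close> show ?thesis by simp
  qed
  moreover obtain k :: nat where "norm s < 2 ^ k" using real_arch_pow[of 2 "norm s"] by auto
  ultimately show False using less_asym by blast
qed

section \<open>Solutions on a single order interval\<close>

text \<open>The limit is the limit inferior: \<open>i n\<close> is the infimum of the tail from
  \<open>n\<close> on, and \<open>p\<close> is the supremum of all \<open>i n\<close>. The distance
  from \<open>b n\<close> to \<open>i n\<close> is controlled by the sum of the later increments,
  and order continuity of \<open>f\<close> handles both passages to the limit. Being an increasing
  supremum, \<open>p\<close> inherits the bound \<open>R\<close>.\<close>

lemma pos_uo_Cauchy_limit:
  fixes b :: "nat \<Rightarrow> 'a::banach_lattice"
  assumes mc: "monotonically_complete TYPE('a)" and f: "f \<in> pos_uo"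
    and b: "\<And>n. 0 \<le> b n" "\<And>n. norm (b n) \<le> C"
    and cauchy: "\<And>n. f \<bar>b (Suc n) - b n\<bar> \<le> (1/2) ^ n"
    and R: "\<And>(x :: nat \<Rightarrow> 'a) u. mono x \<Longrightarrow> (\<And>n. 0 \<le> x n) \<Longrightarrow> (\<And>n. norm (x n) \<le> C) \<Longrightarrow>
      isLub UNIV (range x) u \<Longrightarrow> norm u \<le> R"
  obtains p where "norm p \<le> R" "(\<lambda>n. f \<bar>p - b n\<bar>) \<longlonglongrightarrow> 0"
proof -
  note lin = pos_uo_D(2)[OF f]
  define c where "c n = rec_nat (b n) (\<lambda>m z. inf z (b (n + Suc m)))" for n
  have c_simps: "c n 0 = b n" "c n (Suc m) = inf (c n m) (b (n + Suc m))" for n m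
    by (simp_all add: c_def)
  have c_mono: "c n m' \<le> c n m" if "m \<le> m'" for n m m'
    using that by (induction rule: dec_induct) (auto simp: c_simps intro: le_infI1)
  have c_le: "c n m \<le> b (n + m)" for n m by (cases m) (auto simp: c_simps)
  have c_great: "v \<le> c n m" if "\<And>k. n \<le> k \<Longrightarrow> v \<le> b k" for v n m
    using that by (induction m) (auto simp: c_simps)
  have "\<exists>u. isGlb UNIV (range (c n)) u" for n
  proof (rule monotonically_complete_glb[OF mc, of "range (c n)"])
    show "\<exists>d\<in>range (c n). d \<le> x \<and> d \<le> y" if xy: "x \<in> range (c n)" "y \<in> range (c n)" for x y
    proof -
      obtain i j where "x = c n i" "y = c n j" using xy by blast
      then show ?thesis using c_mono[of i "max i j" n] c_mono[of j "max i j" n]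
        by (intro bexI[of _ "c n (max i j)"]) auto
    qed
    show "0 \<le> x" if "x \<in> range (c n)" for x using that c_great[of n 0] b(1) by auto
  qed auto
  then obtain i where i: "\<And>n. isGlb UNIV (range (c n)) (i n)" by metis
  have i_le: "i n \<le> b k" if "n \<le> k" for n k
  proof -
    have "i n \<le> c n (k - n)" using i[of n] by (auto simp: isGlb_UNIV_iff)
    also have "\<dots> \<le> b k" using c_le[of n "k - n"] that by simp
    finally show ?thesis .
  qed
  have i_great: "v \<le> i n" if "\<And>k. n \<le> k \<Longrightarrow> v \<le> b k" for v n
    using i[of n] c_great[OF that] by (auto simp: isGlb_UNIV_iff)
  have i0: "0 \<le> i n" for n by (rule i_great[OF b(1)])
  have i_mono: "mono i"
  proof (rule monoI)
    fix m n :: nat assume "m \<le> n"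
    then show "i m \<le> i n" by (intro i_great i_le) simp
  qed
  have iC: "norm (i n) \<le> C" for n
    using norm_mono_nonneg[OF i0 i_le[of n n]] b(2)[of n] by (auto intro: order_trans)
  have f_c: "f (b n - c n m) \<le> 2 * (1/2) ^ n" for n m
  proof -
    \<comment> \<open>The sum of the absolute increments bounds \<open>b n\<close> minus each of the
      next \<open>m\<close> terms, hence also minus their infimum; the increments form a geometric
      series, which gives the factor \<open>2\<close>.\<close>
    define s where "s m = (\<Sum>j<m. \<bar>b (Suc (n + j)) - b (n + j)\<bar>)" for m
    have s_Suc: "s (Suc m) = s m + \<bar>b (Suc (n + m)) - b (n + m)\<bar>" for m by (simp add: s_def)
    have s_mono: "s m \<le> s (Suc m)" for m by (simp add: s_Suc)
    have bs: "b n - b (n + m) \<le> s m" for m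
    proof (induction m)
      case (Suc m)
      have "b (n + m) - b (Suc (n + m)) \<le> \<bar>b (Suc (n + m)) - b (n + m)\<bar>"
        using abs_ge_minus_self[of "b (Suc (n + m)) - b (n + m)"] by simp
      from add_mono[OF Suc this] show ?case by (simp add: s_Suc)
    qed (simp add: s_def)
    have "b n - c n m \<le> s m"
    proof (induction m)
      case (Suc m)
      have "b n - c n (Suc m) = sup (b n - c n m) (b n - b (n + Suc m))"
        unfolding c_simps(2) by (simp add: diff_inf_eq_sup add_sup_distrib_left)
      also have "\<dots> \<le> s (Suc m)" using Suc s_mono[of m] bs[of "Suc m"] by (intro le_supI) auto
      finally show ?case .
    qed (simp add: s_def c_simps)
    then have "f (b n - c n m) \<le> f (s m)" by (rule pos_uo_mono[OF f])
    also have "f (s m) = (\<Sum>j<m. f \<bar>b (Suc (n + j)) - b (n + j)\<bar>)"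
      unfolding s_def by (rule linear_sum[OF lin])
    also have "\<dots> \<le> (\<Sum>j<m. (1/2) ^ (n + j))" by (intro sum_mono cauchy)
    also have "\<dots> = (1/2) ^ n * (2 * (1 - (1/2) ^ m))"
      by (simp add: power_add sum_distrib_left[symmetric] sum_gp_strict)
    also have "\<dots> \<le> (1/2) ^ n * 2" by (intro mult_left_mono) auto
    finally show ?thesis by simp
  qed
  have f_i: "f (b n - i n) \<le> 2 * (1/2) ^ n" for n
  proof (rule field_le_epsilon)
    fix e :: real assume e: "0 < e"
    have "\<exists>d\<in>range (c n). f (d - i n) < e"
    proof (rule pos_uo_order_continuous_inf[OF f _ _ i e])
      show "\<exists>d\<in>range (c n). d \<le> x \<and> d \<le> y" if xy: "x \<in> range (c n)" "y \<in> range (c n)" for x y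
      proof -
        obtain i j where "x = c n i" "y = c n j" using xy by blast
        then show ?thesis using c_mono[of i "max i j" n] c_mono[of j "max i j" n]
          by (intro bexI[of _ "c n (max i j)"]) auto
      qed
    qed auto
    then obtain m where "f (c n m - i n) < e" by blast
    moreover have "f (b n - i n) = f (b n - c n m) + f (c n m - i n)"
      by (simp add: linear_diff[OF lin])
    ultimately show "f (b n - i n) \<le> 2 * (1/2) ^ n + e" using f_c[of n m] by linarith
  qed
  have dir: "\<exists>d\<in>range i. x \<le> d \<and> y \<le> d" if xy: "x \<in> range i" "y \<in> range i" for x y
  proof -
    obtain m n where "x = i m" "y = i n" using xy by blast
    then show ?thesis using monoD[OF i_mono, of m "max m n"] monoD[OF i_mono, of n "max m n"]
      by (intro bexI[of _ "i (max m n)"]) auto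
  qed
  obtain p where p: "isLub UNIV (range i) p"
    by (rule monotonically_complete_lub[OF mc, of "range i" C]) (use dir i0 iC in auto)
  have ip: "i n \<le> p" for n using p by (auto simp: isLub_UNIV_iff)
  have "(\<lambda>n. f (p - i n)) \<longlonglongrightarrow> 0"
  proof (rule LIMSEQ_I)
    fix e :: real assume e: "0 < e"
    have "\<exists>d\<in>range i. f (p - d) < e"
      by (rule pos_uo_order_continuous_sup[OF f _ _ p e]) (use dir in auto)
    then obtain N where N: "f (p - i N) < e" by blast
    have "norm (f (p - i n) - 0) < e" if "N \<le> n" for n
      using N pos_uo_mono[OF f, of "p - i n" "p - i N"] monoD[OF i_mono that]
        pos_uo_D(3)[OF f, of "p - i n"] ip by simp
    then show "\<exists>N. \<forall>n\<ge>N. norm (f (p - i n) - 0) < e" by blast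
  qed
  moreover have "(\<lambda>n. 2 * (1/2::real) ^ n) \<longlonglongrightarrow> 0"
    by (intro tendsto_mult_right_zero LIMSEQ_power_zero) simp
  ultimately have lim: "(\<lambda>n. f (p - i n) + 2 * (1/2) ^ n) \<longlonglongrightarrow> 0 + 0" by (rule tendsto_add)
  have bound: "norm (f \<bar>p - b n\<bar>) \<le> f (p - i n) + 2 * (1/2) ^ n" for n
  proof -
    have "\<bar>p - b n\<bar> \<le> \<bar>p - i n\<bar> + \<bar>i n - b n\<bar>"
      using abs_triangle_ineq[of "p - i n" "i n - b n"] by simp
    also have "\<dots> = (p - i n) + (b n - i n)"
      using ip[of n] i_le[of n n] by (simp add: abs_minus_commute[of "i n"])
    finally have "f \<bar>p - b n\<bar> \<le> f ((p - i n) + (b n - i n))" by (rule pos_uo_mono[OF f])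
    then show ?thesis
      using f_i[of n] pos_uo_D(3)[OF f, of "\<bar>p - b n\<bar>"] linear_add[OF lin, of "p - i n" "b n - i n"] by simp
  qed
  have "(\<lambda>n. f \<bar>p - b n\<bar>) \<longlonglongrightarrow> 0"
    by (rule Lim_null_comparison[OF always_eventually[OF allI[OF bound]]]) (use lim in simp)
  moreover have "norm p \<le> R" by (rule R[OF i_mono i0 iC p])
  ultimately show ?thesis by (intro that)
qed

text \<open>The points that represent \<open>G\<close> on the order interval \<open>[-f, f]\<close>.
  Such a point is unique only up to elements \<open>z\<close> with
  \<open>f \<bar>z\<bar> = 0\<close>.\<close>

definition local_reps :: "(('a::banach_lattice \<Rightarrow> real) \<Rightarrow> real) \<Rightarrow> ('a \<Rightarrow> real) \<Rightarrow> 'a set" where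
  "local_reps G f = {u. \<forall>g\<in>uo_functionals. (\<forall>x. \<bar>g x\<bar> \<le> f \<bar>x\<bar>) \<longrightarrow> g u = G g}"

text \<open>Strong approximants are Cauchy in the seminorm, since the functional attaining
  \<open>f \<bar>x\<bar>\<close> lies in \<open>[-f, f]\<close>. Positive and negative parts
  converge separately, because the limit inferior is taken in the positive cone; each limit has norm
  at most \<open>R\<close>, which does not involve \<open>f\<close>.\<close>

lemma local_reps_bounded:
  fixes G :: "('a::banach_lattice \<Rightarrow> real) \<Rightarrow> real"
  assumes mc: "monotonically_complete TYPE('a)" and G: "bidual_bounded G C"
  obtains M where "\<And>f. f \<in> pos_uo \<Longrightarrow> \<exists>u\<in>local_reps G f. norm u \<le> M"
proof -
  obtain R where R: "\<And>(x :: nat \<Rightarrow> 'a) u. mono x \<Longrightarrow> (\<And>n. 0 \<le> x n) \<Longrightarrow> (\<And>n. norm (x n) \<le> C) \<Longrightarrow>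
    isLub UNIV (range x) u \<Longrightarrow> norm u \<le> R"
    using monotonically_complete_weak_Fatou[OF mc] by metis
  show ?thesis
  proof (rule that[of "R + R"])
    fix f :: "'a \<Rightarrow> real" assume f: "f \<in> pos_uo"
    note lin = pos_uo_D(2)[OF f]
    \<comment> \<open>With these errors two consecutive approximants differ by at most
      \<open>(1/2) ^ (n + 2) + (1/2) ^ (n + 1)\<close>, within the rate that the Cauchy lemma
      expects.\<close>
    have "\<exists>b. norm b \<le> C \<and> (\<forall>g\<in>uo_functionals. (\<forall>x. \<bar>g x\<bar> \<le> f \<bar>x\<bar>) \<longrightarrow> \<bar>G g - g b\<bar> \<le> (1/2) ^ Suc n)" for n
      by (rule bidual_strong_approximation[OF G f, of "(1/2) ^ Suc n"]) auto
    then obtain b where bC: "\<And>n. norm (b n) \<le> C" and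
      b: "\<And>n g. g \<in> uo_functionals \<Longrightarrow> (\<And>x. \<bar>g x\<bar> \<le> f \<bar>x\<bar>) \<Longrightarrow> \<bar>G g - g (b n)\<bar> \<le> (1/2) ^ Suc n"
      by metis
    have fb: "f \<bar>b (Suc n) - b n\<bar> \<le> (1/2) ^ n" for n
    proof -
      obtain g where g: "g \<in> uo_functionals" "\<And>z. \<bar>g z\<bar> \<le> f \<bar>z\<bar>" "g (b (Suc n) - b n) = f \<bar>b (Suc n) - b n\<bar>"
        using pos_uo_abs_attained[OF f] by blast
      have "f \<bar>b (Suc n) - b n\<bar> = g (b (Suc n)) - g (b n)"
        by (simp add: g(3)[symmetric] linear_diff[OF uo_functionals_linear[OF g(1)]])
      also have "\<dots> \<le> (1/2) ^ Suc (Suc n) + (1/2) ^ Suc n"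
        using b[OF g(1,2), of n] b[OF g(1,2), of "Suc n"] by linarith
      also have "\<dots> \<le> (1/2) ^ n" by simp
      finally show ?thesis .
    qed
    have fp: "f \<bar>pprt (b (Suc n)) - pprt (b n)\<bar> \<le> (1/2) ^ n" for n
      using pos_uo_mono[OF f abs_pprt_diff_le[of "b (Suc n)" "b n"]] fb[of n] by linarith
    have fm: "f \<bar>pprt (- b (Suc n)) - pprt (- b n)\<bar> \<le> (1/2) ^ n" for n
      using pos_uo_mono[OF f abs_pprt_diff_le[of "- b (Suc n)" "- b n"]] fb[of n]
      by (simp add: abs_minus_commute)
    have nb: "norm (pprt (b n)) \<le> C" "norm (pprt (- b n)) \<le> C" for n
      using norm_pprt_le[of "b n"] norm_pprt_le[of "- b n"] bC[of n] by simp_all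
    obtain p where p: "norm p \<le> R" "(\<lambda>n. f \<bar>p - pprt (b n)\<bar>) \<longlonglongrightarrow> 0"
      using pos_uo_Cauchy_limit[OF mc f, of "\<lambda>n. pprt (b n)" C R] nb(1) fp R by (metis zero_le_pprt)
    obtain q where q: "norm q \<le> R" "(\<lambda>n. f \<bar>q - pprt (- b n)\<bar>) \<longlonglongrightarrow> 0"
      using pos_uo_Cauchy_limit[OF mc f, of "\<lambda>n. pprt (- b n)" C R] nb(2) fm R by (metis zero_le_pprt)
    define u where "u = p - q"
    have fu: "f \<bar>u - b n\<bar> \<le> f \<bar>p - pprt (b n)\<bar> + f \<bar>q - pprt (- b n)\<bar>" for n
    proof -
      have "u - b n = (p - pprt (b n)) - (q - pprt (- b n))"
        using pprt_diff_pprt_uminus[of "b n"] by (simp add: u_def algebra_simps)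
      then have "\<bar>u - b n\<bar> \<le> \<bar>p - pprt (b n)\<bar> + \<bar>q - pprt (- b n)\<bar>"
        by (metis abs_triangle_ineq4)
      from pos_uo_mono[OF f this] show ?thesis by (simp add: linear_add[OF lin])
    qed
    have "u \<in> local_reps G f"
      unfolding local_reps_def
    proof (intro CollectI ballI impI)
      fix g assume g: "g \<in> uo_functionals" "\<forall>x. \<bar>g x\<bar> \<le> f \<bar>x\<bar>"
      have "(\<lambda>n. (1/2::real) ^ Suc n + (f \<bar>p - pprt (b n)\<bar> + f \<bar>q - pprt (- b n)\<bar>)) \<longlonglongrightarrow> 0 + (0 + 0)"
        by (intro tendsto_add p(2) q(2) LIMSEQ_Suc LIMSEQ_power_zero) simp
      moreover have "\<bar>G g - g u\<bar> \<le> (1/2) ^ Suc n + (f \<bar>p - pprt (b n)\<bar> + f \<bar>q - pprt (- b n)\<bar>)" for n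
      proof -
        have "\<bar>g u - g (b n)\<bar> \<le> f \<bar>u - b n\<bar>"
          using g(2)[rule_format, of "u - b n"] by (simp add: linear_diff[OF uo_functionals_linear[OF g(1)]])
        with fu[of n] b[OF g(1) g(2)[rule_format], of n] show ?thesis by linarith
      qed
      ultimately have "\<bar>G g - g u\<bar> \<le> 0 + (0 + 0)" by (intro tendsto_lowerbound) auto
      then show "g u = G g" by simp
    qed
    moreover have "norm u \<le> R + R"
      using norm_triangle_ineq4[of p q] p(1) q(1) by (simp add: u_def)
    ultimately show "\<exists>u\<in>local_reps G f. norm u \<le> R + R" by blast
  qed
qed

section \<open>Gluing the local solutions\<close>

text \<open>The infimum \<open>P f\<close> of all positive parts of solutions for \<open>f\<close>
  still agrees with each of them modulo \<open>f\<close>-null elements, because the solutions are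
  closed under \<open>inf\<close> and \<open>f\<close> is order continuous. Being canonical, it
  increases with \<open>f\<close>. The solution sets are left abstract so that the result applies to
  both \<open>L\<close> and its negatives.\<close>

lemma pos_uo_glue_pos_parts:
  fixes L :: "('a::banach_lattice \<Rightarrow> real) \<Rightarrow> 'a set"
  assumes mc: "monotonically_complete TYPE('a)"
    and bdd: "\<And>f. f \<in> pos_uo \<Longrightarrow> \<exists>u\<in>L f. norm u \<le> M"
    and anti: "\<And>f f'. f \<in> pos_uo \<Longrightarrow> f' \<in> pos_uo \<Longrightarrow> (\<And>x. 0 \<le> x \<Longrightarrow> f x \<le> f' x) \<Longrightarrow> L f' \<subseteq> L f"
    and uniq: "\<And>f u v. f \<in> pos_uo \<Longrightarrow> u \<in> L f \<Longrightarrow> v \<in> L f \<Longrightarrow> f \<bar>u - v\<bar> = 0"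
    and sat: "\<And>f u v. f \<in> pos_uo \<Longrightarrow> u \<in> L f \<Longrightarrow> f \<bar>v - u\<bar> = 0 \<Longrightarrow> v \<in> L f"
  obtains p where "\<And>f u. f \<in> pos_uo \<Longrightarrow> u \<in> L f \<Longrightarrow> f \<bar>p - pprt u\<bar> = 0"
proof -
  have dir: "\<exists>c\<in>pprt ` L f. c \<le> a \<and> c \<le> b" if f: "f \<in> pos_uo" and ab: "a \<in> pprt ` L f" "b \<in> pprt ` L f" for f a b
  proof -
    obtain u v where uv: "a = pprt u" "b = pprt v" "u \<in> L f" "v \<in> L f" using ab by blast
    have "\<bar>inf v u - u\<bar> \<le> \<bar>v - u\<bar>" using abs_inf_diff_le[of v u u] by simp
    from pos_uo_mono[OF f this] have "f \<bar>inf v u - u\<bar> \<le> 0" using uniq[OF f uv(4,3)] by simp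
    moreover have "0 \<le> f \<bar>inf v u - u\<bar>" by (rule pos_uo_D(3)[OF f]) (rule abs_ge_zero)
    ultimately have "inf v u \<in> L f" by (intro sat[OF f uv(3)] antisym)
    then show ?thesis using uv by (intro bexI[of _ "pprt (inf v u)"]) auto
  qed
  have "\<exists>p. isGlb UNIV (pprt ` L f) p" if f: "f \<in> pos_uo" for f
    by (rule monotonically_complete_glb[OF mc, of "pprt ` L f"]) (use bdd[OF f] dir[OF f] in auto)
  then obtain P where P: "\<And>f. f \<in> pos_uo \<Longrightarrow> isGlb UNIV (pprt ` L f) (P f)" by metis
  have P_le: "P f \<le> pprt u" if "f \<in> pos_uo" "u \<in> L f" for f u
    using P[OF that(1)] that(2) by (auto simp: isGlb_UNIV_iff)
  have P0: "0 \<le> P f" if "f \<in> pos_uo" for f using P[OF that] by (auto simp: isGlb_UNIV_iff)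
  have Peq: "f \<bar>P f - pprt u\<bar> = 0" if f: "f \<in> pos_uo" and u: "u \<in> L f" for f u
  proof -
    have "f \<bar>P f - pprt u\<bar> \<le> 0 + e" if e: "0 < e" for e
    proof -
      have "\<exists>d\<in>pprt ` L f. f (d - P f) < e"
        by (rule pos_uo_order_continuous_inf[OF f _ _ P[OF f] e]) (use u dir[OF f] in auto)
      then obtain v where v: "v \<in> L f" "f (pprt v - P f) < e" by blast
      have "\<bar>P f - pprt u\<bar> \<le> \<bar>P f - pprt v\<bar> + \<bar>pprt v - pprt u\<bar>"
        using abs_triangle_ineq[of "P f - pprt v" "pprt v - pprt u"] by simp
      also have "\<dots> \<le> (pprt v - P f) + \<bar>v - u\<bar>"
        using P_le[OF f v(1)] abs_pprt_diff_le[of v u] by (intro add_mono) (auto simp: abs_minus_commute[of "P f"])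
      finally have "f \<bar>P f - pprt u\<bar> \<le> f ((pprt v - P f) + \<bar>v - u\<bar>)" by (rule pos_uo_mono[OF f])
      then show ?thesis using v(2) uniq[OF f v(1) u] by (simp add: linear_add[OF pos_uo_D(2)[OF f]])
    qed
    then have "f \<bar>P f - pprt u\<bar> \<le> 0" by (rule field_le_epsilon)
    then show ?thesis using pos_uo_D(3)[OF f, of "\<bar>P f - pprt u\<bar>"] by simp
  qed
  have P_mono: "P f \<le> P f'" if ff: "f \<in> pos_uo" "f' \<in> pos_uo" "\<And>x. 0 \<le> x \<Longrightarrow> f x \<le> f' x" for f f'
  proof -
    have "\<forall>x\<in>L f'. P f \<le> pprt x" using P_le[OF ff(1)] anti[OF ff] by blast
    then show ?thesis using P[OF ff(2)] by (auto simp: isGlb_UNIV_iff)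
  qed
  have add: "(\<lambda>x. f x + f' x) \<in> pos_uo" if "f \<in> pos_uo" "f' \<in> pos_uo" for f f' :: "'a \<Rightarrow> real"
    using uo_functionals_add[OF pos_uo_D(1)[OF that(1)] pos_uo_D(1)[OF that(2)]]
      add_nonneg_nonneg[OF pos_uo_D(3)[OF that(1)] pos_uo_D(3)[OF that(2)]] unfolding pos_uo_def by blast
  have P_add: "P f \<le> P (\<lambda>x. f x + f' x)" "P f' \<le> P (\<lambda>x. f x + f' x)"
    if ff: "f \<in> pos_uo" "f' \<in> pos_uo" for f f'
    using P_mono[OF ff(1) add[OF ff]] P_mono[OF ff(2) add[OF ff]] pos_uo_D(3)[OF ff(1)] pos_uo_D(3)[OF ff(2)]
    by auto
  have dirP: "\<exists>c\<in>P ` pos_uo. a \<le> c \<and> b \<le> c" if ab: "a \<in> P ` pos_uo" "b \<in> P ` pos_uo" for a b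
  proof -
    obtain f f' where ff: "a = P f" "b = P f'" "f \<in> pos_uo" "f' \<in> pos_uo" using ab by blast
    then show ?thesis using P_add[OF ff(3,4)] add[OF ff(3,4)] by blast
  qed
  have ne: "P ` pos_uo \<noteq> {}"
  proof -
    have "(\<lambda>x. 0) \<in> (uo_functionals :: ('a \<Rightarrow> real) set)" using uo_functionals_sum[of "{}"] by simp
    then have "(\<lambda>x. 0) \<in> (pos_uo :: ('a \<Rightarrow> real) set)" by (simp add: pos_uo_def)
    then show ?thesis by blast
  qed
  have nP: "norm (P f) \<le> M" if f: "f \<in> pos_uo" for f
  proof -
    obtain u where u: "u \<in> L f" "norm u \<le> M" using bdd[OF f] by blast
    show ?thesis
      using norm_mono_nonneg[OF P0[OF f] P_le[OF f u(1)]] norm_pprt_le[of u] u(2) by linarith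
  qed
  obtain p where p: "isLub UNIV (P ` pos_uo) p"
    by (rule monotonically_complete_lub[OF mc ne dirP, of M]) (use P0 nP in auto)
  have "f \<bar>p - pprt u\<bar> = 0" if f: "f \<in> pos_uo" and u: "u \<in> L f" for f u
  proof -
    note lin = pos_uo_D(2)[OF f]
    have "f \<bar>p - pprt u\<bar> \<le> 0 + e" if e: "0 < e" for e
    proof -
      have "\<exists>d\<in>P ` pos_uo. f (p - d) < e"
        by (rule pos_uo_order_continuous_sup[OF f ne dirP p e]) auto
      then obtain f' where f': "f' \<in> pos_uo" "f (p - P f') < e" by blast
      \<comment> \<open>\<open>h\<close> dominates both functionals:
        \<open>P f' \<le> P h \<le> p\<close> makes \<open>P h\<close> close to \<open>p\<close>
        under \<open>f\<close>, while a solution for \<open>h\<close> is also one for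
        \<open>f\<close> and can be compared with \<open>u\<close>.\<close>
      define h where "h = (\<lambda>x. f x + f' x)"
      have h: "h \<in> pos_uo" unfolding h_def using f f'(1) by (rule add)
      obtain v where v: "v \<in> L h" using bdd[OF h] by blast
      have fh: "f x \<le> h x" if "0 \<le> x" for x using pos_uo_D(3)[OF f'(1) that] by (simp add: h_def)
      then have vf: "v \<in> L f" using anti[OF f h] v by blast
      have "f \<bar>P h - pprt v\<bar> = 0"
        using fh[of "\<bar>P h - pprt v\<bar>"] Peq[OF h v] pos_uo_D(3)[OF f, of "\<bar>P h - pprt v\<bar>"] by simp
      moreover have "f \<bar>pprt v - pprt u\<bar> \<le> 0"
        using pos_uo_mono[OF f abs_pprt_diff_le[of v u]] uniq[OF f vf u] by simp
      moreover have "f \<bar>p - P h\<bar> < e"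
      proof -
        have "P h \<le> p" using p h by (auto simp: isLub_UNIV_iff)
        moreover have "P f' \<le> P h" unfolding h_def by (rule P_add(2)[OF f f'(1)])
        ultimately have "f \<bar>p - P h\<bar> \<le> f (p - P f')" by (intro pos_uo_mono[OF f]) (simp add: abs_of_nonneg)
        with f'(2) show ?thesis by linarith
      qed
      moreover have "f \<bar>p - pprt u\<bar> \<le> f (\<bar>p - P h\<bar> + (\<bar>P h - pprt v\<bar> + \<bar>pprt v - pprt u\<bar>))"
      proof (rule pos_uo_mono[OF f])
        show "\<bar>p - pprt u\<bar> \<le> \<bar>p - P h\<bar> + (\<bar>P h - pprt v\<bar> + \<bar>pprt v - pprt u\<bar>)"
        proof -
          have "\<bar>p - pprt u\<bar> \<le> \<bar>p - P h\<bar> + \<bar>P h - pprt u\<bar>"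
            using abs_triangle_ineq[of "p - P h" "P h - pprt u"] by simp
          also have "\<bar>P h - pprt u\<bar> \<le> \<bar>P h - pprt v\<bar> + \<bar>pprt v - pprt u\<bar>"
            using abs_triangle_ineq[of "P h - pprt v" "pprt v - pprt u"] by simp
          finally show ?thesis by simp
        qed
      qed
      ultimately show ?thesis by (simp add: linear_add[OF lin])
    qed
    then have "f \<bar>p - pprt u\<bar> \<le> 0" by (rule field_le_epsilon)
    then show ?thesis using pos_uo_D(3)[OF f, of "\<bar>p - pprt u\<bar>"] by simp
  qed
  then show ?thesis by (rule that)
qed

text \<open>The positive parts of the solutions are glued to \<open>p\<close>, those of their
  negatives to \<open>n\<close>. For \<open>f\<close> dominating \<open>g\<close>, the difference
  \<open>p - n\<close> then equals any solution for \<open>f\<close> up to an \<open>f\<close>-null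
  element, which \<open>g\<close> cannot see.\<close>

lemma monotonically_complete_bidual_rep:
  fixes G :: "('a::banach_lattice \<Rightarrow> real) \<Rightarrow> real"
  assumes mc: "monotonically_complete TYPE('a)" and G: "bidual_bounded G C"
  obtains x where "\<And>g. g \<in> uo_functionals \<Longrightarrow> G g = g x"
proof -
  define L where "L = local_reps G"
  obtain M where bdd: "\<And>f. f \<in> pos_uo \<Longrightarrow> \<exists>u\<in>L f. norm u \<le> M"
    using local_reps_bounded[OF mc G] unfolding L_def by metis
  have anti: "L f' \<subseteq> L f" if le: "\<And>x. 0 \<le> x \<Longrightarrow> f x \<le> f' x" for f f'
  proof
    fix u assume u: "u \<in> L f'"
    have "g u = G g" if "g \<in> uo_functionals" "\<And>x. \<bar>g x\<bar> \<le> f \<bar>x\<bar>" for g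
      using u that order_trans[OF that(2) le[OF abs_ge_zero]] by (simp add: L_def local_reps_def)
    then show "u \<in> L f" by (simp add: L_def local_reps_def)
  qed
  have uniq: "f \<bar>u - v\<bar> = 0" if f: "f \<in> pos_uo" and uv: "u \<in> L f" "v \<in> L f" for f u v
  proof -
    obtain g where g: "g \<in> uo_functionals" "\<And>z. \<bar>g z\<bar> \<le> f \<bar>z\<bar>" "g (u - v) = f \<bar>u - v\<bar>"
      using pos_uo_abs_attained[OF f] by blast
    then have "g u = G g" "g v = G g" using uv by (auto simp: L_def local_reps_def)
    then have "g u = g v" by simp
    with g(3) show ?thesis by (simp add: linear_diff[OF uo_functionals_linear[OF g(1)]])
  qed
  have eq: "g v = g u" if g: "g \<in> uo_functionals" "\<And>x. \<bar>g x\<bar> \<le> f \<bar>x\<bar>" and "f \<bar>v - u\<bar> = 0"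
    for f g :: "'a \<Rightarrow> real" and u v
    using g(2)[of "v - u"] that(3) by (simp add: linear_diff[OF uo_functionals_linear[OF g(1)]])
  have sat: "v \<in> L f" if "u \<in> L f" "f \<bar>v - u\<bar> = 0" for f u v
    using that eq[of _ f v u] unfolding L_def local_reps_def by auto
  obtain p where p: "\<And>f u. f \<in> pos_uo \<Longrightarrow> u \<in> L f \<Longrightarrow> f \<bar>p - pprt u\<bar> = 0"
    by (rule pos_uo_glue_pos_parts[OF mc, of L M]) (use bdd anti uniq sat in blast)+
  obtain n where n: "\<And>f u. f \<in> pos_uo \<Longrightarrow> u \<in> uminus ` L f \<Longrightarrow> f \<bar>n - pprt u\<bar> = 0"
  proof (rule pos_uo_glue_pos_parts[OF mc, of "\<lambda>f. uminus ` L f" M])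
    show "\<exists>u\<in>uminus ` L f. norm u \<le> M" if "f \<in> pos_uo" for f using bdd[OF that] by auto
    show "uminus ` L f' \<subseteq> uminus ` L f" if "\<And>x. 0 \<le> x \<Longrightarrow> f x \<le> f' x" for f f'
      using anti[OF that] by (rule image_mono)
    show "f \<bar>u - v\<bar> = 0" if f: "f \<in> pos_uo" and uv: "u \<in> uminus ` L f" "v \<in> uminus ` L f" for f u v
      using uniq[OF f, of "- u" "- v"] uv by (auto simp: abs_minus_commute)
    show "v \<in> uminus ` L f" if u: "u \<in> uminus ` L f" and 0: "f \<bar>v - u\<bar> = 0" for f u v
    proof -
      have "- u \<in> L f" using u by auto
      then have "- v \<in> L f" by (rule sat) (use 0 in \<open>simp add: abs_minus_commute\<close>)
      then show ?thesis by (intro image_eqI[of _ _ "- v"]) auto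
    qed
    fix n assume "\<And>f u. f \<in> pos_uo \<Longrightarrow> u \<in> uminus ` L f \<Longrightarrow> f \<bar>n - pprt u\<bar> = 0"
    then show thesis by (rule that)
  qed
  have "G g = g (p - n)" if g: "g \<in> uo_functionals" for g
  proof -
    obtain f where f: "f \<in> pos_uo" "\<And>x. \<bar>g x\<bar> \<le> f \<bar>x\<bar>"
      using uo_functionals_dominating[OF g] by blast
    obtain u where u: "u \<in> L f" using bdd[OF f(1)] by blast
    have "(p - n) - u = (p - pprt u) - (n - pprt (- u))"
      using pprt_diff_pprt_uminus[of u] by (simp add: algebra_simps)
    then have "\<bar>(p - n) - u\<bar> \<le> \<bar>p - pprt u\<bar> + \<bar>n - pprt (- u)\<bar>"
      by (metis abs_triangle_ineq4)
    from pos_uo_mono[OF f(1) this] have "f \<bar>(p - n) - u\<bar> \<le> 0"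
      using p[OF f(1) u] n[OF f(1), of "- u"] u by (simp add: linear_add[OF pos_uo_D(2)[OF f(1)]])
    then have "f \<bar>(p - n) - u\<bar> = 0" using pos_uo_D(3)[OF f(1), of "\<bar>(p - n) - u\<bar>"] by simp
    from eq[OF g f(2) this] show ?thesis using u g f(2) by (simp add: L_def local_reps_def)
  qed
  then show ?thesis by (rule that)
qed

section \<open>The evaluation map and the weak topology\<close>

lemma uo_dual_Blinfun:
  assumes "f \<in> uo_functionals"
  shows "Blinfun f \<in> uo_dual" "blinfun_apply (Blinfun f) = f"
  using bounded_linear_Blinfun_apply[OF uo_functionals_bounded_linear[OF assms]] assms
  by (simp_all add: uo_dual_def)

lemma uo_dualD: "\<phi> \<in> uo_dual \<Longrightarrow> blinfun_apply \<phi> \<in> uo_functionals"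
  by (simp add: uo_dual_def)

lemma uo_dual_add: "\<phi> \<in> uo_dual \<Longrightarrow> \<psi> \<in> uo_dual \<Longrightarrow> \<phi> + \<psi> \<in> uo_dual"
  using uo_functionals_add[of "blinfun_apply \<phi>" "blinfun_apply \<psi>"]
  by (simp add: uo_dual_def plus_blinfun.rep_eq)

lemma uo_dual_scaleR: "\<phi> \<in> uo_dual \<Longrightarrow> c *\<^sub>R \<phi> \<in> uo_dual"
  using uo_functionals_scale[of "blinfun_apply \<phi>" c]
  by (simp add: uo_dual_def scaleR_blinfun.rep_eq)

lemma nonneg_functional_pos_uo:
  "\<phi> \<in> uo_dual \<Longrightarrow> nonneg_functional \<phi> \<Longrightarrow> blinfun_apply \<phi> \<in> pos_uo"
  by (simp add: uo_dual_def nonneg_functional_def pos_uo_def)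

lemma pos_uo_nonneg_functional: "f \<in> pos_uo \<Longrightarrow> nonneg_functional (Blinfun f)"
  by (simp add: nonneg_functional_def uo_dual_Blinfun(2)[OF pos_uo_D(1)] pos_uo_D(3))

lemma uo_dual_dualD:
  assumes "F \<in> uo_dual_dual" "\<phi> \<in> uo_dual"
  shows "\<psi> \<in> uo_dual \<Longrightarrow> F (\<phi> + \<psi>) = F \<phi> + F \<psi>" "F (c *\<^sub>R \<phi>) = c * F \<phi>"
  using assms by (auto simp: uo_dual_dual_def)

lemma uo_evaluation_in_uo_dual_dual: "uo_evaluation x \<in> uo_dual_dual"
proof -
  have "\<forall>\<phi>\<in>uo_dual. \<bar>uo_evaluation x \<phi>\<bar> \<le> norm x * norm \<phi>"
  proof
    fix \<phi> :: "'a \<Rightarrow>\<^sub>L real" assume "\<phi> \<in> uo_dual"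
    then show "\<bar>uo_evaluation x \<phi>\<bar> \<le> norm x * norm \<phi>"
      using norm_blinfun[of \<phi> x] by (simp add: uo_evaluation_def mult.commute)
  qed
  then have "\<exists>C. \<forall>\<phi>\<in>uo_dual. \<bar>uo_evaluation x \<phi>\<bar> \<le> C * norm \<phi>" by blast
  then show ?thesis
    unfolding uo_dual_dual_def
    by (auto simp: uo_evaluation_def uo_dual_add uo_dual_scaleR plus_blinfun.rep_eq scaleR_blinfun.rep_eq)
qed

lemma inj_uo_evaluation:
  assumes "uo_dual_separates_points TYPE('a::banach_lattice)"
  shows "inj (uo_evaluation :: 'a \<Rightarrow> ('a \<Rightarrow>\<^sub>L real) \<Rightarrow> real)"
proof (rule injI, rule ccontr)
  fix x y :: 'a assume eq: "uo_evaluation x = uo_evaluation y" and "x \<noteq> y"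
  then obtain \<phi> where "\<phi> \<in> uo_dual" "blinfun_apply \<phi> x \<noteq> blinfun_apply \<phi> y"
    using assms unfolding uo_dual_separates_points_def by blast
  then show False using fun_cong[OF eq, of \<phi>] by (simp add: uo_evaluation_def)
qed

text \<open>The component of \<phi> on the positive part of \<open>x - y\<close> sees
  \<open>x\<close> as the larger element, its complement sees \<open>y\<close>; exchanging the roles
  gives the infimum. An upper bound of both evaluations is compared with \<open>x\<close> on one
  piece and with \<open>y\<close> on the other, and additivity reassembles the bound at
  \<phi>.\<close>

lemma uo_evaluation_sup_inf_split:
  fixes x y :: "'a::banach_lattice"
  assumes \<phi>: "\<phi> \<in> uo_dual" "nonneg_functional \<phi>"
  obtains \<phi>\<^sub>1 \<phi>\<^sub>2 where "\<phi>\<^sub>1 \<in> uo_dual" "nonneg_functional \<phi>\<^sub>1" "\<phi>\<^sub>2 \<in> uo_dual" "nonneg_functional \<phi>\<^sub>2"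
    "\<phi> = \<phi>\<^sub>1 + \<phi>\<^sub>2" "blinfun_apply \<phi> (sup x y) = blinfun_apply \<phi>\<^sub>1 x + blinfun_apply \<phi>\<^sub>2 y"
    "blinfun_apply \<phi> (inf x y) = blinfun_apply \<phi>\<^sub>2 x + blinfun_apply \<phi>\<^sub>1 y"
proof -
  obtain g where g: "g \<in> pos_uo" "(\<lambda>x. blinfun_apply \<phi> x - g x) \<in> pos_uo"
    "g (x - y) = blinfun_apply \<phi> (pprt (x - y))"
    using pos_uo_component[OF nonneg_functional_pos_uo[OF \<phi>]] .
  note B1 = uo_dual_Blinfun[OF pos_uo_D(1)[OF g(1)]] and B2 = uo_dual_Blinfun[OF pos_uo_D(1)[OF g(2)]]
  have gd: "g x - g y = blinfun_apply \<phi> (pprt (x - y))"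
    using g(3) by (simp add: linear_diff[OF pos_uo_D(2)[OF g(1)]])
  show ?thesis
  proof (rule that[of "Blinfun g" "Blinfun (\<lambda>x. blinfun_apply \<phi> x - g x)"])
    show "\<phi> = Blinfun g + Blinfun (\<lambda>x. blinfun_apply \<phi> x - g x)"
      by (rule blinfun_eqI) (simp add: plus_blinfun.rep_eq B1(2) B2(2))
    show "blinfun_apply \<phi> (sup x y) = blinfun_apply (Blinfun g) x + blinfun_apply (Blinfun (\<lambda>x. blinfun_apply \<phi> x - g x)) y"
      unfolding B1(2) B2(2) sup_eq_add_pprt[of x y] using gd by (simp add: blinfun.add_right)
    show "blinfun_apply \<phi> (inf x y) = blinfun_apply (Blinfun (\<lambda>x. blinfun_apply \<phi> x - g x)) x + blinfun_apply (Blinfun g) y"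
      unfolding B1(2) B2(2) inf_eq_diff_pprt[of x y] using gd by (simp add: blinfun.diff_right)
  qed (use B1(1) B2(1) g pos_uo_nonneg_functional in blast)+
qed

lemma uo_evaluation_join:
  "is_join uo_dual_dual uo_dual_dual_le (uo_evaluation x) (uo_evaluation y) (uo_evaluation (sup x y))"
  unfolding is_join_def
proof (intro conjI ballI impI uo_evaluation_in_uo_dual_dual)
  show "uo_dual_dual_le (uo_evaluation x) (uo_evaluation (sup x y))"
    "uo_dual_dual_le (uo_evaluation y) (uo_evaluation (sup x y))"
    by (auto simp: uo_dual_dual_le_def uo_evaluation_def intro!: pos_uo_mono[OF nonneg_functional_pos_uo])
  fix Z assume Z: "Z \<in> uo_dual_dual"
    and le: "uo_dual_dual_le (uo_evaluation x) Z \<and> uo_dual_dual_le (uo_evaluation y) Z"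
  show "uo_dual_dual_le (uo_evaluation (sup x y)) Z"
    unfolding uo_dual_dual_le_def
  proof (intro ballI impI)
    fix \<phi> :: "'a \<Rightarrow>\<^sub>L real" assume \<phi>: "\<phi> \<in> uo_dual" "nonneg_functional \<phi>"
    from \<phi> obtain \<phi>\<^sub>1 \<phi>\<^sub>2 where s: "\<phi>\<^sub>1 \<in> uo_dual" "nonneg_functional \<phi>\<^sub>1" "\<phi>\<^sub>2 \<in> uo_dual" "nonneg_functional \<phi>\<^sub>2"
      "\<phi> = \<phi>\<^sub>1 + \<phi>\<^sub>2" "blinfun_apply \<phi> (sup x y) = blinfun_apply \<phi>\<^sub>1 x + blinfun_apply \<phi>\<^sub>2 y"
      using uo_evaluation_sup_inf_split by blast
    have "blinfun_apply \<phi>\<^sub>1 x \<le> Z \<phi>\<^sub>1" "blinfun_apply \<phi>\<^sub>2 y \<le> Z \<phi>\<^sub>2"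
      using le s(1-4) by (auto simp: uo_dual_dual_le_def uo_evaluation_def)
    moreover have "Z \<phi> = Z \<phi>\<^sub>1 + Z \<phi>\<^sub>2" unfolding s(5) by (rule uo_dual_dualD(1)[OF Z s(1,3)])
    ultimately show "uo_evaluation (sup x y) \<phi> \<le> Z \<phi>" using \<phi>(1) s(6) by (simp add: uo_evaluation_def)
  qed
qed

lemma uo_evaluation_meet:
  "is_join uo_dual_dual (\<lambda>F G. uo_dual_dual_le G F) (uo_evaluation x) (uo_evaluation y) (uo_evaluation (inf x y))"
  unfolding is_join_def
proof (intro conjI ballI impI uo_evaluation_in_uo_dual_dual)
  show "uo_dual_dual_le (uo_evaluation (inf x y)) (uo_evaluation x)"
    "uo_dual_dual_le (uo_evaluation (inf x y)) (uo_evaluation y)"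
    by (auto simp: uo_dual_dual_le_def uo_evaluation_def intro!: pos_uo_mono[OF nonneg_functional_pos_uo])
  fix Z assume Z: "Z \<in> uo_dual_dual"
    and le: "uo_dual_dual_le Z (uo_evaluation x) \<and> uo_dual_dual_le Z (uo_evaluation y)"
  show "uo_dual_dual_le Z (uo_evaluation (inf x y))"
    unfolding uo_dual_dual_le_def
  proof (intro ballI impI)
    fix \<phi> :: "'a \<Rightarrow>\<^sub>L real" assume \<phi>: "\<phi> \<in> uo_dual" "nonneg_functional \<phi>"
    from \<phi> obtain \<phi>\<^sub>1 \<phi>\<^sub>2 where s: "\<phi>\<^sub>1 \<in> uo_dual" "nonneg_functional \<phi>\<^sub>1" "\<phi>\<^sub>2 \<in> uo_dual" "nonneg_functional \<phi>\<^sub>2"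
      "\<phi> = \<phi>\<^sub>1 + \<phi>\<^sub>2" "blinfun_apply \<phi> (inf x y) = blinfun_apply \<phi>\<^sub>2 x + blinfun_apply \<phi>\<^sub>1 y"
      using uo_evaluation_sup_inf_split by blast
    have "Z \<phi>\<^sub>2 \<le> blinfun_apply \<phi>\<^sub>2 x" "Z \<phi>\<^sub>1 \<le> blinfun_apply \<phi>\<^sub>1 y"
      using le s(1-4) by (auto simp: uo_dual_dual_le_def uo_evaluation_def)
    moreover have "Z \<phi> = Z \<phi>\<^sub>1 + Z \<phi>\<^sub>2" unfolding s(5) by (rule uo_dual_dualD(1)[OF Z s(1,3)])
    ultimately show "Z \<phi> \<le> uo_evaluation (inf x y) \<phi>" using \<phi>(1) s(6) by (simp add: uo_evaluation_def)
  qed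
qed

lemma uo_dual_dual_bidual_bounded:
  assumes F: "F \<in> uo_dual_dual"
  obtains C where "bidual_bounded (\<lambda>f. F (Blinfun f)) C"
proof -
  obtain C where C: "\<And>\<phi>. \<phi> \<in> uo_dual \<Longrightarrow> \<bar>F \<phi>\<bar> \<le> C * norm \<phi>"
    using F unfolding uo_dual_dual_def by blast
  \<comment> \<open>The maximum with \<open>1\<close> ensures a strictly positive constant.\<close>
  have "bidual_bounded (\<lambda>f. F (Blinfun f)) (max C 1)"
    unfolding bidual_bounded_def
  proof (intro conjI ballI allI impI)
    fix f g :: "'a \<Rightarrow> real" assume fg: "f \<in> uo_functionals" "g \<in> uo_functionals"
    note B = uo_dual_Blinfun[OF fg(1)] uo_dual_Blinfun[OF fg(2)] uo_dual_Blinfun[OF uo_functionals_add[OF fg]]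
    have "Blinfun (\<lambda>x. f x + g x) = Blinfun f + Blinfun g"
      by (rule blinfun_eqI) (simp add: plus_blinfun.rep_eq B)
    then show "F (Blinfun (\<lambda>x. f x + g x)) = F (Blinfun f) + F (Blinfun g)"
      using uo_dual_dualD(1)[OF F B(1,3)] by simp
  next
    fix c and f :: "'a \<Rightarrow> real" assume f: "f \<in> uo_functionals"
    note B = uo_dual_Blinfun[OF f] uo_dual_Blinfun[OF uo_functionals_scale[OF f]]
    have "Blinfun (\<lambda>x. c * f x) = c *\<^sub>R Blinfun f"
      by (rule blinfun_eqI) (simp add: scaleR_blinfun.rep_eq B)
    then show "F (Blinfun (\<lambda>x. c * f x)) = c * F (Blinfun f)"
      using uo_dual_dualD(2)[OF F B(1)] by simp
  next
    fix f :: "'a \<Rightarrow> real" and K :: real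
    assume f: "f \<in> uo_functionals" and K: "0 \<le> K" "\<forall>x. \<bar>f x\<bar> \<le> K * norm x"
    note B = uo_dual_Blinfun[OF f]
    have "norm (Blinfun f) \<le> K" using K by (intro norm_blinfun_bound) (auto simp: B)
    then have "max C 1 * norm (Blinfun f) \<le> max C 1 * K" by (intro mult_left_mono) auto
    moreover have "C * norm (Blinfun f) \<le> max C 1 * norm (Blinfun f)" by (intro mult_right_mono) auto
    ultimately show "\<bar>F (Blinfun f)\<bar> \<le> max C 1 * K" using C[OF B(1)] by linarith
  qed simp
  then show ?thesis by (rule that)
qed

lemma monotonically_complete_imp_lattice_iso:
  assumes sep: "uo_dual_separates_points TYPE('a::banach_lattice)"
    and mc: "monotonically_complete TYPE('a)"
  shows "lattice_iso_onto_uo_dual_dual (uo_evaluation :: 'a \<Rightarrow> ('a \<Rightarrow>\<^sub>L real) \<Rightarrow> real)"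
proof -
  have "\<exists>x::'a. F = uo_evaluation x" if F: "F \<in> uo_dual_dual" for F
  proof -
    obtain C where "bidual_bounded (\<lambda>f. F (Blinfun f)) C"
      by (rule uo_dual_dual_bidual_bounded[OF F])
    then obtain x where x: "\<And>g. g \<in> uo_functionals \<Longrightarrow> F (Blinfun g) = g x"
      using monotonically_complete_bidual_rep[OF mc] by blast
    have "F \<phi> = uo_evaluation x \<phi>" for \<phi>
    proof (cases "\<phi> \<in> uo_dual")
      case True
      with x[OF uo_dualD[OF this]] show ?thesis by (simp add: blinfun_apply_inverse uo_evaluation_def)
    next
      case False
      with F show ?thesis by (simp add: uo_evaluation_def uo_dual_dual_def extensional_def)
    qed
    then show ?thesis by blast
  qed
  then have "bij_betw (uo_evaluation :: 'a \<Rightarrow> _) UNIV uo_dual_dual"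
    using inj_uo_evaluation[OF sep] uo_evaluation_in_uo_dual_dual by (auto simp: bij_betw_def)
  then show ?thesis
    unfolding lattice_iso_onto_uo_dual_dual_def
    using uo_evaluation_join uo_evaluation_meet
    by (auto simp: uo_evaluation_def blinfun.add_right blinfun.scaleR_right)
qed

section \<open>Weak compactness of the unit ball\<close>

lemma topspace_uo_weak_topology [simp]: "topspace uo_weak_topology = UNIV"
proof -
  have "(\<lambda>x. 0) \<in> (uo_functionals :: ('a \<Rightarrow> real) set)" using uo_functionals_sum[of "{}"] by simp
  from uo_dual_Blinfun(1)[OF this]
  have "blinfun_apply (Blinfun (\<lambda>x::'a. 0::real)) -` UNIV \<in> {blinfun_apply \<phi> -` U | \<phi> U. \<phi> \<in> uo_dual \<and> open U}"
    by blast
  then show ?thesis unfolding uo_weak_topology_def topology_generated_by_topspace by auto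
qed

lemma closedin_uo_weak_topology:
  assumes "\<phi> \<in> uo_dual" "closed S"
  shows "closedin uo_weak_topology (blinfun_apply \<phi> -` S)"
proof -
  have "openin uo_weak_topology (blinfun_apply \<phi> -` (- S))"
    unfolding uo_weak_topology_def using assms by (intro topology_generated_by_Basis) auto
  moreover have "UNIV - blinfun_apply \<phi> -` S = blinfun_apply \<phi> -` (- S)" by auto
  ultimately show ?thesis by (simp add: closedin_def)
qed

text \<open>Banach-Alaoglu for the uo-dual: the functionals of norm at most \<open>1\<close> form a
  closed subset \<open>W\<close> of a product of compact intervals. Surjectivity of the evaluation
  map lets its inverse carry \<open>W\<close> back into the space, and this inverse is continuous
  because both topologies are those of pointwise convergence on the uo-dual.\<close>

lemma lattice_iso_imp_relatively_compact:
  assumes sep: "uo_dual_separates_points TYPE('a::banach_lattice)"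
    and iso: "lattice_iso_onto_uo_dual_dual (uo_evaluation :: 'a \<Rightarrow> ('a \<Rightarrow>\<^sub>L real) \<Rightarrow> real)"
  shows "relatively_compact_in uo_weak_topology (cball (0::'a) 1)"
proof -
  define PT where "PT = product_topology (\<lambda>\<phi>::'a \<Rightarrow>\<^sub>L real. euclideanreal) uo_dual"
  define B where "B = PiE uo_dual (\<lambda>\<phi>::'a \<Rightarrow>\<^sub>L real. {- norm \<phi>..norm \<phi>})"
  have topPT: "topspace PT = extensional uo_dual"
    by (simp add: PT_def topspace_product_topology PiE_def)
  have cont: "continuous_map PT euclideanreal (\<lambda>F. F \<phi>)" if "\<phi> \<in> uo_dual" for \<phi>
    unfolding PT_def
    using continuous_map_product_projection[OF that, of "\<lambda>_. euclideanreal"] by simp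
  have cB: "compactin PT B"
    unfolding PT_def B_def by (simp add: compactin_PiE)
  define Add where "Add \<phi> \<psi> = {F \<in> topspace PT. F (\<phi> + \<psi>) - (F \<phi> + F \<psi>) \<in> {0::real}}" for \<phi> \<psi>
  define Sc where "Sc c \<phi> = {F \<in> topspace PT. F (c *\<^sub>R \<phi>) - c * F \<phi> \<in> {0::real}}" for c \<phi>
  have closedAdd: "closedin PT (Add \<phi> \<psi>)" if "\<phi> \<in> uo_dual" "\<psi> \<in> uo_dual" for \<phi> \<psi>
    unfolding Add_def
    by (rule closedin_continuous_map_preimage[where Y = euclideanreal])
      (use that in \<open>auto intro!: continuous_intros cont uo_dual_add\<close>)
  have closedSc: "closedin PT (Sc c \<phi>)" if "\<phi> \<in> uo_dual" for c \<phi>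
    unfolding Sc_def
    by (rule closedin_continuous_map_preimage[where Y = euclideanreal])
      (use that in \<open>auto intro!: continuous_intros cont uo_dual_scaleR\<close>)
  \<comment> \<open>Including the whole space keeps the family visibly nonempty, as intersecting
    closed sets requires.\<close>
  define \<C> where "\<C> = insert (topspace PT)
    ({Add \<phi> \<psi> | \<phi> \<psi>. \<phi> \<in> uo_dual \<and> \<psi> \<in> uo_dual} \<union> {Sc c \<phi> | c \<phi>. \<phi> \<in> uo_dual})"
  define W where "W = B \<inter> \<Inter>\<C>"
  have "closedin PT (\<Inter>\<C>)"
    by (rule closedin_Inter) (auto simp: \<C>_def closedAdd closedSc)
  then have cW: "compactin PT W" unfolding W_def using cB by (simp add: compact_Int_closedin)
  have Wsub: "F \<in> uo_dual_dual" if F: "F \<in> W" for F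
  proof -
    have "F \<in> extensional uo_dual" "\<And>\<phi>. \<phi> \<in> uo_dual \<Longrightarrow> F \<phi> \<in> {- norm \<phi>..norm \<phi>}"
      using F by (auto simp: W_def B_def PiE_iff)
    moreover have "\<exists>C. \<forall>\<phi>\<in>uo_dual. \<bar>F \<phi>\<bar> \<le> C * norm \<phi>"
    proof (intro exI[of _ 1] ballI)
      fix \<phi> :: "'a \<Rightarrow>\<^sub>L real" assume "\<phi> \<in> uo_dual"
      with F have "F \<phi> \<in> {- norm \<phi>..norm \<phi>}" by (auto simp: W_def B_def PiE_iff)
      then show "\<bar>F \<phi>\<bar> \<le> 1 * norm \<phi>" unfolding atLeastAtMost_iff by linarith
    qed
    moreover have "F (\<phi> + \<psi>) = F \<phi> + F \<psi>" if "\<phi> \<in> uo_dual" "\<psi> \<in> uo_dual" for \<phi> \<psi>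
    proof -
      have "Add \<phi> \<psi> \<in> \<C>" unfolding \<C>_def using that by blast
      then have "F \<in> Add \<phi> \<psi>" using F by (simp add: W_def)
      then show ?thesis by (simp add: Add_def)
    qed
    moreover have "F (c *\<^sub>R \<phi>) = c * F \<phi>" if "\<phi> \<in> uo_dual" for c \<phi>
    proof -
      have "Sc c \<phi> \<in> \<C>" unfolding \<C>_def using that by blast
      then have "F \<in> Sc c \<phi>" using F by (simp add: W_def)
      then show ?thesis by (simp add: Sc_def)
    qed
    ultimately show ?thesis
      unfolding uo_dual_dual_def by blast
  qed
  have evW: "uo_evaluation x \<in> W" if x: "\<And>\<phi>. \<phi> \<in> uo_dual \<Longrightarrow> \<bar>blinfun_apply \<phi> x\<bar> \<le> norm \<phi>" for x
  proof -
    have "uo_evaluation x \<in> B"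
      unfolding B_def PiE_iff
    proof (intro conjI ballI)
      fix \<phi> :: "'a \<Rightarrow>\<^sub>L real" assume "\<phi> \<in> uo_dual"
      with x[OF this] show "uo_evaluation x \<phi> \<in> {- norm \<phi>..norm \<phi>}"
        by (simp add: uo_evaluation_def) linarith
    qed (simp add: uo_evaluation_def)
    moreover have "uo_evaluation x \<in> \<Inter>\<C>"
      by (auto simp: \<C>_def Add_def Sc_def topPT uo_evaluation_def uo_dual_add uo_dual_scaleR
          plus_blinfun.rep_eq scaleR_blinfun.rep_eq)
    ultimately show ?thesis by (simp add: W_def)
  qed
  have surj: "range (uo_evaluation :: 'a \<Rightarrow> _) = uo_dual_dual"
    using iso by (simp add: lattice_iso_onto_uo_dual_dual_def bij_betw_def)
  define J where "J = inv (uo_evaluation :: 'a \<Rightarrow> _)"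
  have J: "blinfun_apply \<phi> (J F) = F \<phi>" if F: "F \<in> W" and \<phi>: "\<phi> \<in> uo_dual" for F \<phi>
  proof -
    have "uo_evaluation (J F) = F" unfolding J_def using surj Wsub[OF F] by (intro f_inv_into_f) simp
    from fun_cong[OF this, of \<phi>] \<phi> show ?thesis by (simp add: uo_evaluation_def)
  qed
  have Jev: "J (uo_evaluation x) = x" for x
    unfolding J_def by (rule inv_f_f[OF inj_uo_evaluation[OF sep]])
  have topW: "topspace (subtopology PT W) = W"
    using compactin_subset_topspace[OF cW] by (simp add: topspace_subtopology Int_absorb1)
  have cover: "\<Union> {blinfun_apply \<phi> -` U | (\<phi> :: 'a \<Rightarrow>\<^sub>L real) U. \<phi> \<in> uo_dual \<and> open U} = UNIV"
    using topspace_uo_weak_topology[where 'a = 'a]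
    unfolding uo_weak_topology_def topology_generated_by_topspace .
  have "continuous_map (subtopology PT W) uo_weak_topology J"
    unfolding uo_weak_topology_def
  proof (rule continuous_on_generated_topo)
    fix V assume "V \<in> {blinfun_apply \<phi> -` U | (\<phi> :: 'a \<Rightarrow>\<^sub>L real) U. \<phi> \<in> uo_dual \<and> open U}"
    then obtain \<phi> :: "'a \<Rightarrow>\<^sub>L real" and U where V: "V = blinfun_apply \<phi> -` U" "\<phi> \<in> uo_dual" "open U" by blast
    have "J -` V \<inter> topspace (subtopology PT W) = {F \<in> topspace (subtopology PT W). F \<phi> \<in> U}"
      unfolding topW V(1) using J V(2) by auto
    moreover have "openin (subtopology PT W) {F \<in> topspace (subtopology PT W). F \<phi> \<in> U}"
      by (rule openin_continuous_map_preimage[where Y = euclideanreal])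
        (use V cont in \<open>auto intro: continuous_map_from_subtopology\<close>)
    ultimately show "openin (subtopology PT W) (J -` V \<inter> topspace (subtopology PT W))" by simp
  next
    show "J ` topspace (subtopology PT W) \<subseteq> \<Union> {blinfun_apply \<phi> -` U | (\<phi> :: 'a \<Rightarrow>\<^sub>L real) U. \<phi> \<in> uo_dual \<and> open U}"
      by (simp only: cover subset_UNIV)
  qed
  moreover have "compactin (subtopology PT W) W" using cW by (simp add: compactin_subtopology)
  ultimately have cJ: "compactin uo_weak_topology (J ` W)" by (rule image_compactin[rotated])
  \<comment> \<open>A weakly closed set between the unit ball and the compact image of
    \<open>W\<close>; it therefore contains the closure of the ball and makes that closure
    compact.\<close>
  define Q where "Q = (\<Inter>\<phi>\<in>uo_dual. blinfun_apply \<phi> -` {- norm \<phi>..norm \<phi>} :: 'a set)"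
  have "closedin uo_weak_topology (\<Inter>(insert UNIV ((\<lambda>\<phi>. blinfun_apply \<phi> -` {- norm \<phi>..norm \<phi>} :: 'a set) ` uo_dual)))"
    by (rule closedin_Inter) (use closedin_topspace[of uo_weak_topology] in \<open>auto intro!: closedin_uo_weak_topology\<close>)
  then have cQ: "closedin uo_weak_topology Q" by (simp add: Q_def)
  have "Q \<subseteq> J ` W"
  proof
    fix x assume "x \<in> Q"
    then have "uo_evaluation x \<in> W" by (intro evW abs_leI) (auto simp: Q_def minus_le_iff[of _ "norm _"])
    then show "x \<in> J ` W" by (intro image_eqI[of _ _ "uo_evaluation x"]) (simp_all add: Jev)
  qed
  moreover have "cball 0 1 \<subseteq> Q"
  proof
    fix x :: 'a assume "x \<in> cball 0 1"
    then have nx: "norm x \<le> 1" by simp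
    have "\<bar>blinfun_apply \<phi> x\<bar> \<le> norm \<phi>" for \<phi> :: "'a \<Rightarrow>\<^sub>L real"
      using norm_blinfun[of \<phi> x] mult_left_mono[OF nx, of "norm \<phi>"] by simp
    from abs_le_D1[OF this] abs_le_D2[OF this] have "- norm \<phi> \<le> blinfun_apply \<phi> x \<and> blinfun_apply \<phi> x \<le> norm \<phi>"
      for \<phi> :: "'a \<Rightarrow>\<^sub>L real" by (metis neg_le_iff_le minus_minus)
    then show "x \<in> Q" by (simp add: Q_def)
  qed
  then have "uo_weak_topology closure_of cball 0 1 \<subseteq> Q" using cQ by (rule closure_of_minimal)
  ultimately show ?thesis
    unfolding relatively_compact_in_def
    by (intro closed_compactin[OF cJ]) auto
qed

text \<open>Closed half-spaces of positive functionals encode the supremum: those in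
  \<open>Lo\<close> force a point above the whole net, those in \<open>Up\<close> force it below
  every upper bound. Each contains a tail of the net, so compactness provides a common point, and
  positive functionals determine the order.\<close>

lemma relatively_compact_imp_monotonically_complete:
  assumes sep: "uo_dual_separates_points TYPE('a::banach_lattice)"
    and rc: "relatively_compact_in uo_weak_topology (cball (0::'a) 1)"
  shows "monotonically_complete TYPE('a)"
  unfolding monotonically_complete_def
proof (intro allI impI)
  fix r :: "'a net_index rel" and x :: "'a net_index \<Rightarrow> 'a"
  assume *: "directed_preorder r \<and> bounded (x ` Field r) \<and> (\<forall>\<alpha>\<in>Field r. 0 \<le> x \<alpha>) \<and> increasing_net r x"
  then have r: "directed_preorder r" and inc: "\<And>\<alpha> \<beta>. (\<alpha>, \<beta>) \<in> r \<Longrightarrow> x \<alpha> \<le> x \<beta>"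
    by (auto simp: increasing_net_def)
  note D = directed_preorderD[OF r]
  from * obtain M where M: "0 < M" "\<And>\<alpha>. \<alpha> \<in> Field r \<Longrightarrow> norm (x \<alpha>) \<le> M"
    by (auto simp: bounded_pos)
  define xM where "xM \<alpha> = (1/M) *\<^sub>R x \<alpha>" for \<alpha>
  define K where "K = uo_weak_topology closure_of cball (0::'a) 1"
  have cK: "compactin uo_weak_topology K" using rc by (simp add: K_def relatively_compact_in_def)
  have xK: "xM \<alpha> \<in> K" if "\<alpha> \<in> Field r" for \<alpha>
  proof -
    have "xM \<alpha> \<in> cball 0 1" using M(2)[OF that] M(1) by (simp add: xM_def)
    then show ?thesis unfolding K_def using closure_of_subset[of "cball (0::'a) 1" uo_weak_topology] by auto
  qed
  define Lo where "Lo = {{v. f (xM \<alpha>) \<le> f v} | f \<alpha>. f \<in> pos_uo \<and> \<alpha> \<in> Field r}"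
  define Up where "Up = {{v. f v \<le> f u} | f u. f \<in> pos_uo \<and> (\<forall>\<alpha>\<in>Field r. xM \<alpha> \<le> u)}"
  have closed: "closedin uo_weak_topology {v. c \<le> f v}" "closedin uo_weak_topology {v. f v \<le> c}"
    if f: "f \<in> pos_uo" for f :: "'a \<Rightarrow> real" and c
  proof -
    note B = uo_dual_Blinfun[OF pos_uo_D(1)[OF f]]
    have "{v. c \<le> f v} = blinfun_apply (Blinfun f) -` {c..}" "{v. f v \<le> c} = blinfun_apply (Blinfun f) -` {..c}"
      by (auto simp: B)
    then show "closedin uo_weak_topology {v. c \<le> f v}" "closedin uo_weak_topology {v. f v \<le> c}"
      using closedin_uo_weak_topology[OF B(1)] by simp_all
  qed
  have ev: "\<exists>\<alpha>\<in>Field r. \<forall>\<beta>. (\<alpha>, \<beta>) \<in> r \<longrightarrow> xM \<beta> \<in> S" if "S \<in> Lo \<union> Up" for S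
    using that
  proof
    assume "S \<in> Lo"
    then obtain f \<alpha> where S: "S = {v. f (xM \<alpha>) \<le> f v}" "f \<in> pos_uo" "\<alpha> \<in> Field r"
      by (auto simp: Lo_def)
    have "xM \<beta> \<in> S" if "(\<alpha>, \<beta>) \<in> r" for \<beta>
      unfolding S(1) xM_def using inc[OF that] M(1)
      by (auto intro!: pos_uo_mono[OF S(2)] scaleR_left_mono)
    with S(3) show ?thesis by blast
  next
    assume "S \<in> Up"
    then obtain f u where S: "S = {v. f v \<le> f u}" "f \<in> pos_uo" "\<forall>\<alpha>\<in>Field r. xM \<alpha> \<le> u"
      by (auto simp: Up_def)
    obtain \<alpha> where "\<alpha> \<in> Field r" using D(4) by blast
    moreover have "xM \<beta> \<in> S" if "(\<alpha>, \<beta>) \<in> r" for \<beta>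
      unfolding S(1) using S(3) FieldI2[OF that] by (auto intro!: pos_uo_mono[OF S(2)])
    ultimately show ?thesis by blast
  qed
  have fin: "\<exists>\<alpha>\<in>Field r. \<forall>\<beta>. (\<alpha>, \<beta>) \<in> r \<longrightarrow> xM \<beta> \<in> \<Inter>\<F>" if "finite \<F>" "\<F> \<subseteq> Lo \<union> Up" for \<F>
    using that
  proof (induction \<F>)
    case empty
    then show ?case using D(4) by auto
  next
    case (insert S \<F>)
    then obtain \<alpha> where \<alpha>: "\<alpha> \<in> Field r" "\<And>\<beta>. (\<alpha>, \<beta>) \<in> r \<Longrightarrow> xM \<beta> \<in> \<Inter>\<F>" by auto
    obtain \<alpha>' where \<alpha>': "\<alpha>' \<in> Field r" "\<And>\<beta>. (\<alpha>', \<beta>) \<in> r \<Longrightarrow> xM \<beta> \<in> S"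
      using ev[of S] insert.prems by blast
    obtain \<gamma> where \<gamma>: "(\<alpha>, \<gamma>) \<in> r" "(\<alpha>', \<gamma>) \<in> r" using D(3)[OF \<alpha>(1) \<alpha>'(1)] by blast
    have "xM \<beta> \<in> \<Inter>(insert S \<F>)" if "(\<gamma>, \<beta>) \<in> r" for \<beta>
      using \<alpha>(2)[OF D(2)[OF \<gamma>(1) that]] \<alpha>'(2)[OF D(2)[OF \<gamma>(2) that]] by simp
    with FieldI2[OF \<gamma>(1)] show ?case by blast
  qed
  have "K \<inter> \<Inter>(Lo \<union> Up) \<noteq> {}"
  proof -
    have "\<forall>S\<in>Lo \<union> Up. closedin uo_weak_topology S" using closed by (auto simp: Lo_def Up_def)
    moreover have "K \<inter> \<Inter>\<F> \<noteq> {}" if F: "finite \<F> \<and> \<F> \<subseteq> Lo \<union> Up" for \<F>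
    proof -
      obtain \<alpha> where \<alpha>: "\<alpha> \<in> Field r" "\<And>\<beta>. (\<alpha>, \<beta>) \<in> r \<Longrightarrow> xM \<beta> \<in> \<Inter>\<F>" using fin F by blast
      then have "xM \<alpha> \<in> K \<inter> \<Inter>\<F>" using xK D(1) by blast
      then show ?thesis by blast
    qed
    ultimately show ?thesis using cK unfolding compactin_fip by blast
  qed
  then obtain v where v: "v \<in> \<Inter>(Lo \<union> Up)" by blast
  have lo: "f (xM \<alpha>) \<le> f v" if "f \<in> pos_uo" "\<alpha> \<in> Field r" for f \<alpha>
  proof -
    have "{v. f (xM \<alpha>) \<le> f v} \<in> Lo" unfolding Lo_def using that by blast
    with v show ?thesis by blast
  qed
  have up: "f v \<le> f u" if "f \<in> pos_uo" "\<forall>\<alpha>\<in>Field r. xM \<alpha> \<le> u" for f u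
  proof -
    have "{v. f v \<le> f u} \<in> Up" unfolding Up_def using that by blast
    with v show ?thesis by blast
  qed
  have le: "a \<le> b" if "\<And>f. f \<in> pos_uo \<Longrightarrow> f a \<le> f b" for a b :: 'a
  proof -
    have "0 \<le> b - a"
      by (rule pos_uo_nonneg_imp_nonneg[OF sep]) (simp add: that linear_diff[OF pos_uo_D(2)])
    then show ?thesis by simp
  qed
  have "isLub UNIV (x ` Field r) (M *\<^sub>R v)"
    unfolding isLub_UNIV_iff
  proof (intro conjI ballI allI impI)
    fix y assume "y \<in> x ` Field r"
    then obtain \<alpha> where \<alpha>: "\<alpha> \<in> Field r" "y = x \<alpha>" by blast
    have "xM \<alpha> \<le> v" using lo[OF _ \<alpha>(1)] by (rule le)
    then have "M *\<^sub>R xM \<alpha> \<le> M *\<^sub>R v" using M(1) by (intro scaleR_left_mono) auto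
    then show "y \<le> M *\<^sub>R v" using M(1) by (simp add: xM_def \<alpha>(2))
  next
    fix u assume u: "\<forall>y\<in>x ` Field r. y \<le> u"
    have "\<forall>\<alpha>\<in>Field r. xM \<alpha> \<le> (1/M) *\<^sub>R u"
      unfolding xM_def using u M(1) by (auto intro!: scaleR_left_mono)
    then have "v \<le> (1/M) *\<^sub>R u" using up by (intro le) blast
    then have "M *\<^sub>R v \<le> M *\<^sub>R (1/M) *\<^sub>R u" using M(1) by (intro scaleR_left_mono) auto
    then show "M *\<^sub>R v \<le> u" using M(1) by simp
  qed
  then show "\<exists>u. isLub UNIV (x ` Field r) u" by blast
qed

section \<open>Bounded uo-completeness\<close>

text \<open>Truncate at \<open>w\<close> itself: the truncated distance equals \<open>w\<close>
  arbitrarily late, so \<open>w\<close> is a lower bound of the net decreasing to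
  \<open>0\<close>.\<close>

lemma uo_converges_frequent_bound:
  fixes x :: "'i \<Rightarrow> 'a::banach_lattice"
  assumes r: "directed_preorder r" and uo: "uo_converges r x l" and w: "0 \<le> w"
    and le: "\<And>\<alpha>. \<alpha> \<in> Field r \<Longrightarrow> \<exists>\<beta>. (\<alpha>, \<beta>) \<in> r \<and> w \<le> \<bar>x \<beta> - l\<bar>"
  shows "w = 0"
proof -
  have "order_converges r (\<lambda>\<alpha>. inf \<bar>x \<alpha> - l\<bar> w) 0" using uo w by (simp add: uo_converges_def)
  then obtain s and y :: "'a net_index \<Rightarrow> 'a" where y: "decreases_to s y 0"
    and *: "\<And>\<gamma>. \<gamma> \<in> Field s \<Longrightarrow> \<exists>\<alpha>\<^sub>0\<in>Field r. \<forall>\<alpha>. (\<alpha>\<^sub>0, \<alpha>) \<in> r \<longrightarrow> \<bar>inf (\<bar>x \<alpha> - l\<bar>) w - 0\<bar> \<le> y \<gamma>"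
    unfolding order_converges_def by blast
  have "w \<le> y \<gamma>" if \<gamma>: "\<gamma> \<in> Field s" for \<gamma>
  proof -
    obtain \<alpha> where \<alpha>: "\<alpha> \<in> Field r" "\<And>\<beta>. (\<alpha>, \<beta>) \<in> r \<Longrightarrow> \<bar>inf (\<bar>x \<beta> - l\<bar>) w - 0\<bar> \<le> y \<gamma>"
      using *[OF \<gamma>] by blast
    obtain \<beta> where "(\<alpha>, \<beta>) \<in> r" "w \<le> \<bar>x \<beta> - l\<bar>" using le[OF \<alpha>(1)] by blast
    with \<alpha>(2)[of \<beta>] w show ?thesis by (simp add: inf_absorb2)
  qed
  then have "w \<le> 0" using y by (auto simp: decreases_to_def isGlb_UNIV_iff)
  with w show ?thesis by simp
qed

lemma increasing_net_uo_limit_isLub: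
  fixes x :: "'i \<Rightarrow> 'a::banach_lattice"
  assumes r: "directed_preorder r" and inc: "increasing_net r x" and uo: "uo_converges r x l"
  shows "isLub UNIV (x ` Field r) l"
  unfolding isLub_UNIV_iff
proof (intro conjI ballI allI impI)
  note D = directed_preorderD[OF r]
  have mono: "x \<alpha> \<le> x \<beta>" if "(\<alpha>, \<beta>) \<in> r" for \<alpha> \<beta> using inc that by (auto simp: increasing_net_def)
  fix v assume "v \<in> x ` Field r"
  then obtain \<alpha> where \<alpha>: "\<alpha> \<in> Field r" "v = x \<alpha>" by blast
  have "pprt (v - l) = 0"
  proof (rule uo_converges_frequent_bound[OF r uo])
    fix \<beta> assume \<beta>: "\<beta> \<in> Field r"
    obtain \<gamma> where \<gamma>: "(\<alpha>, \<gamma>) \<in> r" "(\<beta>, \<gamma>) \<in> r" using D(3)[OF \<alpha>(1) \<beta>] by blast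
    have "pprt (v - l) \<le> pprt (x \<gamma> - l)"
      unfolding \<alpha>(2) by (intro pprt_mono diff_right_mono mono \<gamma>)
    also have "\<dots> \<le> \<bar>x \<gamma> - l\<bar>" by (simp add: abs_eq_pprt_add)
    finally show "\<exists>\<gamma>. (\<beta>, \<gamma>) \<in> r \<and> pprt (v - l) \<le> \<bar>x \<gamma> - l\<bar>" using \<gamma>(2) by blast
  qed simp
  then show "v \<le> l" by (simp add: le_zero_iff_zero_pprt[symmetric])
next
  fix u assume u: "\<forall>v\<in>x ` Field r. v \<le> u"
  have "pprt (l - u) = 0"
  proof (rule uo_converges_frequent_bound[OF r uo])
    fix \<beta> assume \<beta>: "\<beta> \<in> Field r"
    have "pprt (l - u) \<le> pprt (l - x \<beta>)" using u \<beta> by (intro pprt_mono diff_left_mono) auto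
    also have "\<dots> \<le> \<bar>l - x \<beta>\<bar>" by (simp add: abs_eq_pprt_add)
    finally show "\<exists>\<gamma>. (\<beta>, \<gamma>) \<in> r \<and> pprt (l - u) \<le> \<bar>x \<gamma> - l\<bar>"
      using directed_preorderD(1)[OF r \<beta>] by (metis abs_minus_commute)
  qed simp
  then show "l \<le> u" by (simp add: le_zero_iff_zero_pprt[symmetric])
qed

text \<open>Upper bounds remain upper bounds after subtracting \<open>pprt v\<close>, hence after
  subtracting any multiple of it, and the Archimedean property ends the descent. This does the work
  of a supremum of \<open>S\<close>, which may not exist.\<close>

lemma upper_bounds_diff_glb:
  fixes S :: "'a::banach_lattice set"
  assumes s0: "s\<^sub>0 \<in> S" and d0: "\<And>s. s \<in> S \<Longrightarrow> s \<le> d\<^sub>0"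
    and v: "\<And>d s. (\<And>s. s \<in> S \<Longrightarrow> s \<le> d) \<Longrightarrow> s \<in> S \<Longrightarrow> v \<le> d - s"
  shows "v \<le> 0"
proof -
  have "\<forall>s\<in>S. s \<le> d\<^sub>0 - real n *\<^sub>R pprt v" for n
  proof (induction n)
    case (Suc n)
    show ?case
    proof
      fix s assume s: "s \<in> S"
      have "v \<le> (d\<^sub>0 - real n *\<^sub>R pprt v) - s" using Suc s by (intro v) auto
      moreover have "0 \<le> (d\<^sub>0 - real n *\<^sub>R pprt v) - s" using Suc s by simp
      ultimately have "pprt v \<le> (d\<^sub>0 - real n *\<^sub>R pprt v) - s" by (simp add: pprt_def)
      then show "s \<le> d\<^sub>0 - real (Suc n) *\<^sub>R pprt v" by (simp add: algebra_simps)
    qed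
  qed (use d0 in auto)
  then have "real n *\<^sub>R pprt v \<le> d\<^sub>0 - s\<^sub>0" for n using s0 by (auto simp: algebra_simps)
  then have "pprt v \<le> 0" by (rule archimedean)
  then show ?thesis by (simp add: pprt_def)
qed

text \<open>The net may lack a supremum, so the truncated increments beyond \<alpha> are controlled
  by their upper bounds, collected in \<open>E\<close>. That \<open>E\<close> has infimum
  \<open>0\<close> is tested by positive functionals, under which the net converges because it is
  increasing and bounded.\<close>

lemma bounded_increasing_net_uo_Cauchy:
  fixes x :: "'i \<Rightarrow> 'a::banach_lattice"
  assumes sep: "uo_dual_separates_points TYPE('a)" and r: "directed_preorder r"
    and b: "bounded (x ` Field r)" and inc: "increasing_net r x"
  shows "uo_Cauchy r x"
  unfolding uo_Cauchy_def uo_converges_def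
proof (intro allI impI)
  fix z :: 'a assume z: "0 \<le> z"
  note D = directed_preorderD[OF r]
  have mono: "x \<alpha> \<le> x \<beta>" if "(\<alpha>, \<beta>) \<in> r" for \<alpha> \<beta> using inc that by (auto simp: increasing_net_def)
  define S where "S \<alpha> = {inf (x \<beta> - x \<alpha>) z | \<beta>. (\<alpha>, \<beta>) \<in> r}" for \<alpha>
  define E where "E = {d. \<exists>\<alpha>\<in>Field r. \<forall>s\<in>S \<alpha>. s \<le> d}"
  have S0: "0 \<in> S \<alpha>" if "\<alpha> \<in> Field r" for \<alpha>
    unfolding S_def using D(1)[OF that] z by (auto intro!: exI[of _ \<alpha>] simp: inf_absorb1)
  have Ez: "z \<in> E" using D(4) by (auto simp: E_def S_def)
  have E0: "0 \<le> d" if "d \<in> E" for d using that S0 by (auto simp: E_def)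
  have dirE: "inf a b \<in> E" if ab: "a \<in> E" "b \<in> E" for a b
  proof -
    obtain \<alpha> \<beta> where \<alpha>: "\<alpha> \<in> Field r" "\<forall>s\<in>S \<alpha>. s \<le> a" and \<beta>: "\<beta> \<in> Field r" "\<forall>s\<in>S \<beta>. s \<le> b"
      using ab by (auto simp: E_def)
    obtain \<gamma> where \<gamma>: "(\<alpha>, \<gamma>) \<in> r" "(\<beta>, \<gamma>) \<in> r" using D(3)[OF \<alpha>(1) \<beta>(1)] by blast
    have "s \<le> inf a b" if s: "s \<in> S \<gamma>" for s
    proof -
      obtain \<delta> where \<delta>: "s = inf (x \<delta> - x \<gamma>) z" "(\<gamma>, \<delta>) \<in> r" using s by (auto simp: S_def)
      have "s \<le> inf (x \<delta> - x \<alpha>) z" "s \<le> inf (x \<delta> - x \<beta>) z"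
        unfolding \<delta>(1) by (intro inf_mono diff_left_mono mono \<gamma> order_refl)+
      moreover have "inf (x \<delta> - x \<alpha>) z \<in> S \<alpha>" "inf (x \<delta> - x \<beta>) z \<in> S \<beta>"
        using D(2)[OF \<gamma>(1) \<delta>(2)] D(2)[OF \<gamma>(2) \<delta>(2)] by (auto simp: S_def)
      ultimately have "s \<le> a" "s \<le> b" using \<alpha>(2) \<beta>(2) by (meson order_trans)+
      then show ?thesis by simp
    qed
    then show ?thesis using FieldI2[OF \<gamma>(1)] by (auto simp: E_def)
  qed
  have Einf: "v \<le> 0" if v: "\<And>d. d \<in> E \<Longrightarrow> v \<le> d" for v
  proof -
    have pv: "pprt v \<le> d" if "d \<in> E" for d using v[OF that] E0[OF that] by (simp add: pprt_def)
    have "pprt v = 0"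
    proof (rule uo_dual_separates_points_eq_0[OF sep])
      fix f :: "'a \<Rightarrow> real" assume f: "f \<in> pos_uo"
      note lin = pos_uo_D(2)[OF f]
      obtain K where K: "0 \<le> K" "\<And>x. \<bar>f x\<bar> \<le> K * norm x"
        using uo_functionals_bounded[OF pos_uo_D(1)[OF f]] by blast
      obtain M where M: "\<And>\<alpha>. \<alpha> \<in> Field r \<Longrightarrow> norm (x \<alpha>) \<le> M" using b by (auto simp: bounded_iff)
      have "f (x \<alpha>) \<le> K * M" if "\<alpha> \<in> Field r" for \<alpha>
        using K(2)[of "x \<alpha>"] mult_left_mono[OF M[OF that] K(1)] by linarith
      then have bdd: "bdd_above ((\<lambda>\<alpha>. f (x \<alpha>)) ` Field r)" by (intro bdd_aboveI2)
      have "f (pprt v) \<le> 0 + e" if e: "0 < e" for e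
      proof -
        \<comment> \<open>Beyond \<alpha> the values of \<open>f\<close> along the net can rise by
          less than \<open>e/2\<close>, so \<open>f\<close> is at most \<open>e/2\<close> on all
          later increments.\<close>
        obtain \<alpha> where \<alpha>: "\<alpha> \<in> Field r" "(SUP \<alpha>\<in>Field r. f (x \<alpha>)) - e/2 < f (x \<alpha>)"
          using less_cSUP_iff[OF D(4) bdd, of "(SUP \<alpha>\<in>Field r. f (x \<alpha>)) - e/2"] e by auto
        have small: "f s \<le> e/2" if s: "s \<in> S \<alpha>" for s
        proof -
          obtain \<beta> where \<beta>: "s = inf (x \<beta> - x \<alpha>) z" "(\<alpha>, \<beta>) \<in> r" using s by (auto simp: S_def)
          have "f s \<le> f (x \<beta> - x \<alpha>)" unfolding \<beta>(1) by (intro pos_uo_mono[OF f]) simp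
          moreover have "f (x \<beta>) \<le> (SUP \<alpha>\<in>Field r. f (x \<alpha>))"
            using FieldI2[OF \<beta>(2)] by (intro cSUP_upper bdd)
          ultimately show ?thesis using \<alpha>(2) by (simp add: linear_diff[OF lin])
        qed
        \<comment> \<open>Gaps between upper bounds and members of \<open>S \<alpha>\<close> are
          directed downwards with infimum \<open>0\<close>. A gap of \<open>f\<close>-value below
          \<open>e/2\<close> above an increment of \<open>f\<close>-value at most \<open>e/2\<close>
          gives some \<open>d\<close> in \<open>E\<close> with \<open>f d < e\<close>.\<close>
        define T where "T = {d - s | d s. (\<forall>s\<in>S \<alpha>. s \<le> d) \<and> s \<in> S \<alpha>}"
        have "\<exists>t\<in>T. f t < e/2"
        proof (rule pos_uo_order_continuous[OF f, of T "e/2"])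
          show "T \<noteq> {}" using S0[OF \<alpha>(1)] by (auto simp: T_def S_def intro!: exI[of _ z])
          show "\<exists>c\<in>T. c \<le> a \<and> c \<le> b" if ab: "a \<in> T" "b \<in> T" for a b
          proof -
            obtain d s d' s' where *: "a = d - s" "\<forall>s\<in>S \<alpha>. s \<le> d" "s \<in> S \<alpha>"
              "b = d' - s'" "\<forall>s\<in>S \<alpha>. s \<le> d'" "s' \<in> S \<alpha>" using ab by (auto simp: T_def)
            obtain \<beta> \<beta>' where \<beta>: "s = inf (x \<beta> - x \<alpha>) z" "(\<alpha>, \<beta>) \<in> r"
              "s' = inf (x \<beta>' - x \<alpha>) z" "(\<alpha>, \<beta>') \<in> r" using *(3,6) by (auto simp: S_def)
            obtain \<gamma> where \<gamma>: "(\<beta>, \<gamma>) \<in> r" "(\<beta>', \<gamma>) \<in> r"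
              using D(3)[OF FieldI2[OF \<beta>(2)] FieldI2[OF \<beta>(4)]] by blast
            define s'' where "s'' = inf (x \<gamma> - x \<alpha>) z"
            have s''S: "s'' \<in> S \<alpha>" using D(2)[OF \<beta>(2) \<gamma>(1)] by (auto simp: s''_def S_def)
            have le: "s \<le> s''" "s' \<le> s''"
              unfolding \<beta>(1,3) s''_def by (intro inf_mono diff_right_mono mono \<gamma> order_refl)+
            have "inf d d' - s'' \<in> T"
              unfolding T_def using s''S *(2,5)
              by (intro CollectI exI[of _ "inf d d'"] exI[of _ s'']) auto
            moreover have "inf d d' - s'' \<le> a" "inf d d' - s'' \<le> b"
              unfolding *(1,4) using le by (intro diff_mono; simp)+
            ultimately show ?thesis by blast
          qed
          show "0 \<le> t" if "t \<in> T" for t using that by (auto simp: T_def)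
          show "w \<le> 0" if w: "\<And>t. t \<in> T \<Longrightarrow> w \<le> t" for w
          proof (rule upper_bounds_diff_glb[OF S0[OF \<alpha>(1)], of z])
            show "s \<le> z" if "s \<in> S \<alpha>" for s using that by (auto simp: S_def)
            show "w \<le> d - s" if "\<And>s. s \<in> S \<alpha> \<Longrightarrow> s \<le> d" "s \<in> S \<alpha>" for d s
              using that by (intro w) (auto simp: T_def)
          qed
        qed (use e in auto)
        then obtain d s where d: "\<forall>s\<in>S \<alpha>. s \<le> d" "s \<in> S \<alpha>" "f (d - s) < e/2" by (auto simp: T_def)
        have "d \<in> E" using d(1) \<alpha>(1) by (auto simp: E_def)
        from pos_uo_mono[OF f pv[OF this]] have "f (pprt v) \<le> f d" .
        also have "f d = f (d - s) + f s" by (simp add: linear_diff[OF lin])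
        finally show ?thesis using d(3) small[OF d(2)] by linarith
      qed
      then have "f (pprt v) \<le> 0" by (rule field_le_epsilon)
      then show "f (pprt v) = 0" using pos_uo_D(3)[OF f, of "pprt v"] by simp
    qed
    then show ?thesis by (simp add: le_zero_iff_zero_pprt)
  qed
  show "order_converges (product_preorder r r) (\<lambda>p. inf \<bar>(case p of (\<alpha>, \<beta>) \<Rightarrow> x \<alpha> - x \<beta>) - 0\<bar> z) 0"
  proof (rule order_converges_downward_directed[where D = E])
    show "E \<noteq> {}" using Ez by blast
    show "\<exists>c\<in>E. c \<le> a \<and> c \<le> b" if "a \<in> E" "b \<in> E" for a b
      using dirE[OF that] by (intro bexI[of _ "inf a b"]) auto
    fix d assume "d \<in> E"
    then obtain \<alpha> where \<alpha>: "\<alpha> \<in> Field r" "\<forall>s\<in>S \<alpha>. s \<le> d" by (auto simp: E_def)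
    have "inf \<bar>x \<beta> - x \<beta>'\<bar> z \<le> d" if \<beta>: "(\<alpha>, \<beta>) \<in> r" "(\<alpha>, \<beta>') \<in> r" for \<beta> \<beta>'
    proof -
      obtain \<gamma> where \<gamma>: "(\<beta>, \<gamma>) \<in> r" "(\<beta>', \<gamma>) \<in> r"
        using D(3)[OF FieldI2[OF \<beta>(1)] FieldI2[OF \<beta>(2)]] by blast
      have "\<bar>x \<beta> - x \<beta>'\<bar> \<le> x \<gamma> - x \<alpha>"
        using diff_mono[OF mono[OF \<gamma>(1)] mono[OF \<beta>(2)]] diff_mono[OF mono[OF \<gamma>(2)] mono[OF \<beta>(1)]]
        by (intro abs_leI) simp_all
      then have "inf \<bar>x \<beta> - x \<beta>'\<bar> z \<le> inf (x \<gamma> - x \<alpha>) z" by (intro inf_mono) auto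
      also have "\<dots> \<le> d" using \<alpha>(2) D(2)[OF \<beta>(1) \<gamma>(1)] by (auto simp: S_def)
      finally show ?thesis .
    qed
    then show "\<exists>\<alpha>\<^sub>0\<in>Field (product_preorder r r). \<forall>p. (\<alpha>\<^sub>0, p) \<in> product_preorder r r \<longrightarrow>
        \<bar>inf (\<bar>(case p of (\<alpha>, \<beta>) \<Rightarrow> x \<alpha> - x \<beta>) - 0\<bar>) z - 0\<bar> \<le> d"
      using \<alpha>(1) z unfolding product_preorder(2)[OF r r]
      by (intro bexI[of _ "(\<alpha>, \<alpha>)"]) (auto simp: product_preorder_def)
  qed (rule E0, assumption, rule Einf, blast)
qed

lemma boundedly_uo_complete_imp_monotonically_complete:
  assumes sep: "uo_dual_separates_points TYPE('a::banach_lattice)"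
    and uc: "boundedly_uo_complete TYPE('a)"
  shows "monotonically_complete TYPE('a)"
  unfolding monotonically_complete_def
proof (intro allI impI)
  fix r :: "'a net_index rel" and x :: "'a net_index \<Rightarrow> 'a"
  assume *: "directed_preorder r \<and> bounded (x ` Field r) \<and> (\<forall>\<alpha>\<in>Field r. 0 \<le> x \<alpha>) \<and> increasing_net r x"
  then have "uo_Cauchy r x" by (intro bounded_increasing_net_uo_Cauchy[OF sep]) auto
  with uc * obtain l where "uo_converges r x l" unfolding boundedly_uo_complete_def by blast
  with * have "isLub UNIV (x ` Field r) l" by (intro increasing_net_uo_limit_isLub) auto
  then show "\<exists>u. isLub UNIV (x ` Field r) u" ..
qed

section \<open>From representation of functionals to uo-limits\<close>

text \<open>The absolute differences form a bounded uo-null double net, to which \<open>f\<close>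
  applies. An index above both coordinates of the threshold pair serves as a single
  threshold.\<close>

lemma bounded_uo_Cauchy_abs_small:
  fixes x :: "'i \<Rightarrow> 'a::banach_lattice"
  assumes r: "directed_preorder r" and b: "bounded (x ` Field r)" and c: "uo_Cauchy r x"
    and f: "f \<in> pos_uo" and e: "0 < (e::real)"
  obtains \<alpha> where "\<alpha> \<in> Field r" "\<And>\<beta> \<gamma>. (\<alpha>, \<beta>) \<in> r \<Longrightarrow> (\<alpha>, \<gamma>) \<in> r \<Longrightarrow> f \<bar>x \<beta> - x \<gamma>\<bar> < e"
proof -
  note D = directed_preorderD[OF r]
  note P = product_preorder[OF r r]
  obtain M where M: "\<And>\<alpha>. \<alpha> \<in> Field r \<Longrightarrow> norm (x \<alpha>) \<le> M" using b by (auto simp: bounded_iff)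
  define w where "w p = \<bar>x (fst p) - x (snd p)\<bar>" for p
  have "norm (w p) \<le> M + M" if "p \<in> Field (product_preorder r r)" for p
    using that M[of "fst p"] M[of "snd p"] norm_triangle_ineq4[of "x (fst p)" "x (snd p)"]
    by (auto simp: P(2) w_def)
  then have "bounded (w ` Field (product_preorder r r))" unfolding bounded_iff by blast
  moreover have "uo_converges (product_preorder r r) w 0"
    by (rule uo_converges_0_dominated[OF c[unfolded uo_Cauchy_def]]) (auto simp: w_def)
  ultimately have "((\<lambda>p. f (w p)) \<longlongrightarrow> 0) (net_filter (product_preorder r r))"
    by (intro uo_functionals_tendsto[OF pos_uo_D(1)[OF f] P(1)])
  from tendstoD[OF this e] obtain p where p: "p \<in> Field (product_preorder r r)"
    "\<And>q. (p, q) \<in> product_preorder r r \<Longrightarrow> \<bar>f (w q)\<bar> < e"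
    unfolding eventually_net_filter[OF P(1)] by auto
  obtain \<alpha> \<alpha>' where \<alpha>: "p = (\<alpha>, \<alpha>')" "\<alpha> \<in> Field r" "\<alpha>' \<in> Field r" using p(1) by (auto simp: P(2))
  obtain \<delta> where \<delta>: "(\<alpha>, \<delta>) \<in> r" "(\<alpha>', \<delta>) \<in> r" using D(3)[OF \<alpha>(2,3)] by blast
  have "f \<bar>x \<beta> - x \<gamma>\<bar> < e" if "(\<delta>, \<beta>) \<in> r" "(\<delta>, \<gamma>) \<in> r" for \<beta> \<gamma>
  proof -
    have "(p, (\<beta>, \<gamma>)) \<in> product_preorder r r"
      using D(2)[OF \<delta>(1) that(1)] D(2)[OF \<delta>(2) that(2)] by (simp add: \<alpha>(1) product_preorder_def)
    from p(2)[OF this] show ?thesis by (simp add: w_def)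
  qed
  with FieldI2[OF \<delta>(1)] show ?thesis by (rule that)
qed

lemma lattice_iso_imp_boundedly_uo_complete:
  assumes sep: "uo_dual_separates_points TYPE('a::banach_lattice)"
    and iso: "lattice_iso_onto_uo_dual_dual (uo_evaluation :: 'a \<Rightarrow> ('a \<Rightarrow>\<^sub>L real) \<Rightarrow> real)"
  shows "boundedly_uo_complete TYPE('a)"
  unfolding boundedly_uo_complete_def
proof (intro allI impI)
  fix r :: "'a net_index rel" and x :: "'a net_index \<Rightarrow> 'a"
  assume *: "directed_preorder r \<and> bounded (x ` Field r) \<and> uo_Cauchy r x"
  then have r: "directed_preorder r" and b: "bounded (x ` Field r)" and c: "uo_Cauchy r x" by auto
  note D = directed_preorderD[OF r]
  note ev_iff = eventually_net_filter[OF r]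
  obtain M where M: "\<And>\<alpha>. \<alpha> \<in> Field r \<Longrightarrow> norm (x \<alpha>) \<le> M" using b by (auto simp: bounded_iff)
  have ev_Field: "eventually (\<lambda>\<alpha>. \<alpha> \<in> Field r) (net_filter r)"
  proof -
    obtain \<alpha> where "\<alpha> \<in> Field r" using D(4) by blast
    then show ?thesis unfolding ev_iff by (intro bexI[of _ \<alpha>]) (auto intro: FieldI2)
  qed
  have nbot: "net_filter r \<noteq> bot"
    unfolding trivial_limit_def ev_iff by (auto dest: D(1))
  have lim: "\<exists>L. ((\<lambda>\<alpha>. f (x \<alpha>)) \<longlongrightarrow> L) (net_filter r)" if f: "f \<in> uo_functionals" for f
  proof -
    obtain h where h: "h \<in> pos_uo" "\<And>z. \<bar>f z\<bar> \<le> h \<bar>z\<bar>" using uo_functionals_dominating[OF f] by blast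
    have "cauchy_filter (filtermap (\<lambda>\<alpha>. f (x \<alpha>)) (net_filter r))"
      unfolding cauchy_filter_metric_filtermap
    proof (intro allI impI)
      fix e :: real assume e: "0 < e"
      obtain \<alpha> where \<alpha>: "\<alpha> \<in> Field r" "\<And>\<beta> \<gamma>. (\<alpha>, \<beta>) \<in> r \<Longrightarrow> (\<alpha>, \<gamma>) \<in> r \<Longrightarrow> h \<bar>x \<beta> - x \<gamma>\<bar> < e"
        using bounded_uo_Cauchy_abs_small[OF r b c h(1) e] by blast
      have "dist (f (x \<beta>)) (f (x \<gamma>)) < e" if "(\<alpha>, \<beta>) \<in> r" "(\<alpha>, \<gamma>) \<in> r" for \<beta> \<gamma>
        using \<alpha>(2)[OF that] h(2)[of "x \<beta> - x \<gamma>"]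
        by (simp add: dist_real_def linear_diff[OF uo_functionals_linear[OF f]])
      then show "\<exists>P. eventually P (net_filter r) \<and> (\<forall>\<beta> \<gamma>. P \<beta> \<and> P \<gamma> \<longrightarrow> dist (f (x \<beta>)) (f (x \<gamma>)) < e)"
        using \<alpha>(1) unfolding ev_iff by (intro exI[of _ "\<lambda>\<beta>. (\<alpha>, \<beta>) \<in> r"]) auto
    qed
    then have "\<exists>L. filtermap (\<lambda>\<alpha>. f (x \<alpha>)) (net_filter r) \<le> nhds L"
      using complete_UNIV[where 'a = real] nbot unfolding complete_uniform by (simp add: filtermap_bot_iff)
    then show ?thesis by (simp add: filterlim_def)
  qed
  define G where "G f = Lim (net_filter r) (\<lambda>\<alpha>. f (x \<alpha>))" for f :: "'a \<Rightarrow> real"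
  have G: "((\<lambda>\<alpha>. f (x \<alpha>)) \<longlongrightarrow> G f) (net_filter r)" if "f \<in> uo_functionals" for f
    using lim[OF that] tendsto_Lim[OF nbot] unfolding G_def by blast
  have Geq: "G f = L" if "f \<in> uo_functionals" "((\<lambda>\<alpha>. f (x \<alpha>)) \<longlongrightarrow> L) (net_filter r)" for f L
    using tendsto_unique[OF nbot G[OF that(1)] that(2)] .
  define F where "F = (\<lambda>\<phi>\<in>uo_dual. G (blinfun_apply \<phi>))"
  have "F \<in> uo_dual_dual"
    unfolding uo_dual_dual_def
  proof (intro CollectI conjI ballI allI)
    show "F \<in> extensional uo_dual" by (simp add: F_def)
    show "F (\<phi> + \<psi>) = F \<phi> + F \<psi>" if "\<phi> \<in> uo_dual" "\<psi> \<in> uo_dual" for \<phi> \<psi>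
    proof -
      have "G (blinfun_apply (\<phi> + \<psi>)) = G (blinfun_apply \<phi>) + G (blinfun_apply \<psi>)"
        using tendsto_add[OF G[OF uo_dualD[OF that(1)]] G[OF uo_dualD[OF that(2)]]]
        by (intro Geq uo_dualD uo_dual_add that) (simp add: plus_blinfun.rep_eq)
      then show ?thesis using that by (simp add: F_def uo_dual_add)
    qed
    show "F (c *\<^sub>R \<phi>) = c * F \<phi>" if "\<phi> \<in> uo_dual" for c \<phi>
    proof -
      have "G (blinfun_apply (c *\<^sub>R \<phi>)) = c * G (blinfun_apply \<phi>)"
        using tendsto_mult_left[OF G[OF uo_dualD[OF that]], of c]
        by (intro Geq uo_dualD uo_dual_scaleR that) (simp add: scaleR_blinfun.rep_eq)
      then show ?thesis using that by (simp add: F_def uo_dual_scaleR)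
    qed
    have "\<bar>F \<phi>\<bar> \<le> M * norm \<phi>" if \<phi>: "\<phi> \<in> uo_dual" for \<phi>
    proof -
      have "((\<lambda>\<alpha>. \<bar>blinfun_apply \<phi> (x \<alpha>)\<bar>) \<longlongrightarrow> \<bar>G (blinfun_apply \<phi>)\<bar>) (net_filter r)"
        by (intro tendsto_rabs G uo_dualD \<phi>)
      moreover have "eventually (\<lambda>\<alpha>. \<bar>blinfun_apply \<phi> (x \<alpha>)\<bar> \<le> M * norm \<phi>) (net_filter r)"
        using ev_Field
      proof (rule eventually_mono)
        fix \<alpha> assume "\<alpha> \<in> Field r"
        then show "\<bar>blinfun_apply \<phi> (x \<alpha>)\<bar> \<le> M * norm \<phi>"
          using norm_blinfun[of \<phi> "x \<alpha>"] mult_right_mono[OF M, of \<alpha> "norm \<phi>"]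
          by (simp add: mult.commute)
      qed
      ultimately have "\<bar>G (blinfun_apply \<phi>)\<bar> \<le> M * norm \<phi>" by (rule tendsto_upperbound) (rule nbot)
      then show ?thesis using \<phi> by (simp add: F_def)
    qed
    then show "\<exists>C. \<forall>\<phi>\<in>uo_dual. \<bar>F \<phi>\<bar> \<le> C * norm \<phi>" by blast
  qed
  then obtain l where l: "F = uo_evaluation l"
    using iso unfolding lattice_iso_onto_uo_dual_dual_def bij_betw_def by blast
  have Gl: "G f = f l" if "f \<in> uo_functionals" for f
    using fun_cong[OF l, of "Blinfun f"] uo_dual_Blinfun[OF that] by (simp add: F_def uo_evaluation_def)
  \<comment> \<open>The limit under each single functional is strengthened to the seminorm of
    \<open>f\<close>: a functional in \<open>[-f, f]\<close> attains
    \<open>f \<bar>x \<beta> - l\<bar>\<close>, and only its limit along the second index is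
    needed.\<close>
  have small: "\<exists>\<alpha>\<in>Field r. \<forall>\<beta>. (\<alpha>, \<beta>) \<in> r \<longrightarrow> f \<bar>x \<beta> - l\<bar> \<le> e" if f: "f \<in> pos_uo" and e: "0 < e" for f e
  proof -
    obtain \<alpha> where \<alpha>: "\<alpha> \<in> Field r" "\<And>\<beta> \<gamma>. (\<alpha>, \<beta>) \<in> r \<Longrightarrow> (\<alpha>, \<gamma>) \<in> r \<Longrightarrow> f \<bar>x \<beta> - x \<gamma>\<bar> < e"
      using bounded_uo_Cauchy_abs_small[OF r b c f e] by blast
    have "f \<bar>x \<beta> - l\<bar> \<le> e" if \<beta>: "(\<alpha>, \<beta>) \<in> r" for \<beta>
    proof -
      obtain g where g: "g \<in> uo_functionals" "\<And>z. \<bar>g z\<bar> \<le> f \<bar>z\<bar>" "g (x \<beta> - l) = f \<bar>x \<beta> - l\<bar>"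
        using pos_uo_abs_attained[OF f] by blast
      note glin = uo_functionals_linear[OF g(1)]
      have "((\<lambda>\<gamma>. g (x \<beta>) - g (x \<gamma>)) \<longlongrightarrow> g (x \<beta>) - g l) (net_filter r)"
        using G[OF g(1)] unfolding Gl[OF g(1)] by (intro tendsto_diff tendsto_const)
      moreover have "eventually (\<lambda>\<gamma>. g (x \<beta>) - g (x \<gamma>) \<le> e) (net_filter r)"
        unfolding ev_iff
      proof (intro bexI[OF _ \<alpha>(1)] allI impI)
        fix \<gamma> assume "(\<alpha>, \<gamma>) \<in> r"
        then show "g (x \<beta>) - g (x \<gamma>) \<le> e"
          using \<alpha>(2)[OF \<beta>] g(2)[of "x \<beta> - x \<gamma>"] by (fastforce simp: linear_diff[OF glin])
      qed
      ultimately have "g (x \<beta>) - g l \<le> e" by (rule tendsto_upperbound) (rule nbot)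
      then show ?thesis using g(3) by (simp add: linear_diff[OF glin])
    qed
    with \<alpha>(1) show ?thesis by blast
  qed
  have "uo_converges r x l"
    unfolding uo_converges_def
  proof (intro allI impI)
    fix z :: 'a assume z: "0 \<le> z"
    obtain s and y :: "'a net_index \<Rightarrow> 'a" where s: "directed_preorder s" "decreases_to s y 0"
      and y: "\<And>\<gamma>. \<gamma> \<in> Field s \<Longrightarrow> \<exists>p\<in>Field (product_preorder r r). \<forall>q. (p, q) \<in> product_preorder r r \<longrightarrow>
        \<bar>inf (\<bar>(case q of (\<alpha>, \<beta>) \<Rightarrow> x \<alpha> - x \<beta>) - 0\<bar>) z - 0\<bar> \<le> y \<gamma>"
      using c z unfolding uo_Cauchy_def uo_converges_def order_converges_def by blast
    show "order_converges r (\<lambda>\<alpha>. inf \<bar>x \<alpha> - l\<bar> z) 0"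
    \<comment> \<open>The net \<open>y\<close> from the Cauchy property is reused. Replacing
      \<open>x \<beta>\<close> by \<open>l\<close> costs at most
      \<open>f \<bar>x \<beta> - l\<bar>\<close> under \<open>f\<close>, which is arbitrarily small
      for late \<beta>, so the bound by \<open>y \<gamma>\<close> persists under every positive
      functional and hence in the order.\<close>
    proof (rule order_converges_toI[OF s])
      fix \<gamma> assume "\<gamma> \<in> Field s"
      from y[OF this] obtain \<alpha>\<^sub>0 \<beta>\<^sub>0 where 0: "\<alpha>\<^sub>0 \<in> Field r" "\<beta>\<^sub>0 \<in> Field r"
        and "\<And>q. ((\<alpha>\<^sub>0, \<beta>\<^sub>0), q) \<in> product_preorder r r \<Longrightarrow>
          \<bar>inf (\<bar>(case q of (\<alpha>, \<beta>) \<Rightarrow> x \<alpha> - x \<beta>) - 0\<bar>) z - 0\<bar> \<le> y \<gamma>"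
        unfolding product_preorder(2)[OF r r] by blast
      from this(3)[of "(_, _)"] have le: "inf \<bar>x \<alpha> - x \<beta>\<bar> z \<le> y \<gamma>"
        if "(\<alpha>\<^sub>0, \<alpha>) \<in> r" "(\<beta>\<^sub>0, \<beta>) \<in> r" for \<alpha> \<beta>
        using that z by (simp add: product_preorder_def)
      have "\<bar>inf (\<bar>x \<alpha> - l\<bar>) z - 0\<bar> \<le> y \<gamma>" if \<alpha>: "(\<alpha>\<^sub>0, \<alpha>) \<in> r" for \<alpha>
      proof -
        have "0 \<le> y \<gamma> - inf \<bar>x \<alpha> - l\<bar> z"
        proof (rule pos_uo_nonneg_imp_nonneg[OF sep])
          fix f :: "'a \<Rightarrow> real" assume f: "f \<in> pos_uo"
          note lin = pos_uo_D(2)[OF f]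
          have "f (inf \<bar>x \<alpha> - l\<bar> z) \<le> f (y \<gamma>) + e" if e: "0 < e" for e
          proof -
            obtain \<alpha>\<^sub>1 where \<alpha>\<^sub>1: "\<alpha>\<^sub>1 \<in> Field r" "\<And>\<beta>. (\<alpha>\<^sub>1, \<beta>) \<in> r \<Longrightarrow> f \<bar>x \<beta> - l\<bar> \<le> e"
              using small[OF f e] by blast
            obtain \<beta> where \<beta>: "(\<beta>\<^sub>0, \<beta>) \<in> r" "(\<alpha>\<^sub>1, \<beta>) \<in> r" using D(3)[OF 0(2) \<alpha>\<^sub>1(1)] by blast
            have "inf \<bar>x \<alpha> - l\<bar> z - inf \<bar>x \<alpha> - x \<beta>\<bar> z \<le> \<bar>inf \<bar>x \<alpha> - l\<bar> z - inf \<bar>x \<alpha> - x \<beta>\<bar> z\<bar>"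
              by (rule abs_ge_self)
            also have "\<dots> \<le> \<bar>\<bar>x \<alpha> - l\<bar> - \<bar>x \<alpha> - x \<beta>\<bar>\<bar>" by (rule abs_inf_diff_le)
            also have "\<dots> \<le> \<bar>(x \<alpha> - l) - (x \<alpha> - x \<beta>)\<bar>" by (rule abs_triangle_ineq3)
            also have "(x \<alpha> - l) - (x \<alpha> - x \<beta>) = x \<beta> - l" by simp
            finally have "f (inf \<bar>x \<alpha> - l\<bar> z - inf \<bar>x \<alpha> - x \<beta>\<bar> z) \<le> f \<bar>x \<beta> - l\<bar>"
              by (rule pos_uo_mono[OF f])
            moreover have "f (inf \<bar>x \<alpha> - x \<beta>\<bar> z) \<le> f (y \<gamma>)"
              by (rule pos_uo_mono[OF f le[OF \<alpha> \<beta>(1)]])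
            ultimately show ?thesis using \<alpha>\<^sub>1(2)[OF \<beta>(2)] unfolding linear_diff[OF lin] by linarith
          qed
          then have "f (inf \<bar>x \<alpha> - l\<bar> z) \<le> f (y \<gamma>)" by (rule field_le_epsilon)
          then show "0 \<le> f (y \<gamma> - inf \<bar>x \<alpha> - l\<bar> z)" by (simp only: linear_diff[OF lin] diff_ge_0_iff_ge)
        qed
        then have "inf \<bar>x \<alpha> - l\<bar> z \<le> y \<gamma>" by (simp only: diff_ge_0_iff_ge)
        then show ?thesis using z by simp
      qed
      with 0(1) show "\<exists>\<alpha>\<^sub>0\<in>Field r. \<forall>\<alpha>. (\<alpha>\<^sub>0, \<alpha>) \<in> r \<longrightarrow> \<bar>inf \<bar>x \<alpha> - l\<bar> z - 0\<bar> \<le> y \<gamma>" by blast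
    qed
  qed
  then show "\<exists>l. uo_converges r x l" ..
qed

theorem theorem3p4:
  assumes "uo_dual_separates_points TYPE('a::banach_lattice)"
  shows
    "(lattice_iso_onto_uo_dual_dual (uo_evaluation :: 'a \<Rightarrow> ('a \<Rightarrow>\<^sub>L real) \<Rightarrow> real)
        \<longleftrightarrow> relatively_compact_in uo_weak_topology (cball (0::'a) 1)) \<and>
     (relatively_compact_in uo_weak_topology (cball (0::'a) 1)
        \<longleftrightarrow> boundedly_uo_complete TYPE('a)) \<and>
     (boundedly_uo_complete TYPE('a) \<longleftrightarrow> monotonically_complete TYPE('a))"
  using lattice_iso_imp_relatively_compact[OF assms] lattice_iso_imp_boundedly_uo_complete[OF assms]
    relatively_compact_imp_monotonically_complete[OF assms]
    boundedly_uo_complete_imp_monotonically_complete[OF assms]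
    monotonically_complete_imp_lattice_iso[OF assms]
  by blast

end
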